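(* Let $p$ be a prime number, $N$ a positive integer, $k\ge 0$ an integer, and let $\Gamma$ be a congruence subgroup of $\mathrm{SL}_2(\mathbb{Z})$ with $\Gamma_1(N)\subset\Gamma\subset\Gamma_0(N)$. Then the $p$-ordinary part of the group of hyperbolic cycles is the whole $p$-ordinary part of the first homology: $$\mathfrak{Z}_{\Gamma,2k}^{p\text{-}\mathrm{ord}} = H_1^{\mathrm{ord}}(\overline{\Gamma},\mathcal{V}_{2k}\otimes_{\mathbb{Z}}\mathbb{Z}_p).$$
   Context: For a subset $A\subset \mathrm{SL}_2(\mathbb{Z})$, $\overline{A}$ is its image in $\mathrm{PSL}_2(\mathbb{Z})=\mathrm{SL}_2(\mathbb{Z})/\{\pm1\}$. Coefficients: $M_2^+(\mathbb{Z})$ is the monoid of integral $2\times2$ matrices of positive determinant. $\mathcal{V}_k=\mathrm{Sym}^k(\mathrm{Hom}(\mathbb{Z}^2,\mathbb{Z}))$ is the group of homogeneous polynomials of degree $k$ in $\mathbb{Z}[X_1,X_2]$, with left $M_2^+(\mathbb{Z})$-action $\left(\begin{smallmatrix}a&b\\c&d\end{smallmatrix}\right)\cdot P(X_1,X_2)=P(dX_1-bX_2,\,-cX_1+aX_2)$. For even $k$ the matrix $-1$ acts trivially. Put $\mathcal{V}_{k,R}=\mathcal{V}_k\otimes_{\mathbb{Z}}R$. Homology: $H_1(\overline\Gamma,\mathcal V)$ is group homology, identified with the set of $\sum_\gamma(\gamma-1)\otimes v_\gamma\in I_{\overline\Gamma}\otimes_{\mathbb{Z}[\overline\Gamma]}\mathcal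 V$ with $\sum_\gamma(\gamma-1)v_\gamma=0$, where $I_{\overline\Gamma}$ is the augmentation ideal of $\mathbb{Z}[\overline\Gamma]$. Hyperbolic cycles: $\gamma=\left(\begin{smallmatrix}a&b\\c&d\end{smallmatrix}\right)\in\mathrm{PSL}_2(\mathbb{Z})$ is hyperbolic if $|\mathrm{trace}(\gamma)|>2$; $\overline\Gamma^{\mathrm{hyp}}$ is the set of hyperbolic elements of $\overline\Gamma$. For hyperbolic $\gamma$ put $Q_\gamma(X_1,X_2)=-\frac{\mathrm{sgn}(a+d)}{\gcd(c,a-d,b)}\left(cX_1^2-(a-d)X_1X_2-bX_2^2\right)\in\mathcal V_2$, which satisfies $\gamma\cdot Q_\gamma=Q_\gamma$. For $\gamma\in\overline\Gamma^{\mathrm{hyp}}$ put $\mathfrak z_{\Gamma,2k}(\gamma)=(\gamma-1)\otimes Q_\gamma^k\in H_1(\overline\Gamma,\mathcal V_{2k})$, and let $\mathfrak Z_{\Gamma,2k}\subset H_1(\overline\Gamma,\mathcal V_{2k})$ be the subgroup generated by all $\mathfrak z_{\Gamma,2k}(\gamma)$, $\gamma\in\overline\Gamma^{\mathrm{hyp}}$. Double coset operators: for congruence subgroups $\Gamma,\Gamma'$, $\alpha\in M_2^+(\mathbb{Z})$ and a left $M_2^+(\mathbb{Z})/\{\pm1\}$-module $\mathcal V$, let $\beta_1,\dots,\beta_r$ represent $\overline{\Gamma'}\backslash\overline{\Gamma'}\alpha\overline{\Gamma}$. The operator $[\Gamma'\alpha\Gamma]:H_i(\overline\Gamma,\mathcal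 V)\to H_i(\overline{\Gamma'},\mathcal V)$ is the $\delta$-functorial extension of $m\mapsto\sum_i\beta_im$ on $H_0$. On $H_1$ it is induced by $(\gamma-1)\otimes v\mapsto\sum_{i=1}^r(\gamma_i'-1)\otimes\beta_{\sigma(i)}v$, where $\beta_i\gamma=\gamma'_i\beta_{\sigma(i)}$ with $\gamma_i'\in\overline{\Gamma'}$. It is independent of choices. Ordinary part: on $H_1(\overline\Gamma,\mathcal V)$ with $\mathcal V$ a finitely generated $\mathbb{Z}_p$-module, let $e_p=\lim_{m\to\infty}[\Gamma\left(\begin{smallmatrix}1&0\\0&p\end{smallmatrix}\right)\Gamma]^{m!}$, an idempotent, and $H_1^{\mathrm{ord}}(\overline\Gamma,\mathcal V)=e_pH_1(\overline\Gamma,\mathcal V)$. Finally, $\mathfrak Z_{\Gamma,2k}^{p\text{-}\mathrm{ord}}=e_p(\mathfrak Z_{\Gamma,2k}\otimes\mathbb{Z}_p)$ is the $\mathbb{Z}_p$-submodule of $H_1^{\mathrm{ord}}(\overline\Gamma,\mathcal V_{2k,\mathbb{Z}_p})$ generated by the elements $e_p\mathfrak z_{\Gamma,2k}(\gamma)$, $\gamma\in\overline\Gamma^{\mathrm{hyp}}$. *)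

theory Defs
  imports
    "HOL-Analysis.Determinants"
    "HOL-Algebra.Free_Abelian_Groups"
    "HOL-Computational_Algebra.Polynomial"
    "Berlekamp_Zassenhaus.Finite_Field"
begin

section \<open>The ring of p-adic integers\<close>

text \<open>
  \<open>'p padic_int\<close> is the inverse limit of the rings \<open>\<int> / p ^ n\<close> for \<open>p = CARD('p)\<close>: the \<open>n\<close>-th
  entry is the representative in \<open>{0..<p ^ n}\<close> of the class modulo \<open>p ^ n\<close> (the defining
  condition forces it into that range).
\<close>

typedef (overloaded) ('p :: prime_card) padic_int =
    "{x :: nat \<Rightarrow> int. \<forall>n. x (Suc n) mod int CARD('p) ^ n = x n}"
  by (rule exI[of _ "\<lambda>_. 0"]) simp

setup_lifting type_definition_padic_int

lemma padic_mod_mod: "(a :: int) mod (q ^ Suc n) mod q ^ n = a mod q ^ n"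
  by (rule mod_mod_cancel) simp

instantiation padic_int :: (prime_card) comm_ring_1
begin

lift_definition zero_padic_int :: "'a padic_int" is "\<lambda>_. 0" by simp

lift_definition one_padic_int :: "'a padic_int" is "\<lambda>n. 1 mod int CARD('a) ^ n"
  by (simp only: padic_mod_mod simp_thms)

lift_definition plus_padic_int :: "'a padic_int \<Rightarrow> 'a padic_int \<Rightarrow> 'a padic_int"
  is "\<lambda>x y n. (x n + y n) mod int CARD('a) ^ n"
  by (metis (no_types, lifting) padic_mod_mod mod_add_eq)

lift_definition minus_padic_int :: "'a padic_int \<Rightarrow> 'a padic_int \<Rightarrow> 'a padic_int"
  is "\<lambda>x y n. (x n - y n) mod int CARD('a) ^ n"
  by (metis (no_types, lifting) padic_mod_mod mod_diff_eq)

lift_definition uminus_padic_int :: "'a padic_int \<Rightarrow> 'a padic_int"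
  is "\<lambda>x n. (- x n) mod int CARD('a) ^ n"
  by (metis (no_types, lifting) padic_mod_mod mod_minus_eq)

lift_definition times_padic_int :: "'a padic_int \<Rightarrow> 'a padic_int \<Rightarrow> 'a padic_int"
  is "\<lambda>x y n. (x n * y n) mod int CARD('a) ^ n"
  by (metis (no_types, lifting) padic_mod_mod mod_mult_eq)

lemma padic_reduced:
  assumes "\<forall>n. x (Suc n) mod int CARD('a :: prime_card) ^ n = x n"
  shows "x n mod int CARD('a) ^ n = x n"
  by (metis assms mod_mod_trivial)

instance
proof
  fix a b c :: "'a padic_int"
  show "a * b * c = a * (b * c)"
    by transfer (simp add: mod_simps mult.assoc)
  show "a * b = b * a"
    by transfer (simp add: mult.commute)
  show "1 * a = a"
    by transfer (simp add: mod_simps padic_reduced)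
  show "a + b + c = a + (b + c)"
    by transfer (simp add: mod_simps add.assoc)
  show "a + b = b + a"
    by transfer (simp add: add.commute)
  show "0 + a = a"
    by transfer (simp add: padic_reduced)
  show "- a + a = 0"
    by transfer (simp add: mod_simps)
  show "a - b = a + - b"
    by transfer (simp add: mod_simps)
  show "(a + b) * c = a * c + b * c"
    by transfer (simp add: mod_simps distrib_right)
  show "(0 :: 'a padic_int) \<noteq> 1"
  proof transfer
    have "1 mod int CARD('a) ^ 1 = 1"
      using prime_gt_1_nat[OF prime_card[where 'a = 'a]] by simp
    then show "(\<lambda>_. 0) \<noteq> (\<lambda>n. 1 mod int CARD('a) ^ n)"
      by (metis zero_neq_one)
  qed
qed

end


section \<open>Matrices and congruence subgroups\<close>

type_synonym mat2 = "int ^ 2 ^ 2"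

definition mat2 :: "int \<Rightarrow> int \<Rightarrow> int \<Rightarrow> int \<Rightarrow> mat2" where
  "mat2 a b c d = vector [vector [a, b], vector [c, d]]"

definition SL2Z :: "mat2 monoid" where
  "SL2Z = \<lparr>carrier = {A. det A = 1}, monoid.mult = (**), one = mat 1\<rparr>"

definition M2plus :: "mat2 monoid" where
  "M2plus = \<lparr>carrier = {A. det A > 0}, monoid.mult = (**), one = mat 1\<rparr>"

abbreviation pm1 :: "mat2 set" where
  "pm1 \<equiv> {mat 1, - mat 1}"

text \<open>
  An element of \<open>PSL2Z\<close> or of \<open>M2plus_bar\<close> is a set \<open>{A, - A}\<close>; the two monoids have the same
  multiplication, so the first is a submonoid of the second.
\<close>

definition PSL2Z :: "mat2 set monoid" where
  "PSL2Z = SL2Z Mod pm1"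

definition M2plus_bar :: "mat2 set monoid" where
  "M2plus_bar = M2plus Mod pm1"

definition bar :: "mat2 \<Rightarrow> mat2 set" where
  "bar A = pm1 #>\<^bsub>M2plus\<^esub> A"

definition bar_group :: "mat2 set \<Rightarrow> mat2 set monoid" where
  "bar_group \<Gamma> = PSL2Z\<lparr>carrier := bar ` \<Gamma>\<rparr>"

definition mat_of :: "mat2 set \<Rightarrow> mat2" where
  "mat_of g = (SOME A. A \<in> g)"

definition Gamma_principal :: "nat \<Rightarrow> mat2 set" where
  "Gamma_principal N = {A \<in> carrier SL2Z.
     [A $ 1 $ 1 = 1] (mod int N) \<and> [A $ 1 $ 2 = 0] (mod int N) \<and>
     [A $ 2 $ 1 = 0] (mod int N) \<and> [A $ 2 $ 2 = 1] (mod int N)}"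

definition Gamma0 :: "nat \<Rightarrow> mat2 set" where
  "Gamma0 N = {A \<in> carrier SL2Z. [A $ 2 $ 1 = 0] (mod int N)}"

definition Gamma1 :: "nat \<Rightarrow> mat2 set" where
  "Gamma1 N = {A \<in> carrier SL2Z.
     [A $ 1 $ 1 = 1] (mod int N) \<and> [A $ 2 $ 1 = 0] (mod int N) \<and> [A $ 2 $ 2 = 1] (mod int N)}"

definition congruence_subgroup :: "mat2 set \<Rightarrow> bool" where
  "congruence_subgroup \<Gamma> \<longleftrightarrow> subgroup \<Gamma> SL2Z \<and> (\<exists>M > 0. Gamma_principal M \<subseteq> \<Gamma>)"


section \<open>Tensor products over a ring\<close>

definition additive_group :: "'a :: ab_group_add set \<Rightarrow> 'a monoid" where
  "additive_group S = \<lparr>carrier = S, monoid.mult = (+), one = 0\<rparr>"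

text \<open>
  The tensor product of a right module \<open>M\<close> (action \<open>ract\<close>) and a left module \<open>N\<close> (action \<open>lact\<close>)
  over a ring with underlying set \<open>S\<close>, as the free abelian group on \<open>M \<times> N\<close> modulo biadditivity
  and balancedness. Like \<^const>\<open>free_Abelian_group\<close> it is an abelian group written
  multiplicatively.
\<close>

definition tensor_relations ::
    "'s set \<Rightarrow> ('m :: ab_group_add \<Rightarrow> 's \<Rightarrow> 'm) \<Rightarrow> 'm set \<Rightarrow>
     ('s \<Rightarrow> 'n :: ab_group_add \<Rightarrow> 'n) \<Rightarrow> 'n set \<Rightarrow> ('m \<times> 'n \<Rightarrow>\<^sub>0 int) set" where
  "tensor_relations S ract M lact N =
     {frag_of (x + x', v) - frag_of (x, v) - frag_of (x', v) | x x' v.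
        x \<in> M \<and> x' \<in> M \<and> v \<in> N} \<union>
     {frag_of (x, v + v') - frag_of (x, v) - frag_of (x, v') | x v v'.
        x \<in> M \<and> v \<in> N \<and> v' \<in> N} \<union>
     {frag_of (ract x s, v) - frag_of (x, lact s v) | x s v.
        x \<in> M \<and> s \<in> S \<and> v \<in> N}"

definition tensor_kernel ::
    "'s set \<Rightarrow> ('m :: ab_group_add \<Rightarrow> 's \<Rightarrow> 'm) \<Rightarrow> 'm set \<Rightarrow>
     ('s \<Rightarrow> 'n :: ab_group_add \<Rightarrow> 'n) \<Rightarrow> 'n set \<Rightarrow> ('m \<times> 'n \<Rightarrow>\<^sub>0 int) set" where
  "tensor_kernel S ract M lact N =
     generate (free_Abelian_group (M \<times> N)) (tensor_relations S ract M lact N)"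

definition tensor ::
    "'s set \<Rightarrow> ('m :: ab_group_add \<Rightarrow> 's \<Rightarrow> 'm) \<Rightarrow> 'm set \<Rightarrow>
     ('s \<Rightarrow> 'n :: ab_group_add \<Rightarrow> 'n) \<Rightarrow> 'n set \<Rightarrow> ('m \<times> 'n \<Rightarrow>\<^sub>0 int) set monoid" where
  "tensor S ract M lact N = free_Abelian_group (M \<times> N) Mod tensor_kernel S ract M lact N"

text \<open>
  The homomorphism into an abelian group \<open>A\<close> induced by a balanced biadditive map \<open>f\<close>; for such
  \<open>f\<close> the choice of a representative does not matter.
\<close>

definition tensor_lift ::
    "('a, 'b) monoid_scheme \<Rightarrow> ('m \<Rightarrow> 'n \<Rightarrow> 'a) \<Rightarrow> ('m \<times> 'n \<Rightarrow>\<^sub>0 int) set \<Rightarrow> 'a" where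
  "tensor_lift A f t =
     (let c = (SOME c. c \<in> t) in
      finprod A (\<lambda>z. f (fst z) (snd z) [^]\<^bsub>A\<^esub> Poly_Mapping.lookup c z) (Poly_Mapping.keys c))"


section \<open>Group rings\<close>

text \<open>The group ring \<open>\<int>[G]\<close> consists of the finitely supported functions on \<open>G\<close>.\<close>

definition group_ring :: "('g, 'x) monoid_scheme \<Rightarrow> ('g \<Rightarrow>\<^sub>0 int) set" where
  "group_ring G = {x. Poly_Mapping.keys x \<subseteq> carrier G}"

definition group_ring_mult ::
    "('g, 'x) monoid_scheme \<Rightarrow> ('g \<Rightarrow>\<^sub>0 int) \<Rightarrow> ('g \<Rightarrow>\<^sub>0 int) \<Rightarrow> ('g \<Rightarrow>\<^sub>0 int)" where
  "group_ring_mult G x y =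
     (\<Sum>a \<in> Poly_Mapping.keys x. \<Sum>b \<in> Poly_Mapping.keys y.
        Poly_Mapping.single (a \<otimes>\<^bsub>G\<^esub> b) (Poly_Mapping.lookup x a * Poly_Mapping.lookup y b))"

definition augmentation_ideal :: "('g, 'x) monoid_scheme \<Rightarrow> ('g \<Rightarrow>\<^sub>0 int) set" where
  "augmentation_ideal G =
     {x \<in> group_ring G. (\<Sum>g \<in> Poly_Mapping.keys x. Poly_Mapping.lookup x g) = 0}"

definition group_ring_act :: "('g \<Rightarrow> 'v \<Rightarrow> 'v) \<Rightarrow> ('g \<Rightarrow>\<^sub>0 int) \<Rightarrow> 'v \<Rightarrow> 'v :: ring_1" where
  "group_ring_act act x v =
     (\<Sum>g \<in> Poly_Mapping.keys x. of_int (Poly_Mapping.lookup x g) * act g v)"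


section \<open>Homogeneous polynomials in two variables\<close>

text \<open>
  \<open>R[X\<^sub>1, X\<^sub>2]\<close> is \<open>R[X\<^sub>2][X\<^sub>1]\<close>, so that \<open>coeff (coeff P i) j\<close> is the coefficient of
  \<open>X\<^sub>1\<^sup>i X\<^sub>2\<^sup>j\<close>. The module \<open>\<V>\<^sub>k \<otimes> R\<close> is the module of homogeneous polynomials of degree
  \<open>k\<close> over \<open>R\<close>; \<open>\<V>\<^sub>k\<close> itself is the case \<open>R = \<int>\<close>.
\<close>

type_synonym 'r poly2 = "'r poly poly"

definition X1 :: "'r :: comm_ring_1 poly2" where "X1 = [:0, 1:]"

definition X2 :: "'r :: comm_ring_1 poly2" where "X2 = [:[:0, 1:]:]"

definition const2 :: "'r :: comm_ring_1 \<Rightarrow> 'r poly2" where "const2 r = [:[:r:]:]"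

definition homogeneous :: "nat \<Rightarrow> 'r :: comm_ring_1 poly2 set" where
  "homogeneous k =
     {P. \<forall>i j. Polynomial.coeff (Polynomial.coeff P i) j \<noteq> 0 \<longrightarrow> i + j = k}"

definition subst2 :: "'r :: comm_ring_1 poly2 \<Rightarrow> 'r poly2 \<Rightarrow> 'r poly2 \<Rightarrow> 'r poly2" where
  "subst2 P U W =
     (\<Sum>i \<le> Polynomial.degree P. \<Sum>j \<le> Polynomial.degree (Polynomial.coeff P i).
        const2 (Polynomial.coeff (Polynomial.coeff P i) j) * U ^ i * W ^ j)"

definition mat_act :: "mat2 \<Rightarrow> 'r :: comm_ring_1 poly2 \<Rightarrow> 'r poly2" where
  "mat_act A P =
     subst2 P (of_int (A $ 2 $ 2) * X1 - of_int (A $ 1 $ 2) * X2)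
              (- of_int (A $ 2 $ 1) * X1 + of_int (A $ 1 $ 1) * X2)"

text \<open>Only used on homogeneous polynomials of even degree, on which \<open>-1\<close> acts trivially.\<close>

definition bar_act :: "mat2 set \<Rightarrow> 'r :: comm_ring_1 poly2 \<Rightarrow> 'r poly2" where
  "bar_act g P = mat_act (mat_of g) P"

definition base_change :: "int poly2 \<Rightarrow> 'r :: comm_ring_1 poly2" where
  "base_change = map_poly (map_poly of_int)"


section \<open>The first homology group\<close>

text \<open>In all definitions below \<open>k\<close> is the half weight: the coefficients are \<open>\<V>\<^sub>2\<^sub>k \<otimes> R\<close>.\<close>

type_synonym 'r chain = "((mat2 set \<Rightarrow>\<^sub>0 int) \<times> 'r poly2 \<Rightarrow>\<^sub>0 int) set"

definition IV :: "mat2 set \<Rightarrow> nat \<Rightarrow> 'r :: comm_ring_1 chain monoid" where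
  "IV \<Gamma> k =
     tensor (group_ring (bar_group \<Gamma>))
       (group_ring_mult (bar_group \<Gamma>)) (augmentation_ideal (bar_group \<Gamma>))
       (group_ring_act bar_act) (homogeneous (2 * k))"

definition pure_tensor ::
    "mat2 set \<Rightarrow> nat \<Rightarrow> (mat2 set \<Rightarrow>\<^sub>0 int) \<Rightarrow> 'r :: comm_ring_1 poly2 \<Rightarrow> 'r chain" where
  "pure_tensor \<Gamma> k x v =
     tensor_kernel (group_ring (bar_group \<Gamma>))
       (group_ring_mult (bar_group \<Gamma>)) (augmentation_ideal (bar_group \<Gamma>))
       (group_ring_act bar_act) (homogeneous (2 * k))
     #>\<^bsub>free_Abelian_group (augmentation_ideal (bar_group \<Gamma>) \<times> homogeneous (2 * k))\<^esub> frag_of (x, v)"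

definition H1 :: "mat2 set \<Rightarrow> nat \<Rightarrow> 'r :: comm_ring_1 chain set" where
  "H1 \<Gamma> k =
     kernel (IV \<Gamma> k) (additive_group (homogeneous (2 * k)))
       (tensor_lift (additive_group (homogeneous (2 * k))) (group_ring_act bar_act))"

definition minus_one :: "mat2 set \<Rightarrow> (mat2 set \<Rightarrow>\<^sub>0 int)" where
  "minus_one g = frag_of g - frag_of (bar (mat 1))"

definition scalar_mult :: "mat2 set \<Rightarrow> nat \<Rightarrow> 'r :: comm_ring_1 \<Rightarrow> 'r chain \<Rightarrow> 'r chain" where
  "scalar_mult \<Gamma> k r = tensor_lift (IV \<Gamma> k) (\<lambda>x v. pure_tensor \<Gamma> k x (const2 r * v))"

inductive_set submodule_generated ::
    "mat2 set \<Rightarrow> nat \<Rightarrow> 'r :: comm_ring_1 chain set \<Rightarrow> 'r chain set"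
  for \<Gamma> k S where
  zero: "\<one>\<^bsub>IV \<Gamma> k\<^esub> \<in> submodule_generated \<Gamma> k S"
| base: "t \<in> S \<Longrightarrow> t \<in> submodule_generated \<Gamma> k S"
| add: "t \<in> submodule_generated \<Gamma> k S \<Longrightarrow> u \<in> submodule_generated \<Gamma> k S \<Longrightarrow>
    t \<otimes>\<^bsub>IV \<Gamma> k\<^esub> u \<in> submodule_generated \<Gamma> k S"
| scale: "t \<in> submodule_generated \<Gamma> k S \<Longrightarrow>
    scalar_mult \<Gamma> k r t \<in> submodule_generated \<Gamma> k S"


section \<open>Hyperbolic cycles\<close>

definition hyperbolic :: "mat2 set \<Rightarrow> bool" where
  "hyperbolic g \<longleftrightarrow> \<bar>trace (mat_of g)\<bar> > 2"

definition hyperbolic_elements :: "mat2 set \<Rightarrow> mat2 set set" where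
  "hyperbolic_elements \<Gamma> = {g \<in> bar ` \<Gamma>. hyperbolic g}"

text \<open>The divisions by the gcd are exact; replacing the matrix by its negative changes nothing.\<close>

definition Q_form :: "mat2 set \<Rightarrow> int poly2" where
  "Q_form g =
     (let A = mat_of g; a = A $ 1 $ 1; b = A $ 1 $ 2; c = A $ 2 $ 1; d = A $ 2 $ 2;
          e = gcd c (gcd (a - d) b)
      in - const2 (sgn (a + d)) *
           (const2 (c div e) * X1 ^ 2 - const2 ((a - d) div e) * X1 * X2
            - const2 (b div e) * X2 ^ 2))"

text \<open>
  The image in \<open>H\<^sub>1(\<V>\<^sub>2\<^sub>k \<otimes> R)\<close> of the cycle \<open>(\<gamma> - 1) \<otimes> Q\<^sub>\<gamma>\<^sup>k\<close>; the integral cycle is the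
  case \<open>R = \<int>\<close>.
\<close>

definition hyp_cycle :: "mat2 set \<Rightarrow> nat \<Rightarrow> mat2 set \<Rightarrow> 'r :: comm_ring_1 chain" where
  "hyp_cycle \<Gamma> k g = pure_tensor \<Gamma> k (minus_one g) (base_change (Q_form g ^ k))"


section \<open>Double coset operators\<close>

definition double_coset_quotient :: "mat2 set \<Rightarrow> mat2 \<Rightarrow> mat2 set \<Rightarrow> mat2 set set set" where
  "double_coset_quotient \<Gamma>' \<alpha> \<Gamma> =
     {bar ` \<Gamma>' #>\<^bsub>M2plus_bar\<^esub> b | b.
        b \<in> bar ` \<Gamma>' <#>\<^bsub>M2plus_bar\<^esub> (bar \<alpha> <#\<^bsub>M2plus_bar\<^esub> bar ` \<Gamma>)}"

definition coset_rep :: "mat2 set set \<Rightarrow> mat2 set" where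
  "coset_rep C = (SOME b. b \<in> C)"

text \<open>
  The index \<open>i\<close> of the representatives \<open>\<beta>\<^sub>i\<close> is the coset \<open>C\<close> itself. Then
  \<open>\<sigma>(C) = C \<gamma>\<close>, and \<open>hecke_transfer \<Gamma>' C \<gamma>\<close> is the element \<open>\<gamma>'\<close> with
  \<open>\<beta>\<^sub>C \<gamma> = \<gamma>' \<beta>\<^bsub>C \<gamma>\<^esub>\<close>.
\<close>

definition hecke_transfer :: "mat2 set \<Rightarrow> mat2 set set \<Rightarrow> mat2 set \<Rightarrow> mat2 set" where
  "hecke_transfer \<Gamma>' C g =
     (THE g'. g' \<in> bar ` \<Gamma>' \<and>
        coset_rep C \<otimes>\<^bsub>M2plus_bar\<^esub> g = g' \<otimes>\<^bsub>M2plus_bar\<^esub> coset_rep (C #>\<^bsub>M2plus_bar\<^esub> g))"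

definition hecke_basic ::
    "mat2 set \<Rightarrow> mat2 \<Rightarrow> mat2 set \<Rightarrow> nat \<Rightarrow> mat2 set \<Rightarrow> 'r :: comm_ring_1 poly2 \<Rightarrow> 'r chain" where
  "hecke_basic \<Gamma>' \<alpha> \<Gamma> k g v =
     finprod (IV \<Gamma>' k)
       (\<lambda>C. pure_tensor \<Gamma>' k (minus_one (hecke_transfer \<Gamma>' C g))
              (bar_act (coset_rep (C #>\<^bsub>M2plus_bar\<^esub> g)) v))
       (double_coset_quotient \<Gamma>' \<alpha> \<Gamma>)"

text \<open>
  \<open>x = \<Sum> x(\<gamma>) \<gamma>\<close> in the augmentation ideal equals \<open>\<Sum> x(\<gamma>) (\<gamma> - 1)\<close>, whence the
  extension of \<open>(\<gamma> - 1) \<otimes> v \<mapsto> hecke_basic \<gamma> v\<close> to all \<open>x \<otimes> v\<close>.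
\<close>

definition hecke ::
    "mat2 set \<Rightarrow> mat2 \<Rightarrow> mat2 set \<Rightarrow> nat \<Rightarrow> 'r :: comm_ring_1 chain \<Rightarrow> 'r chain" where
  "hecke \<Gamma>' \<alpha> \<Gamma> k =
     tensor_lift (IV \<Gamma>' k)
       (\<lambda>x v. finprod (IV \<Gamma>' k)
          (\<lambda>g. hecke_basic \<Gamma>' \<alpha> \<Gamma> k g v [^]\<^bsub>IV \<Gamma>' k\<^esub> Poly_Mapping.lookup x g)
          (Poly_Mapping.keys x))"


section \<open>The ordinary part\<close>

text \<open>
  The limit is taken in the \<open>p\<close>-adic topology of \<open>H\<^sub>1\<close>, in which the subgroups \<open>p\<^sup>n H\<^sub>1\<close> are
  the basic neighbourhoods of \<open>0\<close>.
\<close>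

definition padic_limit ::
    "nat \<Rightarrow> mat2 set \<Rightarrow> nat \<Rightarrow> (nat \<Rightarrow> 'r :: comm_ring_1 chain) \<Rightarrow> 'r chain \<Rightarrow> bool" where
  "padic_limit p \<Gamma> k s t \<longleftrightarrow>
     t \<in> H1 \<Gamma> k \<and>
     (\<forall>n. \<forall>\<^sub>F m in sequentially.
        s m \<otimes>\<^bsub>IV \<Gamma> k\<^esub> inv\<^bsub>IV \<Gamma> k\<^esub> t \<in> (\<lambda>u. u [^]\<^bsub>IV \<Gamma> k\<^esub> (p ^ n)) ` H1 \<Gamma> k)"

definition ord_projector :: "nat \<Rightarrow> mat2 set \<Rightarrow> nat \<Rightarrow> 'r :: comm_ring_1 chain \<Rightarrow> 'r chain" where
  "ord_projector p \<Gamma> k t =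
     (THE u. padic_limit p \<Gamma> k (\<lambda>m. (hecke \<Gamma> (mat2 1 0 0 (int p)) \<Gamma> k ^^ fact m) t) u)"

definition H1_ord :: "nat \<Rightarrow> mat2 set \<Rightarrow> nat \<Rightarrow> 'r :: comm_ring_1 chain set" where
  "H1_ord p \<Gamma> k = ord_projector p \<Gamma> k ` H1 \<Gamma> k"

definition hyp_ord :: "nat \<Rightarrow> mat2 set \<Rightarrow> nat \<Rightarrow> 'r :: comm_ring_1 chain set" where
  "hyp_ord p \<Gamma> k =
     submodule_generated \<Gamma> k
       ((\<lambda>g. ord_projector p \<Gamma> k (hyp_cycle \<Gamma> k g)) ` hyperbolic_elements \<Gamma>)"

end

theory Submission
  imports Defs
begin

text \<open>Let \<open>U\<close> be the Hecke operator at \<open>p\<close> acting on the finitely generated \<open>p\<close>-adic module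
  \<open>H = H\<^sub>1\<close>, and let \<open>Z \<subseteq> H\<close> be spanned by the hyperbolic cycles. As \<open>U\<close> is invertible on the ordinary
  part \<open>eH\<close>, by Nakayama's lemma it suffices that \<open>U H \<subseteq> Z + p H\<close>, and this can be tested on chains.
  Modulo \<open>p\<close> the matrix \<open>\<alpha> = diag(1, p)\<close> sends every form of degree \<open>2k\<close> to a multiple of
  \<open>X = X2\<^sup>2\<^sup>k\<close>, and with coset representatives of the form \<open>\<alpha> g\<close> the transfer lands in
  \<open>\<Gamma>\<^sub>p = \<Gamma> \<inter> \<Gamma>\<^sub>0(p)\<close>, which acts on \<open>X\<close> modulo \<open>p\<close> through the character \<open>a\<^sup>2\<^sup>k\<close>. So \<open>U z\<close> is
  congruent to a combination of the chains \<open>(A - 1) \<otimes> X\<close> with \<open>A \<in> \<Gamma>\<^sub>p\<close>. If \<open>a \<equiv> d\<close> modulo \<open>p\<close>, multiplying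
  \<open>A\<close> by a high power of a translation makes it hyperbolic with form \<open>Q \<equiv> u X2\<^sup>2\<close>, \<open>u\<close> a unit, and
  \<open>(A - 1) \<otimes> X\<close> becomes a hyperbolic cycle. The other \<open>A\<close> are reduced to this case by commutators if
  the character is nontrivial modulo \<open>p\<close>, and by the power \<open>A\<^sup>p\<^sup>-\<^sup>1\<close> otherwise.\<close>

section \<open>The \<open>p\<close>-adic integers as a complete discrete valuation ring\<close>

text \<open>The ordinary projector is a \<open>THE\<close>-limit in a quotient of a free abelian
  group, so existence and uniqueness of the limit must be proved. This calls for finite generation
  of \<open>H1\<close> over the p-adic integers, obtained from that of \<open>\<Gamma>\<close>, and
  then for Krull's intersection theorem and completeness. As \<open>IV\<close> is a multiplicative
  group of cosets, the linear algebra is done upstairs on chains, finitely supported functions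
  standing for sums of \<open>(g - 1) \<otimes> v\<close>; homology is the module \<open>Zc\<close>
  of cycles relative to the submodule \<open>B\<close> of chains with trivial class.

  Two facts make a congruence of chains sufficient. Coset representatives are picked by
  \<open>SOME\<close>; passing to the form \<open>\<alpha> g\<close> changes the result by a term
  that depends on a cycle only through its boundary, so it vanishes. And the coefficients have no
  p-torsion: if p times a chain is a cycle, so is the chain. The cycle condition acts once more when
  the character is nontrivial, where the boundary detects the coefficient of the one chain that
  remains. The unipotent elements used to create hyperbolic ones come from
  \<open>Gamma1 N\<close>.\<close>

lemma CARD_prime: "prime CARD('p :: prime_card)"
  by (rule prime_card)

lemma CARD_gt_1: "int CARD('p :: prime_card) > 1"
  using prime_gt_1_nat[OF CARD_prime[where 'p = 'p]] by simp

lemma Rep_padic_mod: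
  "Rep_padic_int (x :: 'p :: prime_card padic_int) (Suc n) mod int CARD('p) ^ n = Rep_padic_int x n"
  using Rep_padic_int[of x] by simp

lemma Rep_padic_reduced:
  "Rep_padic_int (x :: 'p :: prime_card padic_int) n mod int CARD('p) ^ n = Rep_padic_int x n"
  by (metis Rep_padic_mod mod_mod_trivial)

lemma Rep_padic_bounds:
  "0 \<le> Rep_padic_int (x :: 'p :: prime_card padic_int) n"
  "Rep_padic_int (x :: 'p :: prime_card padic_int) n < int CARD('p) ^ n"
  by (metis (full_types) Rep_padic_reduced CARD_gt_1 Euclidean_Rings.pos_mod_sign zero_less_power order.strict_trans zero_less_one,
      metis (full_types) Rep_padic_reduced CARD_gt_1 Euclidean_Rings.pos_mod_bound zero_less_power order.strict_trans zero_less_one)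

lemma Rep_padic_of_nat: "Rep_padic_int (of_nat m :: 'p :: prime_card padic_int) n = int m mod int CARD('p) ^ n"
  by (induction m)
    (simp_all add: zero_padic_int.rep_eq one_padic_int.rep_eq plus_padic_int.rep_eq mod_simps)

lemma Rep_padic_of_int: "Rep_padic_int (of_int m :: 'p :: prime_card padic_int) n = m mod int CARD('p) ^ n"
  by (cases m rule: int_diff_cases)
    (simp add: minus_padic_int.rep_eq Rep_padic_of_nat mod_simps)

lemma padic_eqI: "(\<And>n. Rep_padic_int x n = Rep_padic_int y n) \<Longrightarrow> x = y"
  by (simp add: Rep_padic_int_inject[symmetric] fun_eq_iff)

lemma mod_mult_div_eq: "(a :: int) mod (q * b) div q = a div q mod b" if "q > 0" "b \<ge> 0"
proof -
  have "a mod (q * b) = a mod q + q * (a div q mod b)" using zmod_zmult2_eq[OF that(2), of a q] by linarith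
  then show ?thesis using that(1) by (simp only: div_mult_self2 less_imp_neq[symmetric] mod_div_trivial add_0 not_False_eq_True)
qed

text \<open>Multiplication by p shifts the residues by one place without losing any;
  torsion-freeness and the valuation in \<open>padic_factor\<close> both come from this
  shift.\<close>

lemma Rep_padic_times_prime:
  "Rep_padic_int (of_nat CARD('p) * x) (Suc n)
    = int CARD('p) * Rep_padic_int (x :: 'p :: prime_card padic_int) n"
proof -
  have "Rep_padic_int (of_nat CARD('p) * x) (Suc n)
     = (int CARD('p) * Rep_padic_int x (Suc n)) mod (int CARD('p) * int CARD('p) ^ n)"
    by (simp only: times_padic_int.rep_eq Rep_padic_of_nat mod_mult_left_eq power_Suc)
  also have "\<dots> = int CARD('p) * (Rep_padic_int x (Suc n) mod int CARD('p) ^ n)"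
    by (rule mod_mult_mult1)
  finally show ?thesis by (simp only: Rep_padic_mod)
qed

text \<open>The quotient by p is read off the residues one place further out, because dividing by p
  costs one digit of precision.\<close>

lemma padic_one_step:
  "\<exists>y. x = of_int (Rep_padic_int x 1) + of_nat CARD('p) * (y :: 'p :: prime_card padic_int)"
proof -
  define q where "q = int CARD('p)"
  define r where "r = (\<lambda>m. Rep_padic_int x (Suc m) div q)"
  have q1: "q > 1" unfolding q_def by (rule CARD_gt_1)
  have "r (Suc n) mod q ^ n = r n" for n
  proof -
    have "r (Suc n) mod q ^ n = Rep_padic_int x (Suc (Suc n)) mod (q * q ^ n) div q"
      unfolding r_def using q1 by (intro mod_mult_div_eq[symmetric]) auto
    also have "Rep_padic_int x (Suc (Suc n)) mod (q * q ^ n) = Rep_padic_int x (Suc n)"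
      unfolding q_def by (metis Rep_padic_mod power_Suc)
    finally show ?thesis by (simp add: r_def)
  qed
  then have R: "Rep_padic_int (Abs_padic_int r :: 'p padic_int) = r"
    by (intro Abs_padic_int_inverse) (simp add: q_def)
  \<comment> \<open>The last digit is the same at every level, so the remainder on division by
    \<open>q\<close> does not depend on \<open>n\<close>.\<close>
  have low: "Rep_padic_int x (Suc n) mod q = Rep_padic_int x 1" for n
  proof (induction n)
    case 0
    then show ?case using Rep_padic_reduced[of x 1] by (simp add: q_def)
  next
    case (Suc n)
    have "Rep_padic_int x (Suc (Suc n)) mod q = Rep_padic_int x (Suc (Suc n)) mod q ^ Suc n mod q"
      by (simp add: mod_mod_cancel)
    also have "\<dots> = Rep_padic_int x (Suc n) mod q" using Rep_padic_mod[of x "Suc n"] by (simp add: q_def)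
    finally show ?case using Suc by simp
  qed
  show ?thesis
  proof (intro exI padic_eqI)
    fix n
    have "Rep_padic_int (of_int (Rep_padic_int x 1) + of_nat CARD('p) * (Abs_padic_int r :: 'p padic_int)) n
        = (Rep_padic_int x 1 + q * r n) mod q ^ n"
      by (simp add: plus_padic_int.rep_eq times_padic_int.rep_eq Rep_padic_of_int Rep_padic_of_nat R q_def mod_simps)
    also have "Rep_padic_int x 1 + q * r n = Rep_padic_int x (Suc n)"
      using mult_div_mod_eq[of q "Rep_padic_int x (Suc n)"] low[of n] by (simp add: r_def)
    also have "\<dots> mod q ^ n = Rep_padic_int x n" unfolding q_def by (rule Rep_padic_mod)
    finally show "Rep_padic_int x n = Rep_padic_int (of_int (Rep_padic_int x 1) + of_nat CARD('p) * (Abs_padic_int r :: 'p padic_int)) n"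
      by simp
  qed
qed

text \<open>Peels off one digit at a time. The bound on \<open>c\<close> is what makes the quotients
  by powers of p finite in \<open>finite_quotient\<close>.\<close>

lemma padic_mod_power:
  "\<exists>c \<in> {0..<int CARD('p) ^ n}. \<exists>y. x = of_int c + of_nat CARD('p) ^ n * (y :: 'p :: prime_card padic_int)"
proof (induction n)
  case 0
  show ?case by (intro bexI[of _ 0] exI[of _ x]) auto
next
  case (Suc n)
  then obtain c y where c: "0 \<le> c" "c < int CARD('p) ^ n" and x: "x = of_int c + of_nat CARD('p) ^ n * y" by auto
  obtain z where z: "y = of_int (Rep_padic_int y 1) + of_nat CARD('p) * z" using padic_one_step by blast
  define d where "d = Rep_padic_int y 1"
  have d: "0 \<le> d" "d < int CARD('p)" using Rep_padic_bounds[of y 1] by (auto simp: d_def)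
  have "x = of_int (c + int CARD('p) ^ n * d) + of_nat CARD('p) ^ Suc n * z"
    by (subst x, subst z) (simp add: algebra_simps d_def)
  moreover have "c + int CARD('p) ^ n * d < int CARD('p) ^ Suc n"
  proof -
    have "c + int CARD('p) ^ n * d < int CARD('p) ^ n * (1 + d)" using c by (simp add: algebra_simps)
    also have "\<dots> \<le> int CARD('p) ^ n * int CARD('p)" using d by (intro mult_left_mono) auto
    finally show ?thesis by (simp add: mult.commute)
  qed
  ultimately show ?case using c d by (intro bexI[of _ "c + int CARD('p) ^ n * d"]) auto
qed

lemma padic_torsion_free:
  assumes "of_nat CARD('p) * x = (0 :: 'p :: prime_card padic_int)"
  shows "x = 0"
proof (rule padic_eqI)
  fix n
  have "int CARD('p) * Rep_padic_int x n = 0"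
    unfolding Rep_padic_times_prime[symmetric] assms by (simp add: zero_padic_int.rep_eq)
  then show "Rep_padic_int x n = Rep_padic_int 0 n"
    by (simp add: zero_padic_int.rep_eq)
qed

section \<open>Series in powers of p\<close>

lemma padic_sum_aux:
  "(\<Sum>i<Suc n. q ^ i * Rep_padic_int (r i :: 'p :: prime_card padic_int) (Suc n)) mod q ^ Suc n mod q ^ n
    = (\<Sum>i<n. q ^ i * Rep_padic_int (r i) n) mod q ^ n" if "q = int CARD('p)"
proof -
  have "(\<Sum>i<Suc n. q ^ i * Rep_padic_int (r i) (Suc n)) mod q ^ Suc n mod q ^ n
     = (\<Sum>i<n. q ^ i * Rep_padic_int (r i) (Suc n)) mod q ^ n"
    by (subst padic_mod_mod) simp
  also have "\<dots> = (\<Sum>i<n. (q ^ i * (Rep_padic_int (r i) (Suc n) mod q ^ n)) mod q ^ n) mod q ^ n"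
    by (simp add: mod_sum_eq mod_simps)
  finally show ?thesis by (simp add: that Rep_padic_mod mod_sum_eq)
qed

text \<open>The sum of the terms p^i r_i. Modulo p^n only the first n terms count, so every entry is
  a finite sum and convergence is built in.\<close>

definition padic_series :: "(nat \<Rightarrow> 'p :: prime_card padic_int) \<Rightarrow> 'p padic_int" where
  "padic_series r = Abs_padic_int
     (\<lambda>n. (\<Sum>i<n. int CARD('p) ^ i * Rep_padic_int (r i) n) mod int CARD('p) ^ n)"

lemma Rep_padic_series:
  "Rep_padic_int (padic_series (r :: nat \<Rightarrow> 'p :: prime_card padic_int)) n
    = (\<Sum>i<n. int CARD('p) ^ i * Rep_padic_int (r i) n) mod int CARD('p) ^ n"
proof -
  have "(\<lambda>n. (\<Sum>i<n. int CARD('p) ^ i * Rep_padic_int (r i) n) mod int CARD('p) ^ n)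
      \<in> {x. \<forall>n. x (Suc n) mod int CARD('p) ^ n = x n}"
    using padic_sum_aux[OF refl, where r = r] by blast
  then show ?thesis unfolding padic_series_def by (subst Abs_padic_int_inverse) simp_all
qed

lemma padic_series_Suc:
  "padic_series r = r 0 + of_nat CARD('p) * padic_series (\<lambda>i. r (Suc i) :: 'p :: prime_card padic_int)"
proof (rule padic_eqI)
  fix n
  define q where "q = int CARD('p)"
  have L: "Rep_padic_int (padic_series r) n = (\<Sum>i<n. q ^ i * Rep_padic_int (r i) n) mod q ^ n"
    by (simp add: Rep_padic_series q_def)
  have "Rep_padic_int (r 0 + of_nat CARD('p) * padic_series (\<lambda>i. r (Suc i))) n
      = (Rep_padic_int (r 0) n + q * (\<Sum>i<n. q ^ i * Rep_padic_int (r (Suc i)) n)) mod q ^ n"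
    by (simp add: plus_padic_int.rep_eq times_padic_int.rep_eq Rep_padic_of_nat Rep_padic_series q_def mod_simps)
  also have "Rep_padic_int (r 0) n + q * (\<Sum>i<n. q ^ i * Rep_padic_int (r (Suc i)) n)
     = (\<Sum>i<Suc n. q ^ i * Rep_padic_int (r i) n)"
    by (subst sum.lessThan_Suc_shift) (simp add: sum_distrib_left mult.assoc)
  also have "\<dots> mod q ^ n = (\<Sum>i<n. q ^ i * Rep_padic_int (r i) n) mod q ^ n" by simp
  finally show "Rep_padic_int (padic_series r) n
      = Rep_padic_int (r 0 + of_nat CARD('p) * padic_series (\<lambda>i. r (Suc i))) n" using L by simp
qed

text \<open>The exact tail takes the place of a convergence estimate in
  \<open>complete\<close>.\<close>

lemma padic_series_split:
  "padic_series r = (\<Sum>i<n. of_nat CARD('p) ^ i * r i)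
     + of_nat CARD('p) ^ n * padic_series (\<lambda>i. r (n + i) :: 'p :: prime_card padic_int)"
proof (induction n)
  case (Suc n)
  show ?case
    by (subst Suc, subst padic_series_Suc) (simp add: algebra_simps)
qed simp

lemma padic_series_mult: "padic_series (\<lambda>i. a * r i) = a * padic_series (r :: nat \<Rightarrow> 'p :: prime_card padic_int)"
proof (rule padic_eqI)
  fix n
  define q where "q = int CARD('p)"
  have "Rep_padic_int (padic_series (\<lambda>i. a * r i)) n
     = (\<Sum>i<n. q ^ i * (Rep_padic_int a n * Rep_padic_int (r i) n mod q ^ n)) mod q ^ n"
    by (simp add: Rep_padic_series times_padic_int.rep_eq q_def)
  also have "\<dots> = (\<Sum>i<n. (q ^ i * (Rep_padic_int a n * Rep_padic_int (r i) n)) mod q ^ n) mod q ^ n"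
    by (simp only: mod_mult_right_eq mod_sum_eq[of "\<lambda>i. q ^ i * (Rep_padic_int a n * Rep_padic_int (r i) n mod q ^ n)", symmetric])
  also have "\<dots> = (\<Sum>i<n. (q ^ i * (Rep_padic_int a n * Rep_padic_int (r i) n))) mod q ^ n"
    by (rule mod_sum_eq)
  also have "\<dots> = (Rep_padic_int a n * (\<Sum>i<n. q ^ i * Rep_padic_int (r i) n)) mod q ^ n"
    by (simp add: sum_distrib_left mult.left_commute)
  also have "\<dots> = Rep_padic_int (a * padic_series r) n"
    by (simp add: times_padic_int.rep_eq Rep_padic_series q_def mod_simps)
  finally show "Rep_padic_int (padic_series (\<lambda>i. a * r i)) n = Rep_padic_int (a * padic_series r) n" .
qed

text \<open>The inverse is the geometric series, which satisfies \<open>s = 1 + p a s\<close> by its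
  recursion. Thus p lies in the Jacobson radical, the input to Nakayama's lemma.\<close>

lemma padic_one_minus_unit: "(1 - of_nat CARD('p) * a) dvd (1 :: 'p :: prime_card padic_int)"
proof -
  define s where "s = padic_series (\<lambda>i. a ^ i)"
  have "s = 1 + of_nat CARD('p) * (a * s)"
    unfolding s_def by (rule padic_series_Suc[of "\<lambda>i. a ^ i", unfolded power_Suc padic_series_mult power_0])
  then have "s - of_nat CARD('p) * (a * s) = 1" by (subst diff_eq_eq)
  then have "1 = (1 - of_nat CARD('p) * a) * s" by (simp only: left_diff_distrib mult_1_left mult.assoc)
  then show ?thesis by (rule dvdI)
qed

section \<open>Units and valuations\<close>

lemma padic_unit_of_int:
  assumes "\<not> int CARD('p) dvd c"
  shows "\<exists>b y. of_int c * of_int b = (1 :: 'p :: prime_card padic_int) - of_nat CARD('p) * of_int y"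
proof -
  have "prime (int CARD('p))" using CARD_prime[where 'p = 'p] by simp
  then have "coprime (int CARD('p)) c" using assms by (simp add: prime_imp_coprime)
  then obtain u v where "u * int CARD('p) + v * c = 1"
    using bezout_int[of "int CARD('p)" c] by (auto simp: coprime_iff_gcd_eq_1)
  then have "c * v = 1 - int CARD('p) * u" by (simp add: algebra_simps)
  then have "of_int c * of_int v = (of_int (1 - int CARD('p) * u) :: 'p padic_int)"
    by (simp only: of_int_mult[symmetric])
  then show ?thesis by (intro exI[of _ v] exI[of _ u]) simp
qed

text \<open>An inverse of the last digit modulo p, from Bezout's identity, turns \<open>x\<close>
  into an element of the form \<open>1 - p a\<close>, whose inverse is a geometric series.\<close>

lemma padic_unit:
  assumes "Rep_padic_int x 1 \<noteq> 0"
  shows "x dvd (1 :: 'p :: prime_card padic_int)"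
proof -
  define c where "c = Rep_padic_int x 1"
  have "\<not> int CARD('p) dvd c" using Rep_padic_bounds[of x 1] assms zdvd_not_zless unfolding c_def by fastforce
  from padic_unit_of_int[OF this] obtain b y where
    b: "of_int c * of_int b = (1 :: 'p padic_int) - of_nat CARD('p) * of_int y" by blast
  obtain z where z: "x = of_int c + of_nat CARD('p) * z" using padic_one_step c_def by blast
  have "x * of_int b = of_int c * of_int b + of_nat CARD('p) * (z * of_int b)"
    by (subst z) (simp add: algebra_simps)
  also have "\<dots> = 1 - of_nat CARD('p) * (of_int y - z * of_int b)" by (subst b) (simp add: algebra_simps)
  finally have "x * of_int b dvd 1" using padic_one_minus_unit by metis
  then show ?thesis by (rule dvd_mult_left)
qed

lemma padic_factor:
  assumes "x \<noteq> 0"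
  shows "\<exists>j u. x = of_nat CARD('p) ^ j * u \<and> u dvd (1 :: 'p :: prime_card padic_int)"
proof -
  \<comment> \<open>Induction on an index with nonzero residue: a division by p lowers this index by
    one, so the process stops.\<close>
  have *: "Rep_padic_int x n \<noteq> 0 \<Longrightarrow> \<exists>j u. x = of_nat CARD('p) ^ j * u \<and> u dvd 1" for n and x :: "'p padic_int"
  proof (induction n arbitrary: x)
    case 0
    then show ?case using Rep_padic_reduced[of x 0] by simp
  next
    case (Suc n)
    show ?case
    proof (cases "Rep_padic_int x 1 = 0")
      case False
      then show ?thesis using padic_unit by (intro exI[of _ 0] exI[of _ x]) simp
    next
      case True
      then obtain y where y: "x = of_nat CARD('p) * y" using padic_one_step[of x] by auto
      have "Rep_padic_int y n \<noteq> 0" using Suc.prems by (auto simp: y Rep_padic_times_prime)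
      from Suc.IH[OF this] obtain j u where "y = of_nat CARD('p) ^ j * u" "u dvd 1" by blast
      then show ?thesis using y by (intro exI[of _ "Suc j"] exI[of _ u]) (simp add: mult.assoc)
    qed
  qed
  obtain n where "Rep_padic_int x n \<noteq> 0"
    using assms padic_eqI[of x 0] by (auto simp: zero_padic_int.rep_eq)
  then show ?thesis by (rule *)
qed

text \<open>A member of least valuation divides all the others, since its unit part divides
  everything. In \<open>noetherian\<close>, \<open>J\<close> is the set of leading
  coefficients.\<close>

lemma padic_principal:
  fixes J :: "'p :: prime_card padic_int set"
  assumes "0 \<in> J"
  shows "\<exists>d \<in> J. \<forall>x \<in> J. d dvd x"
proof (cases "J \<subseteq> {0}")
  case True
  then show ?thesis using assms by auto
next
  case False
  define P where "P j \<longleftrightarrow> (\<exists>u. of_nat CARD('p) ^ j * u \<in> J \<and> u dvd 1)" for j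
  from False obtain x where "x \<in> J" "x \<noteq> 0" by auto
  then have "\<exists>j. P j" using padic_factor[of x] unfolding P_def by metis
  then have "P (LEAST j. P j)" by (metis LeastI)
  then obtain u where u: "of_nat CARD('p) ^ (LEAST j. P j) * u \<in> J" "u dvd 1" unfolding P_def by blast
  show ?thesis
  proof (intro bexI[OF _ u(1)] ballI)
    fix y assume y: "y \<in> J"
    show "of_nat CARD('p) ^ (LEAST j. P j) * u dvd y"
    proof (cases "y = 0")
      case False
      then obtain i w where w: "y = of_nat CARD('p) ^ i * w" "w dvd 1" using padic_factor by metis
      then have "P i" using y P_def by metis
      then have "(LEAST j. P j) \<le> i" by (rule Least_le)
      then have "of_nat CARD('p) ^ (LEAST j. P j) dvd (of_nat CARD('p) ^ i :: 'p padic_int)" by (rule le_imp_power_dvd)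
      moreover have "u dvd w" using u(2) by (meson dvd_trans one_dvd)
      ultimately show ?thesis using w(1) mult_dvd_mono by blast
    qed simp
  qed
qed

section \<open>Finitely generated modules over the \<open>p\<close>-adic integers\<close>

locale padic_module = Modules.module scale
  for scale :: "'p :: prime_card padic_int \<Rightarrow> 'b :: ab_group_add \<Rightarrow> 'b" (infixr "\<star>" 75)
begin

abbreviation \<pi> :: "'p padic_int" where "\<pi> \<equiv> of_nat CARD('p)"

text \<open>The submodule \<open>p\<^sup>n Z + B\<close>, by which \<open>Z / B\<close> is filtered.\<close>

definition filt :: "nat \<Rightarrow> 'b set \<Rightarrow> 'b set \<Rightarrow> 'b set" where
  "filt n Z B = {x. \<exists>z \<in> Z. x - \<pi> ^ n \<star> z \<in> B}"

lemma subspace_filt: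
  assumes "subspace Z" "subspace B"
  shows "subspace (filt n Z B)"
proof (rule subspaceI)
  show "0 \<in> filt n Z B"
    unfolding filt_def using subspace_0[OF assms(1)] subspace_0[OF assms(2)] by force
next
  fix x y assume "x \<in> filt n Z B" "y \<in> filt n Z B"
  then obtain z w where z: "z \<in> Z" "x - \<pi> ^ n \<star> z \<in> B" and w: "w \<in> Z" "y - \<pi> ^ n \<star> w \<in> B"
    unfolding filt_def by blast
  have "(x + y) - \<pi> ^ n \<star> (z + w) = (x - \<pi> ^ n \<star> z) + (y - \<pi> ^ n \<star> w)"
    by (simp add: scale_right_distrib)
  also have "\<dots> \<in> B" using z w assms by (simp only: subspace_add)
  finally show "x + y \<in> filt n Z B"
    unfolding filt_def using z w subspace_add[OF assms(1)] by blast
next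
  fix c x assume "x \<in> filt n Z B"
  then obtain z where z: "z \<in> Z" "x - \<pi> ^ n \<star> z \<in> B" unfolding filt_def by blast
  have "c \<star> x - \<pi> ^ n \<star> (c \<star> z) = c \<star> (x - \<pi> ^ n \<star> z)"
    by (simp add: scale_right_diff_distrib mult.commute)
  also have "\<dots> \<in> B" using z assms by (simp only: subspace_scale)
  finally show "c \<star> x \<in> filt n Z B"
    unfolding filt_def using z subspace_scale[OF assms(1)] by blast
qed

lemma filtI: "z \<in> Z \<Longrightarrow> x - \<pi> ^ n \<star> z \<in> B \<Longrightarrow> x \<in> filt n Z B"
  unfolding filt_def by blast

lemma subset_filt: "subspace Z \<Longrightarrow> B \<subseteq> filt n Z B"
  unfolding filt_def using subspace_0 by force

text \<open>Induction on the generators: take a member of \<open>K\<close> whose coefficient at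
  \<open>s\<close> divides all such coefficients, together with generators of the part of
  \<open>K\<close> in the span of the others. Everything is relative to \<open>B\<close>, so that no
  quotient has to be formed.\<close>

lemma noetherian:
  assumes "finite S" "subspace B" "subspace K" "B \<subseteq> K" "K \<subseteq> span (S \<union> B)"
  shows "\<exists>T. finite T \<and> T \<subseteq> K \<and> K = span (T \<union> B)"
  using assms
proof (induction S arbitrary: K rule: finite_induct)
  case empty
  then have "K = span B" using span_minimal[of B K] by auto
  then show ?case by (intro exI[of _ "{}"]) simp
next
  case (insert s S)
  define W where "W = span (S \<union> B)"
  have W: "subspace W" by (simp add: W_def)
  have "subspace (K \<inter> W)" using insert.prems W by (intro subspace_inter)
  moreover have "B \<subseteq> K \<inter> W" using insert.prems by (auto simp: W_def span_base)
  ultimately obtain T where T: "finite T" "T \<subseteq> K \<inter> W" "K \<inter> W = span (T \<union> B)"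
    using insert.IH[of "K \<inter> W"] insert.prems by (auto simp: W_def)
  \<comment> \<open>The coefficients at \<open>s\<close> of members of \<open>K\<close>, modulo the
    span of the remaining generators.\<close>
  define J where "J = {r. \<exists>y \<in> W. r \<star> s + y \<in> K}"
  have "0 \<in> J" unfolding J_def using W insert.prems by (auto intro!: bexI[of _ 0] simp: subspace_0)
  then obtain d where d: "d \<in> J" "\<And>r. r \<in> J \<Longrightarrow> d dvd r" using padic_principal[OF \<open>0 \<in> J\<close>] by blast
  then obtain y where y: "y \<in> W" "d \<star> s + y \<in> K" unfolding J_def by blast
  define x where "x = d \<star> s + y"
  have "K \<subseteq> span (insert x T \<union> B)"
  proof
    fix k assume k: "k \<in> K"
    then have "k \<in> span (insert s (S \<union> B))" using insert.prems by auto
    then obtain r where r: "k - r \<star> s \<in> W" unfolding span_insert W_def by blast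
    have "r \<in> J" unfolding J_def using k r by (auto intro!: bexI[of _ "k - r \<star> s"])
    then obtain e where e: "r = e * d" using d(2) by (metis dvdE mult.commute)
    \<comment> \<open>Subtracting this multiple of \<open>x\<close> kills the coefficient at
      \<open>s\<close>.\<close>
    have "k - e \<star> x = (k - r \<star> s) - e \<star> y"
      by (simp add: x_def e scale_right_distrib)
    then have "k - e \<star> x \<in> W" using r y W by (simp only: subspace_diff subspace_scale)
    moreover have "k - e \<star> x \<in> K" using k y(2) insert.prems(2) by (simp add: x_def subspace_diff subspace_scale)
    ultimately have "k - e \<star> x \<in> span (T \<union> B)" using T by blast
    then show "k \<in> span (insert x T \<union> B)" unfolding Un_insert_left span_insert by blast
  qed
  moreover have "span (insert x T \<union> B) \<subseteq> K"
    using T y insert.prems by (intro span_minimal) (auto simp: x_def)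
  ultimately show ?case using T y by (intro exI[of _ "insert x T"]) (auto simp: x_def)
qed

text \<open>Eliminates one generator at a time. Writing \<open>y = a s + w\<close>, the hypothesis
  gives \<open>(1 - p a) s = p w\<close> modulo \<open>N\<close>, and \<open>1 - p a\<close> is a
  unit, so modulo \<open>N\<close> the generator \<open>s\<close> is p times a combination of the
  others.\<close>

lemma nakayama_aux:
  assumes "finite S" "subspace N" "\<And>s. s \<in> S \<Longrightarrow> \<exists>y \<in> span (S \<union> N). s - \<pi> \<star> y \<in> N"
  shows "S \<subseteq> N"
  using assms
proof (induction S rule: finite_induct)
  case (insert s S)
  define W where "W = span (S \<union> N)"
  have W: "subspace W" "N \<subseteq> W" by (auto simp: W_def span_base)
  obtain y where y: "y \<in> span (insert s (S \<union> N))" "s - \<pi> \<star> y \<in> N" using insert.prems(2)[of s] by auto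
  obtain a where a: "y - a \<star> s \<in> W" using y(1) unfolding span_insert W_def by blast
  obtain u where u: "(1 - \<pi> * a) * u = 1" using padic_one_minus_unit[of a] by (metis dvdE)
  define w where "w = u \<star> (y - a \<star> s)"
  have w: "w \<in> W" unfolding w_def using a W by (simp add: subspace_scale)
  have "s - \<pi> \<star> w = u \<star> (s - \<pi> \<star> y)"
  proof -
    have "u \<star> s - \<pi> \<star> (u \<star> (a \<star> s)) = ((1 - \<pi> * a) * u) \<star> s"
      by (simp add: scale_left_diff_distrib right_diff_distrib mult_ac)
    also have "\<dots> = s" by (simp only: u scale_one)
    finally have "s - \<pi> \<star> w = (u \<star> s - \<pi> \<star> (u \<star> (a \<star> s))) - \<pi> \<star> w" by simp
    also have "\<dots> = u \<star> (s - \<pi> \<star> y)"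
      by (simp add: w_def scale_right_diff_distrib scale_left_commute mult_ac)
    finally show ?thesis .
  qed
  then have sw: "s - \<pi> \<star> w \<in> N" using y insert.prems(1) by (simp add: subspace_scale)
  have s: "s \<in> W"
  proof -
    have "s = (s - \<pi> \<star> w) + \<pi> \<star> w" by simp
    then show ?thesis using sw W w by (metis subsetD subspace_add subspace_scale)
  qed
  have "S \<subseteq> N"
  proof (rule insert.IH[OF insert.prems(1)])
    fix t assume "t \<in> S"
    then obtain z where z: "z \<in> span (insert s (S \<union> N))" "t - \<pi> \<star> z \<in> N" using insert.prems(2)[of t] by auto
    have "span (insert s (S \<union> N)) \<subseteq> W"
      using s W by (intro span_minimal) (auto simp: W_def span_base)
    then show "\<exists>y \<in> span (S \<union> N). t - \<pi> \<star> y \<in> N" using z by (auto simp: W_def)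
  qed
  then have "W \<subseteq> N" unfolding W_def using insert.prems(1) by (intro span_minimal) auto
  then have "(s - \<pi> \<star> w) + \<pi> \<star> w \<in> N"
    using sw w insert.prems(1) by (intro subspace_add subspace_scale) auto
  then show ?case using \<open>S \<subseteq> N\<close> by simp
qed simp

lemma nakayama:
  assumes "finite T" "K = span (T \<union> B)" "subspace N" "B \<subseteq> N"
    and "\<And>x. x \<in> K \<Longrightarrow> \<exists>y \<in> K. x - \<pi> \<star> y \<in> N"
  shows "K \<subseteq> N"
proof -
  have KN: "K \<subseteq> span (T \<union> N)" unfolding assms(2) using assms(4) by (intro span_mono) auto
  have "T \<subseteq> N"
  proof (rule nakayama_aux[OF assms(1,3)])
    fix s assume "s \<in> T"
    then have "s \<in> K" by (simp add: assms(2) span_base)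
    from assms(5)[OF this] show "\<exists>y \<in> span (T \<union> N). s - \<pi> \<star> y \<in> N" using KN by blast
  qed
  then show ?thesis unfolding assms(2) using assms(3,4) by (intro span_minimal) auto
qed

text \<open>Krull's intersection theorem. The torsion of \<open>Z / B\<close> is finitely generated,
  hence killed by a single power of p; from this the intersection \<open>D\<close> of the filtration
  satisfies \<open>D = p D\<close> modulo \<open>B\<close>, and Nakayama's lemma applies.\<close>

lemma separated:
  assumes "finite T" "subspace B" and Z: "Z = span (T \<union> B)" and x: "\<And>n. x \<in> filt n Z B"
  shows "x \<in> B"
proof -
  have sZ: "subspace Z" and BZ: "B \<subseteq> Z" by (auto simp: Z span_base)
  define tor where "tor = {x \<in> Z. \<exists>e. \<pi> ^ e \<star> x \<in> B}"
  have up: "\<pi> ^ f \<star> x \<in> B" if "\<pi> ^ e \<star> x \<in> B" "e \<le> f" for e f x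
  proof -
    have "\<pi> ^ f \<star> x = \<pi> ^ (f - e) \<star> \<pi> ^ e \<star> x" using that(2) by (simp flip: power_add)
    then show ?thesis using that(1) assms(2) by (simp only: subspace_scale)
  qed
  have tor1: "subspace tor"
  proof (rule subspaceI)
    show "0 \<in> tor" using sZ assms(2) by (simp add: tor_def subspace_0)
  next
    fix x y assume "x \<in> tor" "y \<in> tor"
    then obtain e f where "x \<in> Z" "y \<in> Z" "\<pi> ^ e \<star> x \<in> B" "\<pi> ^ f \<star> y \<in> B" unfolding tor_def by blast
    then have "\<pi> ^ (max e f) \<star> (x + y) \<in> B"
      unfolding scale_right_distrib using up assms(2) by (intro subspace_add) auto
    then show "x + y \<in> tor" using sZ \<open>x \<in> Z\<close> \<open>y \<in> Z\<close> by (auto simp: tor_def subspace_add)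
  next
    fix c x assume "x \<in> tor"
    then obtain e where "x \<in> Z" "\<pi> ^ e \<star> x \<in> B" unfolding tor_def by blast
    then have "\<pi> ^ e \<star> (c \<star> x) \<in> B" by (subst scale_left_commute) (rule subspace_scale[OF assms(2)])
    then show "c \<star> x \<in> tor" using sZ \<open>x \<in> Z\<close> by (auto simp: tor_def subspace_scale)
  qed
  have tor2: "B \<subseteq> tor" using BZ by (auto simp: tor_def intro: exI[of _ 0])
  have tor3: "tor \<subseteq> span (T \<union> B)" by (auto simp: tor_def Z)
  obtain T1 where T1: "finite T1" "T1 \<subseteq> tor" "tor = span (T1 \<union> B)"
    using noetherian[OF assms(1,2) tor1 tor2 tor3] by blast
  have "\<forall>t \<in> T1. \<exists>e. \<pi> ^ e \<star> t \<in> B" using T1(2) by (auto simp: tor_def)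
  then obtain ex where ex: "\<And>t. t \<in> T1 \<Longrightarrow> \<pi> ^ ex t \<star> t \<in> B" by metis
  \<comment> \<open>The sum of the exponents dominates each of them, so one power of p serves for
    all generators.\<close>
  define E where "E = sum ex T1"
  have "subspace {x. \<pi> ^ E \<star> x \<in> B}"
    using assms(2) by (intro subspaceI)
      (auto simp: subspace_0 scale_right_distrib subspace_add scale_left_commute[of "\<pi> ^ E"] subspace_scale
         simp del: scale_scale)
  moreover have "T1 \<union> B \<subseteq> {x. \<pi> ^ E \<star> x \<in> B}"
  proof -
    have "\<pi> ^ E \<star> t \<in> B" if "t \<in> T1" for t
      using up[OF ex[OF that]] T1(1) that by (simp add: E_def member_le_sum)
    then show ?thesis using assms(2) by (auto simp: subspace_scale)
  qed
  ultimately have tE: "\<pi> ^ E \<star> y \<in> B" if "y \<in> tor" for y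
    using that span_minimal unfolding T1(3) by blast
  define D where "D = (\<Inter>n. filt n Z B)"
  have D1: "subspace D" unfolding D_def using sZ assms(2) by (intro subspace_Int subspace_filt)
  have D2: "B \<subseteq> D" unfolding D_def using sZ subset_filt by blast
  have D3: "D \<subseteq> span (T \<union> B)"
  proof
    fix x assume "x \<in> D"
    then have "x \<in> filt 0 Z B" by (auto simp: D_def)
    then obtain z where "z \<in> Z" "x - z \<in> B" by (auto simp: filt_def)
    then have "z + (x - z) \<in> Z" using BZ sZ by (intro subspace_add) auto
    then show "x \<in> span (T \<union> B)" by (simp add: Z)
  qed
  obtain T2 where T2: "finite T2" "D = span (T2 \<union> B)"
    using noetherian[OF assms(1,2) D1 D2 D3] by blast
  have "D \<subseteq> B"
  proof (rule nakayama[OF T2 assms(2)])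
    fix x assume xD: "x \<in> D"
    \<comment> \<open>The exponent is \<open>E + 1\<close> because one factor p is to be split off,
      while the remaining \<open>\<pi> ^ E\<close> kills torsion: this makes
      \<open>\<pi> ^ E \<star> z\<close> lie in \<open>D\<close> again.\<close>
    then have "x \<in> filt (Suc E) Z B" by (auto simp: D_def)
    then obtain z where z: "z \<in> Z" "x - \<pi> ^ Suc E \<star> z \<in> B" unfolding filt_def by blast
    have "\<pi> ^ E \<star> z \<in> filt n Z B" for n
    proof -
      have "x \<in> filt (Suc E + n) Z B" using xD by (auto simp: D_def)
      then obtain w where w: "w \<in> Z" "x - \<pi> ^ (Suc E + n) \<star> w \<in> B" unfolding filt_def by blast
      have "\<pi> ^ Suc E \<star> (z - \<pi> ^ n \<star> w) = (x - \<pi> ^ (Suc E + n) \<star> w) - (x - \<pi> ^ Suc E \<star> z)"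
        by (simp add: scale_right_diff_distrib power_add mult.assoc)
      then have "\<pi> ^ Suc E \<star> (z - \<pi> ^ n \<star> w) \<in> B" using z w assms(2) by (simp only: subspace_diff)
      moreover have "z - \<pi> ^ n \<star> w \<in> Z" using z w sZ by (simp add: subspace_diff subspace_scale)
      ultimately have "z - \<pi> ^ n \<star> w \<in> tor" unfolding tor_def by blast
      then have "\<pi> ^ E \<star> (z - \<pi> ^ n \<star> w) \<in> B" by (rule tE)
      moreover have "\<pi> ^ E \<star> (z - \<pi> ^ n \<star> w) = \<pi> ^ E \<star> z - \<pi> ^ n \<star> (\<pi> ^ E \<star> w)"
        by (simp add: scale_right_diff_distrib mult.commute)
      ultimately show ?thesis using w sZ by (intro filtI[of "\<pi> ^ E \<star> w"]) (auto simp: subspace_scale)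
    qed
    then show "\<exists>y \<in> D. x - \<pi> \<star> y \<in> B"
      using z by (intro bexI[of _ "\<pi> ^ E \<star> z"]) (auto simp: D_def)
  qed simp
  then show ?thesis using x by (auto simp: D_def)
qed

lemma span_Un_finite:
  assumes "finite T" "subspace B" "z \<in> span (T \<union> B)"
  shows "\<exists>r. z - (\<Sum>t\<in>T. r t \<star> t) \<in> B"
proof -
  obtain x y where "z = x + y" "x \<in> span T" "y \<in> span B" using assms(3) unfolding span_Un by blast
  moreover obtain r where "x = (\<Sum>t\<in>T. r t \<star> t)" using \<open>x \<in> span T\<close> by (auto simp: span_finite assms(1))
  moreover have "y \<in> B" using \<open>y \<in> span B\<close> span_minimal[of B B] assms(2) by auto
  ultimately show ?thesis by (intro exI[of _ r]) simp
qed

text \<open>Reducing the coefficients of a combination of the generators modulo p^n leaves finitely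
  many combinations.\<close>

lemma finite_quotient:
  assumes "finite T" "subspace B" and Z: "Z = span (T \<union> B)"
  shows "\<exists>R. finite R \<and> (\<forall>z \<in> Z. \<exists>r \<in> R. z - r \<in> filt n Z B)"
proof (intro exI conjI ballI)
  let ?R = "(\<lambda>c. \<Sum>t\<in>T. of_int (c t) \<star> t) ` (T \<rightarrow>\<^sub>E {0..<int CARD('p) ^ n})"
  show "finite ?R" using assms(1) by (intro finite_imageI finite_PiE) auto
  fix z assume "z \<in> Z"
  then obtain r where r: "z - (\<Sum>t\<in>T. r t \<star> t) \<in> B" using span_Un_finite assms by blast
  obtain c y where c: "\<And>t. c t \<in> {0..<int CARD('p) ^ n}" and y: "\<And>t. r t = of_int (c t) + \<pi> ^ n * y t"
  proof -
    have "\<forall>t. \<exists>c y. c \<in> {0..<int CARD('p) ^ n} \<and> r t = of_int c + \<pi> ^ n * y"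
      using padic_mod_power by blast
    then show ?thesis using that by metis
  qed
  show "\<exists>r\<in>?R. z - r \<in> filt n Z B"
  proof (rule bexI)
    show "(\<Sum>t\<in>T. of_int (restrict c T t) \<star> t) \<in> ?R" using c by (intro imageI) auto
    show "z - (\<Sum>t\<in>T. of_int (restrict c T t) \<star> t) \<in> filt n Z B"
    proof (rule filtI)
      show "(\<Sum>t\<in>T. y t \<star> t) \<in> Z" unfolding Z by (intro span_sum span_scale span_base) auto
      have "z - (\<Sum>t\<in>T. of_int (restrict c T t) \<star> t) - \<pi> ^ n \<star> (\<Sum>t\<in>T. y t \<star> t) = z - (\<Sum>t\<in>T. r t \<star> t)"
        by (simp add: y scale_left_distrib sum.distrib scale_sum_right cong: sum.cong)
      then show "z - (\<Sum>t\<in>T. of_int (restrict c T t) \<star> t) - \<pi> ^ n \<star> (\<Sum>t\<in>T. y t \<star> t) \<in> B"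
        using r by (simp only:)
    qed
  qed
qed

text \<open>Each difference is p^n times a combination of the same finitely many generators, so the
  limit is obtained by summing the coefficients as p-adic series.\<close>

lemma complete:
  assumes "finite T" "subspace B" and Z: "Z = span (T \<union> B)"
    and a: "\<And>n. a n \<in> Z" "\<And>n. a (Suc n) - a n \<in> filt n Z B"
  shows "\<exists>L \<in> Z. \<forall>n. a n - L \<in> filt n Z B"
proof -
  have sZ: "subspace Z" by (simp add: Z)
  have "\<forall>n. \<exists>r. a (Suc n) - a n - \<pi> ^ n \<star> (\<Sum>t\<in>T. r t \<star> t) \<in> B"
  proof
    fix n
    obtain z where z: "z \<in> Z" "a (Suc n) - a n - \<pi> ^ n \<star> z \<in> B" using a(2)[of n] unfolding filt_def by blast
    obtain r where r: "z - (\<Sum>t\<in>T. r t \<star> t) \<in> B" using z(1) span_Un_finite assms by blast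
    have "a (Suc n) - a n - \<pi> ^ n \<star> (\<Sum>t\<in>T. r t \<star> t)
       = (a (Suc n) - a n - \<pi> ^ n \<star> z) + \<pi> ^ n \<star> (z - (\<Sum>t\<in>T. r t \<star> t))"
      by (simp add: scale_right_diff_distrib)
    also have "\<dots> \<in> B" using z r assms(2) by (intro subspace_add subspace_scale)
    finally show "\<exists>r. a (Suc n) - a n - \<pi> ^ n \<star> (\<Sum>t\<in>T. r t \<star> t) \<in> B" by blast
  qed
  then obtain r where r: "\<And>n. a (Suc n) - a n - \<pi> ^ n \<star> (\<Sum>t\<in>T. r n t \<star> t) \<in> B" by metis
  define L where "L = a 0 + (\<Sum>t\<in>T. padic_series (\<lambda>i. r i t) \<star> t)"
  have an: "a n - a 0 - (\<Sum>t\<in>T. (\<Sum>i<n. \<pi> ^ i * r i t) \<star> t) \<in> B" for n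
  proof (induction n)
    case 0
    then show ?case using assms(2) by (simp add: subspace_0)
  next
    case (Suc n)
    have "a (Suc n) - a 0 - (\<Sum>t\<in>T. (\<Sum>i<Suc n. \<pi> ^ i * r i t) \<star> t)
      = (a n - a 0 - (\<Sum>t\<in>T. (\<Sum>i<n. \<pi> ^ i * r i t) \<star> t))
        + (a (Suc n) - a n - \<pi> ^ n \<star> (\<Sum>t\<in>T. r n t \<star> t))"
      by (simp add: scale_left_distrib sum.distrib scale_sum_right)
    then show ?case using Suc r[of n] assms(2) by (simp only: subspace_add)
  qed
  have tail: "(\<Sum>t\<in>T. c t \<star> t) \<in> Z" for c :: "'b \<Rightarrow> 'p padic_int"
    unfolding Z by (intro span_sum span_scale span_base) auto
  have "a n - L \<in> filt n Z B" for n
  proof (rule filtI)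
    show "(\<Sum>t\<in>T. (- padic_series (\<lambda>i. r (n + i) t)) \<star> t) \<in> Z" by (rule tail)
    have "(\<Sum>t\<in>T. padic_series (\<lambda>i. r i t) \<star> t)
       = (\<Sum>t\<in>T. (\<Sum>i<n. \<pi> ^ i * r i t) \<star> t) + \<pi> ^ n \<star> (\<Sum>t\<in>T. padic_series (\<lambda>i. r (n + i) t) \<star> t)"
      by (subst padic_series_split[of _ n]) (simp add: scale_left_distrib sum.distrib scale_sum_right)
    then have "a n - L - \<pi> ^ n \<star> (\<Sum>t\<in>T. (- padic_series (\<lambda>i. r (n + i) t)) \<star> t)
      = a n - a 0 - (\<Sum>t\<in>T. (\<Sum>i<n. \<pi> ^ i * r i t) \<star> t)"
      by (simp add: L_def scale_right_diff_distrib sum_negf)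
    then show "a n - L - \<pi> ^ n \<star> (\<Sum>t\<in>T. (- padic_series (\<lambda>i. r (n + i) t)) \<star> t) \<in> B" using an by (simp only:)
  qed
  moreover have "L \<in> Z" unfolding L_def using a(1) tail sZ by (simp add: subspace_add)
  ultimately show ?thesis by blast
qed

end

section \<open>The ordinary projector of an operator on a finitely generated module\<close>

locale padic_operator = padic_module scale
  for scale :: "'p :: prime_card padic_int \<Rightarrow> 'b :: ab_group_add \<Rightarrow> 'b" (infixr "\<star>" 75) +
  fixes U :: "'b \<Rightarrow> 'b" and Z B T :: "'b set"
  assumes U: "module_hom scale scale U"
    and T: "finite T" and B: "subspace B" and Z: "Z = span (T \<union> B)"
    and UZ: "\<And>z. z \<in> Z \<Longrightarrow> U z \<in> Z" and UB: "\<And>b. b \<in> B \<Longrightarrow> U b \<in> B"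
begin

abbreviation F :: "nat \<Rightarrow> 'b set" where "F n \<equiv> filt n Z B"

lemma subspace_Z: "subspace Z" and B_subset_Z: "B \<subseteq> Z"
  by (auto simp: Z span_base)

lemma subspace_F: "subspace (F n)"
  using subspace_Z B by (rule subspace_filt)

lemma B_subset_F: "B \<subseteq> F n"
  using subspace_Z by (rule subset_filt)

lemma U_add: "U (x + y) = U x + U y" and U_diff: "U (x - y) = U x - U y" and U_scale: "U (c \<star> x) = c \<star> U x"
  using U by (auto simp: module_hom.add module_hom.diff module_hom.scale)

lemma pow_add: "(U ^^ j) (x + y) = (U ^^ j) x + (U ^^ j) y"
  and pow_diff: "(U ^^ j) (x - y) = (U ^^ j) x - (U ^^ j) y"
  and pow_scale: "(U ^^ j) (c \<star> x) = c \<star> (U ^^ j) x"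
  by (induction j) (simp_all add: U_add U_diff U_scale)

lemma pow_Z: "z \<in> Z \<Longrightarrow> (U ^^ j) z \<in> Z" and pow_B: "b \<in> B \<Longrightarrow> (U ^^ j) b \<in> B"
  by (induction j) (simp_all add: UZ UB)

lemma pow_F: "x \<in> F n \<Longrightarrow> (U ^^ j) x \<in> F n"
proof -
  assume "x \<in> F n"
  then obtain z where "z \<in> Z" "x - \<pi> ^ n \<star> z \<in> B" unfolding filt_def by blast
  then show ?thesis
    using pow_Z[of z j] pow_B[of "x - \<pi> ^ n \<star> z" j] by (intro filtI[of "(U ^^ j) z"]) (auto simp: pow_diff pow_scale)
qed

text \<open>Pigeonhole in the finite quotient modulo p^n: every orbit of \<open>U\<close> is
  periodic from index \<open>M\<close> on, with period at most \<open>M\<close>, where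
  \<open>M\<close> counts representatives. For \<open>m \<ge> M\<close> the number
  \<open>fact m\<close> is at least \<open>M\<close> and a multiple of the period. The bound
  \<open>M\<close> is uniform in \<open>z\<close>.\<close>

lemma eventually_idempotent:
  "\<exists>M. \<forall>m\<ge>M. \<forall>z\<in>Z. (U ^^ fact m) z - (U ^^ fact M) z \<in> F n \<and>
    (U ^^ fact m) ((U ^^ fact m) z) - (U ^^ fact m) z \<in> F n"
proof -
  obtain R where R: "finite R" "\<And>z. z \<in> Z \<Longrightarrow> \<exists>r\<in>R. z - r \<in> F n"
    using finite_quotient[OF T B Z, of n] by blast
  define M where "M = card R"
  have period: "\<exists>d. 0 < d \<and> d \<le> M \<and> (\<forall>a\<ge>M. \<forall>t. (U ^^ (a + d * t)) z - (U ^^ a) z \<in> F n)" if z: "z \<in> Z" for z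
  proof -
    obtain \<kappa> where \<kappa>: "\<And>y. y \<in> Z \<Longrightarrow> \<kappa> y \<in> R \<and> y - \<kappa> y \<in> F n" using R(2) by metis
    have "(\<lambda>i. \<kappa> ((U ^^ i) z)) ` {..M} \<subseteq> R" using \<kappa> pow_Z[OF z] by auto
    \<comment> \<open>There are \<open>M + 1\<close> exponents but only \<open>M\<close>
      representatives.\<close>
    then have "\<not> inj_on (\<lambda>i. \<kappa> ((U ^^ i) z)) {..M}"
      using card_inj_on_le[of _ "{..M}" R] R(1) by (fastforce simp: M_def)
    then obtain i j where ij: "i < j" "j \<le> M" "\<kappa> ((U ^^ i) z) = \<kappa> ((U ^^ j) z)"
      unfolding inj_on_def by (metis atMost_iff linorder_neqE_nat)
    have base: "(U ^^ j) z - (U ^^ i) z \<in> F n"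
    proof -
      have "(U ^^ j) z - (U ^^ i) z = ((U ^^ j) z - \<kappa> ((U ^^ j) z)) - ((U ^^ i) z - \<kappa> ((U ^^ i) z))"
        using ij by simp
      then show ?thesis using \<kappa>[OF pow_Z[OF z]] subspace_F by (simp only: subspace_diff)
    qed
    define d where "d = j - i"
    have step: "(U ^^ (a + d)) z - (U ^^ a) z \<in> F n" if "a \<ge> M" for a
    proof -
      have "(U ^^ (a - i)) ((U ^^ j) z - (U ^^ i) z) \<in> F n" using base by (rule pow_F)
      moreover have "(a - i) + j = a + d" "(a - i) + i = a" using ij that by (auto simp: d_def)
      ultimately show ?thesis by (simp add: pow_diff funpow_add[symmetric, unfolded comp_def fun_eq_iff, rule_format])
    qed
    have "(U ^^ (a + d * t)) z - (U ^^ a) z \<in> F n" if "a \<ge> M" for a t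
    proof (induction t)
      case 0
      then show ?case using subspace_F by (simp add: subspace_0)
    next
      case (Suc t)
      have "(U ^^ (a + d * Suc t)) z - (U ^^ a) z
        = ((U ^^ (a + d * t + d)) z - (U ^^ (a + d * t)) z) + ((U ^^ (a + d * t)) z - (U ^^ a) z)"
        by (simp add: algebra_simps)
      then show ?case using Suc step[of "a + d * t"] that subspace_F by (simp only: subspace_add trans_le_add1)
    qed
    then show ?thesis using ij by (intro exI[of _ d]) (auto simp: d_def)
  qed
  show ?thesis
  proof (intro exI[of _ M] allI impI ballI)
    fix m z assume m: "m \<ge> M" and z: "z \<in> Z"
    obtain d where d: "0 < d" "d \<le> M" "\<And>a t. a \<ge> M \<Longrightarrow> (U ^^ (a + d * t)) z - (U ^^ a) z \<in> F n"
      using period[OF z] by blast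
    have dv: "d dvd fact M" "d dvd fact m" using d m by (auto intro: dvd_fact)
    have M: "M \<le> fact M" "M \<le> fact m" using m fact_ge_self[of M] fact_ge_self[of m] by linarith+
    have "(fact M :: nat) \<le> fact m" using m by (rule fact_mono)
    moreover have "d dvd fact m - fact M" using dv by (rule dvd_diff_nat[rotated])
    ultimately obtain t where "fact m = fact M + d * t" by (metis dvdE le_add_diff_inverse)
    then have 1: "(U ^^ fact m) z - (U ^^ fact M) z \<in> F n" using d(3)[OF M(1)] by simp
    obtain t where "fact m = d * t" using dv(2) by blast
    then have "(U ^^ (fact m + fact m)) z - (U ^^ fact m) z \<in> F n" using d(3)[OF M(2), of t] by simp
    then show "(U ^^ fact m) z - (U ^^ fact M) z \<in> F n \<and>
      (U ^^ fact m) ((U ^^ fact m) z) - (U ^^ fact m) z \<in> F n" using 1 by (simp add: funpow_add)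
  qed
qed

text \<open>A relation instead of a function, because upstairs the limit is determined only modulo
  \<open>B\<close>.\<close>

definition is_ord :: "'b \<Rightarrow> 'b \<Rightarrow> bool" where
  "is_ord z l \<longleftrightarrow> l \<in> Z \<and> (\<forall>n. \<exists>M. \<forall>m\<ge>M. (U ^^ fact m) z - l \<in> F n)"

lemma is_ord_exists:
  assumes z: "z \<in> Z"
  shows "\<exists>l. is_ord z l"
proof -
  have "\<forall>n. \<exists>M. \<forall>m\<ge>M. (U ^^ fact m) z - (U ^^ fact M) z \<in> F n"
    using eventually_idempotent z by meson
  then obtain M where M: "\<And>n m. m \<ge> M n \<Longrightarrow> (U ^^ fact m) z - (U ^^ fact (M n)) z \<in> F n" by metis
  have "(U ^^ fact (M (Suc n))) z - (U ^^ fact (M n)) z \<in> F n" for n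
  proof -
    \<comment> \<open>The thresholds \<open>M n\<close> need not be monotone, so two of them are
      compared at a common later exponent.\<close>
    define m where "m = max (M n) (M (Suc n))"
    have a: "(U ^^ fact m) z - (U ^^ fact (M n)) z \<in> F n" by (rule M) (simp add: m_def)
    have "(U ^^ fact m) z - (U ^^ fact (M (Suc n))) z \<in> F (Suc n)" by (rule M) (simp add: m_def)
    then obtain w where w: "w \<in> Z" "(U ^^ fact m) z - (U ^^ fact (M (Suc n))) z - \<pi> ^ Suc n \<star> w \<in> B"
      unfolding filt_def by blast
    have b: "(U ^^ fact m) z - (U ^^ fact (M (Suc n))) z \<in> F n"
      using w subspace_Z by (intro filtI[of "\<pi> \<star> w"]) (auto simp: subspace_scale mult.commute)
    have "(U ^^ fact (M (Suc n))) z - (U ^^ fact (M n)) z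
      = ((U ^^ fact m) z - (U ^^ fact (M n)) z) - ((U ^^ fact m) z - (U ^^ fact (M (Suc n))) z)" by simp
    then show ?thesis using a b subspace_F by (simp only: subspace_diff)
  qed
  from complete[OF T B Z pow_Z[OF z] this]
  obtain L where L: "L \<in> Z" "\<And>n. (U ^^ fact (M n)) z - L \<in> F n" by blast
  have "(U ^^ fact m) z - L \<in> F n" if "m \<ge> M n" for m n
  proof -
    have "(U ^^ fact m) z - L = ((U ^^ fact m) z - (U ^^ fact (M n)) z) + ((U ^^ fact (M n)) z - L)" by simp
    then show ?thesis using M[OF that] L(2)[of n] subspace_F by (simp only: subspace_add)
  qed
  then show ?thesis unfolding is_ord_def using L(1) by blast
qed

text \<open>Two limits differ by an element of every filtration step, so \<open>separated\<close>
  applies. This is what justifies the \<open>THE\<close> in \<open>ord_projector\<close>.\<close>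

lemma is_ord_unique:
  assumes "is_ord z l" "is_ord z l'"
  shows "l - l' \<in> B"
proof (rule separated[OF T B Z])
  fix n
  obtain M M' where "\<forall>m\<ge>M. (U ^^ fact m) z - l \<in> F n" "\<forall>m\<ge>M'. (U ^^ fact m) z - l' \<in> F n"
    using assms unfolding is_ord_def by meson
  then have "(U ^^ fact (max M M')) z - l \<in> F n" "(U ^^ fact (max M M')) z - l' \<in> F n" by auto
  moreover have "l - l' = ((U ^^ fact (max M M')) z - l') - ((U ^^ fact (max M M')) z - l)" by simp
  ultimately show "l - l' \<in> F n" using subspace_F by (simp only: subspace_diff)
qed

lemma is_ord_add:
  assumes "is_ord x l" "is_ord y l'"
  shows "is_ord (x + y) (l + l')"
  unfolding is_ord_def
proof (intro conjI allI)
  show "l + l' \<in> Z" using assms subspace_Z by (auto simp: is_ord_def subspace_add)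
  fix n
  obtain M M' where "\<forall>m\<ge>M. (U ^^ fact m) x - l \<in> F n" "\<forall>m\<ge>M'. (U ^^ fact m) y - l' \<in> F n"
    using assms unfolding is_ord_def by meson
  then have "\<forall>m\<ge>max M M'. ((U ^^ fact m) x - l) + ((U ^^ fact m) y - l') \<in> F n"
    using subspace_F by (auto intro: subspace_add)
  then show "\<exists>M. \<forall>m\<ge>M. (U ^^ fact m) (x + y) - (l + l') \<in> F n"
    by (intro exI[of _ "max M M'"]) (simp add: pow_add add_diff_add)
qed

lemma is_ord_scale:
  assumes "is_ord x l"
  shows "is_ord (c \<star> x) (c \<star> l)"
  unfolding is_ord_def
proof (intro conjI allI)
  show "c \<star> l \<in> Z" using assms subspace_Z by (auto simp: is_ord_def subspace_scale)
  fix n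
  obtain M where "\<forall>m\<ge>M. (U ^^ fact m) x - l \<in> F n"
    using assms unfolding is_ord_def by meson
  then have "\<forall>m\<ge>M. c \<star> ((U ^^ fact m) x - l) \<in> F n"
    using subspace_F by (auto intro: subspace_scale)
  then show "\<exists>M. \<forall>m\<ge>M. (U ^^ fact m) (c \<star> x) - (c \<star> l) \<in> F n"
    by (auto simp: pow_scale scale_right_diff_distrib)
qed

lemma is_ord_B: "b \<in> B \<Longrightarrow> is_ord b 0"
  unfolding is_ord_def using subspace_0[OF subspace_Z] pow_B B_subset_F by (auto simp: subset_iff)

lemma is_ord_mod_B:
  assumes "is_ord x l" "l - l' \<in> B"
  shows "is_ord x l'"
  unfolding is_ord_def
proof (intro conjI allI)
  have "l - (l - l') \<in> Z"
    using assms B_subset_Z unfolding is_ord_def by (blast intro: subspace_diff[OF subspace_Z])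
  then show "l' \<in> Z" by simp
  fix n
  obtain M where "\<forall>m\<ge>M. (U ^^ fact m) x - l \<in> F n"
    using assms unfolding is_ord_def by meson
  moreover have "(U ^^ fact m) x - l' = ((U ^^ fact m) x - l) + (l - l')" for m by simp
  ultimately have "\<forall>m\<ge>M. (U ^^ fact m) x - l' \<in> F n"
    using subspace_add[OF subspace_F[of n]] B_subset_F[of n] assms(2) by (metis subsetD)
  then show "\<exists>M. \<forall>m\<ge>M. (U ^^ fact m) x - l' \<in> F n" by blast
qed

text \<open>Modulo p^n, \<open>l\<close> is \<open>(U ^^ fact m) z\<close> for large
  \<open>m\<close>, and by \<open>eventually_idempotent\<close> another application of
  \<open>U ^^ fact m\<close> does not move that element.\<close>

lemma is_ord_idem:
  assumes z: "z \<in> Z" and l: "is_ord z l"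
  shows "is_ord l l"
proof -
  have lZ: "l \<in> Z" using l by (simp add: is_ord_def)
  have "\<exists>M. \<forall>m\<ge>M. (U ^^ fact m) l - l \<in> F n" for n
  proof -
    obtain M where M: "\<And>m. m \<ge> M \<Longrightarrow> (U ^^ fact m) ((U ^^ fact m) z) - (U ^^ fact m) z \<in> F n"
      using eventually_idempotent[of n] z by blast
    obtain M' where M': "\<And>m. m \<ge> M' \<Longrightarrow> (U ^^ fact m) z - l \<in> F n" using l unfolding is_ord_def by meson
    have "(U ^^ fact m) l - l \<in> F n" if "m \<ge> max M M'" for m
    proof -
      have 1: "(U ^^ fact m) ((U ^^ fact m) z - l) \<in> F n" using M' that by (intro pow_F) auto
      have "(U ^^ fact m) l - l = ((U ^^ fact m) ((U ^^ fact m) z) - (U ^^ fact m) z)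
         - (U ^^ fact m) ((U ^^ fact m) z - l) + ((U ^^ fact m) z - l)"
        by (simp add: pow_diff)
      also have "\<dots> \<in> F n"
        using that by (intro subspace_add[OF subspace_F] subspace_diff[OF subspace_F, OF _ 1] M M') auto
      finally show ?thesis .
    qed
    then show ?thesis by blast
  qed
  then show ?thesis unfolding is_ord_def using lZ by blast
qed

text \<open>Nakayama's lemma for the module \<open>E\<close> of all ordinary limits and its
  submodule \<open>W\<close> of limits from \<open>span Y\<close>. Modulo p an ordinary element is a
  value of \<open>U ^^ fact m\<close>, hence a value of \<open>U\<close>, and \<open>gen\<close>
  replaces it by an element of \<open>span Y\<close>.\<close>

theorem ordinary_generated:
  assumes Y: "Y \<subseteq> Z"
    and gen: "\<And>z. z \<in> Z \<Longrightarrow> \<exists>w \<in> span Y. U z - w \<in> F 1"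
    and z: "z \<in> Z" "is_ord z l"
  shows "\<exists>w \<in> span Y. is_ord w l"
proof -
  have sYZ: "span Y \<subseteq> Z" using Y subspace_Z by (rule span_minimal)
  define W where "W = {l. \<exists>w \<in> span Y. is_ord w l}"
  define E where "E = {l. \<exists>z \<in> Z. is_ord z l}"
  have sub: "subspace {l. \<exists>w \<in> A. is_ord w l}" if "subspace A" for A
  proof (rule subspaceI)
    show "0 \<in> {l. \<exists>w \<in> A. is_ord w l}" using is_ord_B[OF subspace_0[OF B]] subspace_0[OF that] by blast
  next
    fix x y assume "x \<in> {l. \<exists>w \<in> A. is_ord w l}" "y \<in> {l. \<exists>w \<in> A. is_ord w l}"
    then show "x + y \<in> {l. \<exists>w \<in> A. is_ord w l}" using is_ord_add subspace_add[OF that] by blast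
  next
    fix c x assume "x \<in> {l. \<exists>w \<in> A. is_ord w l}"
    then show "c \<star> x \<in> {l. \<exists>w \<in> A. is_ord w l}" using is_ord_scale subspace_scale[OF that] by blast
  qed
  have BB: "B \<subseteq> {l. \<exists>w \<in> A. is_ord w l}" if "subspace A" for A
  proof
    fix b assume "b \<in> B"
    then have "is_ord 0 b"
      using is_ord_mod_B[OF is_ord_B[OF subspace_0[OF B]], of b] B by (simp add: subspace_neg)
    then show "b \<in> {l. \<exists>w \<in> A. is_ord w l}" using subspace_0[OF that] by blast
  qed
  have E: "subspace E" "B \<subseteq> E" unfolding E_def using sub BB subspace_Z by auto
  have W: "subspace W" "B \<subseteq> W" unfolding W_def using sub BB by auto
  have EZ: "E \<subseteq> span (T \<union> B)" unfolding E_def is_ord_def Z[symmetric] by auto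
  obtain T' where T': "finite T'" "E = span (T' \<union> B)" using noetherian[OF T B E EZ] by blast
  have "E \<subseteq> W"
  proof (rule nakayama[OF T' W])
    fix x assume "x \<in> E"
    then obtain z where z: "z \<in> Z" "is_ord z x" unfolding E_def by blast
    then have xZ: "x \<in> Z" by (simp add: is_ord_def)
    obtain m where "(U ^^ fact m) z - x \<in> F 1" using z(2) unfolding is_ord_def by (meson order_refl)
    then obtain z1 where z1: "z1 \<in> Z" "(U ^^ fact m) z - x - \<pi> \<star> z1 \<in> B" unfolding filt_def by auto
    \<comment> \<open>Factorials are positive, so one application of \<open>U\<close> can be split
      off for \<open>gen\<close>.\<close>
    obtain f where "fact m = Suc f" using fact_nonzero[of m] by (metis not0_implies_Suc)
    then have "(U ^^ fact m) z = U ((U ^^ f) z)" by simp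
    then obtain w where w: "w \<in> span Y" "(U ^^ fact m) z - w \<in> F 1" using gen pow_Z[OF z(1)] by metis
    then obtain z2 where z2: "z2 \<in> Z" "(U ^^ fact m) z - w - \<pi> \<star> z2 \<in> B" unfolding filt_def by auto
    define b where "b = ((U ^^ fact m) z - w - \<pi> \<star> z2) - ((U ^^ fact m) z - x - \<pi> \<star> z1)"
    have b: "b \<in> B" unfolding b_def using z1 z2 B by (simp only: subspace_diff)
    have x: "x = w + (\<pi> \<star> (z2 - z1) + b)" by (simp add: b_def scale_right_diff_distrib)
    have z21: "z2 - z1 \<in> Z" using z1 z2 subspace_Z by (simp add: subspace_diff)
    obtain lw where lw: "is_ord w lw" using is_ord_exists w sYZ by blast
    obtain ly where ly: "is_ord (z2 - z1) ly" using is_ord_exists z21 by blast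
    \<comment> \<open>The decomposition of \<open>x\<close> is projected. As \<open>x\<close> is its
      own limit by \<open>is_ord_idem\<close>, this exhibits \<open>x\<close> as an element of
      \<open>W + p E\<close>, up to \<open>B\<close>.\<close>
    have "is_ord x (lw + (\<pi> \<star> ly + 0))"
      by (subst x) (intro is_ord_add is_ord_scale lw ly is_ord_B b)
    then have "x - (lw + (\<pi> \<star> ly + 0)) \<in> B" using is_ord_unique is_ord_idem[OF z] by blast
    then have "lw - (x - \<pi> \<star> ly) \<in> B" using subspace_neg[OF B] by (fastforce simp: algebra_simps)
    then have "is_ord w (x - \<pi> \<star> ly)" using is_ord_mod_B[OF lw] by blast
    then show "\<exists>y\<in>E. x - \<pi> \<star> y \<in> W" using w z21 ly unfolding W_def E_def by blast
  qed
  then show ?thesis using z unfolding E_def W_def by blast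
qed

end

section \<open>Tensor products and cocycles\<close>

lemma sum_keys_superset:
  assumes "finite S" "Poly_Mapping.keys x \<subseteq> S" "\<And>g. \<phi> g 0 = 0"
  shows "(\<Sum>g\<in>Poly_Mapping.keys x. \<phi> g (Poly_Mapping.lookup x g)) = (\<Sum>g\<in>S. \<phi> g (Poly_Mapping.lookup x g))"
  using assms by (intro sum.mono_neutral_left) (auto simp: in_keys_iff)

lemma sum_keys_add:
  assumes "\<And>g. \<phi> g 0 = 0" "\<And>g v w. \<phi> g (v + w) = \<phi> g v + \<phi> g w"
  shows "(\<Sum>g\<in>Poly_Mapping.keys (x + y). \<phi> g (Poly_Mapping.lookup (x + y) g))
    = (\<Sum>g\<in>Poly_Mapping.keys x. \<phi> g (Poly_Mapping.lookup x g))
      + (\<Sum>g\<in>Poly_Mapping.keys y. \<phi> g (Poly_Mapping.lookup y g))"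
proof -
  let ?S = "Poly_Mapping.keys x \<union> Poly_Mapping.keys y"
  have "(\<Sum>g\<in>Poly_Mapping.keys (x + y). \<phi> g (Poly_Mapping.lookup (x + y) g))
      = (\<Sum>g\<in>?S. \<phi> g (Poly_Mapping.lookup (x + y) g))"
    by (rule sum_keys_superset) (simp_all add: keys_add assms)
  also have "\<dots> = (\<Sum>g\<in>?S. \<phi> g (Poly_Mapping.lookup x g)) + (\<Sum>g\<in>?S. \<phi> g (Poly_Mapping.lookup y g))"
    by (simp add: lookup_add assms sum.distrib)
  also have "(\<Sum>g\<in>?S. \<phi> g (Poly_Mapping.lookup x g)) = (\<Sum>g\<in>Poly_Mapping.keys x. \<phi> g (Poly_Mapping.lookup x g))"
    by (rule sum_keys_superset[symmetric]) (simp_all add: assms)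
  also have "(\<Sum>g\<in>?S. \<phi> g (Poly_Mapping.lookup y g)) = (\<Sum>g\<in>Poly_Mapping.keys y. \<phi> g (Poly_Mapping.lookup y g))"
    by (rule sum_keys_superset[symmetric]) (simp_all add: assms)
  finally show ?thesis .
qed

context comm_group
begin

lemma finprod_keys_superset:
  assumes "finite S" "Poly_Mapping.keys x \<subseteq> S" "\<And>g. g \<in> S \<Longrightarrow> \<phi> g 0 = \<one>"
    and "\<And>g. g \<in> S \<Longrightarrow> \<phi> g (Poly_Mapping.lookup x g) \<in> carrier G"
  shows "finprod G (\<lambda>g. \<phi> g (Poly_Mapping.lookup x g)) (Poly_Mapping.keys x)
    = finprod G (\<lambda>g. \<phi> g (Poly_Mapping.lookup x g)) S"
  using assms by (intro finprod_mono_neutral_cong_left) (auto simp: in_keys_iff)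

text \<open>\<open>\<phi>\<close> is multiplicative only for arguments in \<open>K\<close> and
  \<open>V\<close>; the supports are enlarged to their union so that the factors can be compared one
  by one.\<close>

lemma finprod_keys_add:
  assumes K: "Poly_Mapping.keys x \<subseteq> K" "Poly_Mapping.keys y \<subseteq> K"
    and V: "\<And>g. Poly_Mapping.lookup x g \<in> V" "\<And>g. Poly_Mapping.lookup y g \<in> V"
    and V_add: "\<And>v w. v \<in> V \<Longrightarrow> w \<in> V \<Longrightarrow> v + w \<in> V"
    and \<phi>: "\<And>g v. g \<in> K \<Longrightarrow> v \<in> V \<Longrightarrow> \<phi> g v \<in> carrier G"
      "\<And>g v w. g \<in> K \<Longrightarrow> v \<in> V \<Longrightarrow> w \<in> V \<Longrightarrow> \<phi> g (v + w) = \<phi> g v \<otimes> \<phi> g w"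
      "\<And>g. g \<in> K \<Longrightarrow> \<phi> g 0 = \<one>"
  shows "finprod G (\<lambda>g. \<phi> g (Poly_Mapping.lookup (x + y) g)) (Poly_Mapping.keys (x + y))
    = finprod G (\<lambda>g. \<phi> g (Poly_Mapping.lookup x g)) (Poly_Mapping.keys x)
      \<otimes> finprod G (\<lambda>g. \<phi> g (Poly_Mapping.lookup y g)) (Poly_Mapping.keys y)"
proof -
  let ?S = "Poly_Mapping.keys x \<union> Poly_Mapping.keys y"
  have S: "finite ?S" "Poly_Mapping.keys (x + y) \<subseteq> ?S" "Poly_Mapping.keys x \<subseteq> ?S" "Poly_Mapping.keys y \<subseteq> ?S" "?S \<subseteq> K"
    using K by (auto simp: keys_add)
  have "finprod G (\<lambda>g. \<phi> g (Poly_Mapping.lookup (x + y) g)) (Poly_Mapping.keys (x + y))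
     = finprod G (\<lambda>g. \<phi> g (Poly_Mapping.lookup (x + y) g)) ?S"
    using S V \<phi> V_add by (intro finprod_keys_superset) (auto simp: lookup_add)
  also have "\<dots> = finprod G (\<lambda>g. \<phi> g (Poly_Mapping.lookup x g) \<otimes> \<phi> g (Poly_Mapping.lookup y g)) ?S"
    using S V \<phi> by (intro finprod_cong) (auto simp: lookup_add simp_implies_def)
  also have "\<dots> = finprod G (\<lambda>g. \<phi> g (Poly_Mapping.lookup x g)) ?S
      \<otimes> finprod G (\<lambda>g. \<phi> g (Poly_Mapping.lookup y g)) ?S"
    using S V \<phi> by (intro finprod_multf) auto
  also have "finprod G (\<lambda>g. \<phi> g (Poly_Mapping.lookup x g)) ?S
     = finprod G (\<lambda>g. \<phi> g (Poly_Mapping.lookup x g)) (Poly_Mapping.keys x)"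
    using S V \<phi> by (intro finprod_keys_superset[symmetric]) auto
  also have "finprod G (\<lambda>g. \<phi> g (Poly_Mapping.lookup y g)) ?S
     = finprod G (\<lambda>g. \<phi> g (Poly_Mapping.lookup y g)) (Poly_Mapping.keys y)"
    using S V \<phi> by (intro finprod_keys_superset[symmetric]) auto
  finally show ?thesis .
qed

lemma finprod_int_pow:
  assumes "f \<in> I \<rightarrow> carrier G"
  shows "finprod G f I [^] (n :: int) = finprod G (\<lambda>i. f i [^] n) I"
  using assms
  by (induction I rule: infinite_finite_induct) (auto simp: int_pow_distrib Pi_def)

lemma finprod_int_pow_sum:
  assumes "a \<in> carrier G"
  shows "finprod G (\<lambda>i. a [^] (n i :: int)) I = a [^] (\<Sum>i\<in>I. n i)"
  using assms
  by (induction I rule: infinite_finite_induct) (auto simp: int_pow_mult)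

end

lemma hom_finprod:
  assumes "h \<in> hom A B" "comm_group A" "comm_group B" "f \<in> I \<rightarrow> carrier A"
  shows "h (finprod A f I) = finprod B (\<lambda>i. h (f i)) I"
  using assms(4)
proof (induction I rule: infinite_finite_induct)
  case (infinite I)
  then show ?case
    using assms by (simp add: comm_group.axioms group.is_monoid hom_one comm_monoid.finprod_infinite)
next
  case empty
  show ?case
    using assms by (simp add: comm_group.axioms hom_one comm_monoid.finprod_empty)
next
  case (insert i I)
  interpret A: comm_group A by fact
  interpret B: comm_group B by fact
  have "h \<in> carrier A \<rightarrow> carrier B" using assms(1) by (simp add: hom_def)
  then show ?case using insert assms(1) by (auto simp: hom_mult Pi_def)
qed

subsection \<open>The universal property of the tensor product\<close>

locale balanced_tensor =
  fixes S :: "'s set" and ract :: "'m :: ab_group_add \<Rightarrow> 's \<Rightarrow> 'm" and M :: "'m set"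
    and lact :: "'s \<Rightarrow> 'n :: ab_group_add \<Rightarrow> 'n" and N :: "'n set"
  assumes M_add: "\<And>x y. x \<in> M \<Longrightarrow> y \<in> M \<Longrightarrow> x + y \<in> M"
    and N_add: "\<And>x y. x \<in> N \<Longrightarrow> y \<in> N \<Longrightarrow> x + y \<in> N"
    and M_zero: "0 \<in> M" and N_zero: "0 \<in> N"
    and M_act: "\<And>x s. x \<in> M \<Longrightarrow> s \<in> S \<Longrightarrow> ract x s \<in> M"
    and N_act: "\<And>x s. x \<in> N \<Longrightarrow> s \<in> S \<Longrightarrow> lact s x \<in> N"
begin

abbreviation "Fr \<equiv> free_Abelian_group (M \<times> N)"
abbreviation "Ker \<equiv> tensor_kernel S ract M lact N"
abbreviation "TP \<equiv> tensor S ract M lact N"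

definition pt :: "'m \<Rightarrow> 'n \<Rightarrow> ('m \<times> 'n \<Rightarrow>\<^sub>0 int) set" where
  "pt x v = Ker #>\<^bsub>Fr\<^esub> frag_of (x, v)"

lemma keys_diff3: "Poly_Mapping.keys (frag_of a - frag_of b - frag_of c) \<subseteq> {a, b, c}"
  using keys_diff[of "frag_of a - frag_of b" "frag_of c"] keys_diff[of "frag_of a" "frag_of b"] by auto

lemma keys_diff2: "Poly_Mapping.keys (frag_of a - frag_of b) \<subseteq> {a, b}"
  using keys_diff[of "frag_of a" "frag_of b"] by auto

lemma relations_carrier: "tensor_relations S ract M lact N \<subseteq> carrier Fr"
proof -
  have "Poly_Mapping.keys (frag_of a - frag_of b - frag_of c) \<subseteq> M \<times> N"
    if "a \<in> M \<times> N" "b \<in> M \<times> N" "c \<in> M \<times> N" for a b c :: "'m \<times> 'n"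
    using keys_diff3[of a b c] that by blast
  moreover have "Poly_Mapping.keys (frag_of a - frag_of b) \<subseteq> M \<times> N"
    if "a \<in> M \<times> N" "b \<in> M \<times> N" for a b :: "'m \<times> 'n"
    using keys_diff2[of a b] that by blast
  ultimately show ?thesis
    unfolding tensor_relations_def using M_add N_add M_act N_act by fastforce
qed

lemma subgroup_Ker: "subgroup Ker Fr"
  unfolding tensor_kernel_def
  by (rule group.generate_is_subgroup[OF group_free_Abelian_group relations_carrier])

lemma normal_Ker: "Ker \<lhd> Fr"
  using comm_group.subgroup_imp_normal[OF abelian_free_Abelian_group subgroup_Ker] .

lemma TP_comm_group: "comm_group TP"
  unfolding tensor_def by (rule comm_group.abelian_FactGroup[OF abelian_free_Abelian_group subgroup_Ker])

lemma carrier_TP: "carrier TP = (\<lambda>c. Ker #>\<^bsub>Fr\<^esub> c) ` carrier Fr"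
  unfolding tensor_def by (rule carrier_FactGroup)

lemma one_TP: "\<one>\<^bsub>TP\<^esub> = Ker"
  by (simp add: tensor_def)

lemma coset_mult:
  assumes "a \<in> carrier Fr" "b \<in> carrier Fr"
  shows "(Ker #>\<^bsub>Fr\<^esub> a) \<otimes>\<^bsub>TP\<^esub> (Ker #>\<^bsub>Fr\<^esub> b) = Ker #>\<^bsub>Fr\<^esub> (a + b)"
  using normal.rcos_sum[OF normal_Ker assms] by (simp add: tensor_def)

lemma coset_Ker: "c \<in> Ker \<Longrightarrow> Ker #>\<^bsub>Fr\<^esub> c = \<one>\<^bsub>TP\<^esub>"
  unfolding one_TP using subgroup.rcos_const[OF subgroup_Ker group_free_Abelian_group] .

lemma pt_closed: "x \<in> M \<Longrightarrow> v \<in> N \<Longrightarrow> pt x v \<in> carrier TP"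
  unfolding pt_def carrier_TP by simp

lemma relation_in_Ker: "r \<in> tensor_relations S ract M lact N \<Longrightarrow> r \<in> Ker"
  unfolding tensor_kernel_def by (rule generate.incl)

sublocale TP: comm_group TP
  by (rule TP_comm_group)

lemma coset_relation3:
  assumes "a \<in> M \<times> N" "b \<in> M \<times> N" "c \<in> M \<times> N" "frag_of a - frag_of b - frag_of c \<in> Ker"
  shows "Ker #>\<^bsub>Fr\<^esub> frag_of a = (Ker #>\<^bsub>Fr\<^esub> frag_of b) \<otimes>\<^bsub>TP\<^esub> (Ker #>\<^bsub>Fr\<^esub> frag_of c)"
proof -
  let ?r = "frag_of a - frag_of b - frag_of c"
  have bc: "frag_of b + frag_of c \<in> carrier Fr" "frag_of b \<in> carrier Fr" "frag_of c \<in> carrier Fr"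
    using assms keys_add[of "frag_of b" "frag_of c"] by auto
  have r: "?r \<in> carrier Fr" using assms(4) subgroup.subset[OF subgroup_Ker] by blast
  have "Ker #>\<^bsub>Fr\<^esub> frag_of a = (Ker #>\<^bsub>Fr\<^esub> ?r) \<otimes>\<^bsub>TP\<^esub> (Ker #>\<^bsub>Fr\<^esub> (frag_of b + frag_of c))"
    by (simp only: coset_mult[OF r bc(1)]) simp
  also have "\<dots> = Ker #>\<^bsub>Fr\<^esub> (frag_of b + frag_of c)"
    unfolding coset_Ker[OF assms(4)] using bc(1) by (intro TP.l_one) (auto simp: carrier_TP)
  also have "\<dots> = (Ker #>\<^bsub>Fr\<^esub> frag_of b) \<otimes>\<^bsub>TP\<^esub> (Ker #>\<^bsub>Fr\<^esub> frag_of c)"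
    using coset_mult[OF bc(2,3)] by simp
  finally show ?thesis .
qed

lemma coset_relation2:
  assumes "a \<in> M \<times> N" "b \<in> M \<times> N" "frag_of a - frag_of b \<in> Ker"
  shows "Ker #>\<^bsub>Fr\<^esub> frag_of a = Ker #>\<^bsub>Fr\<^esub> frag_of b"
proof -
  let ?r = "frag_of a - frag_of b"
  have b: "frag_of b \<in> carrier Fr" using assms by auto
  have r: "?r \<in> carrier Fr" using assms(3) subgroup.subset[OF subgroup_Ker] by blast
  have "Ker #>\<^bsub>Fr\<^esub> frag_of a = (Ker #>\<^bsub>Fr\<^esub> ?r) \<otimes>\<^bsub>TP\<^esub> (Ker #>\<^bsub>Fr\<^esub> frag_of b)"
    by (simp only: coset_mult[OF r b]) simp
  also have "\<dots> = Ker #>\<^bsub>Fr\<^esub> frag_of b"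
    unfolding coset_Ker[OF assms(3)] using b by (intro TP.l_one) (auto simp: carrier_TP)
  finally show ?thesis .
qed

lemma pt_add_left:
  assumes "x \<in> M" "y \<in> M" "v \<in> N"
  shows "pt (x + y) v = pt x v \<otimes>\<^bsub>TP\<^esub> pt y v"
  unfolding pt_def
  by (intro coset_relation3 relation_in_Ker)
    (use assms in \<open>auto simp: M_add tensor_relations_def\<close>)

lemma pt_add_right:
  assumes "x \<in> M" "v \<in> N" "w \<in> N"
  shows "pt x (v + w) = pt x v \<otimes>\<^bsub>TP\<^esub> pt x w"
  unfolding pt_def
  by (intro coset_relation3 relation_in_Ker)
    (use assms in \<open>auto simp: N_add tensor_relations_def\<close>)

lemma pt_act:
  assumes "x \<in> M" "v \<in> N" "s \<in> S"
  shows "pt (ract x s) v = pt x (lact s v)"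
  unfolding pt_def
  by (intro coset_relation2 relation_in_Ker)
    (use assms in \<open>auto simp: M_act N_act tensor_relations_def\<close>)

lemma pt_zero_left: "v \<in> N \<Longrightarrow> pt 0 v = \<one>\<^bsub>TP\<^esub>"
  using pt_add_left[of 0 0 v] TP.r_cancel_one'[of "pt 0 v" "pt 0 v"] by (simp add: M_zero pt_closed)

lemma pt_zero_right: "x \<in> M \<Longrightarrow> pt x 0 = \<one>\<^bsub>TP\<^esub>"
  using pt_add_right[of x 0 0] TP.r_cancel_one'[of "pt x 0" "pt x 0"] by (simp add: N_zero pt_closed)

text \<open>The product on the right is the one evaluated by \<open>tensor_lift\<close>; it is
  identified here with any homomorphism that has the prescribed values on generators.\<close>

lemma hom_free_finprod:
  fixes A :: "('a, 'b) monoid_scheme" and f :: "'m \<Rightarrow> 'n \<Rightarrow> 'a"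
  assumes A: "comm_group A" and h: "h \<in> hom Fr A"
    and hf: "\<And>z. z \<in> M \<times> N \<Longrightarrow> h (frag_of z) = f (fst z) (snd z)"
    and c: "c \<in> carrier Fr"
  shows "h c = finprod A (\<lambda>z. f (fst z) (snd z) [^]\<^bsub>A\<^esub> Poly_Mapping.lookup c z) (Poly_Mapping.keys c)"
proof -
  interpret A: comm_group A by fact
  have sum: "h (\<Sum>z\<in>I. frag_cmul (n z) (frag_of z)) = finprod A (\<lambda>z. f (fst z) (snd z) [^]\<^bsub>A\<^esub> n z) I
      \<and> (\<Sum>z\<in>I. frag_cmul (n z) (frag_of z)) \<in> carrier Fr"
    if "finite I" "I \<subseteq> M \<times> N" for n :: "'m \<times> 'n \<Rightarrow> int" and I
    using that
  proof (induction I rule: finite_induct)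
    case empty
    then show ?case using hom_one[OF h group_free_Abelian_group A.is_group] by simp
  next
    case (insert z I)
    have z: "frag_cmul (n z) (frag_of z) \<in> carrier Fr"
      using insert.prems keys_cmul[of "n z" "frag_of z"] by auto
    have "h (frag_cmul (n z) (frag_of z)) = h (frag_of z [^]\<^bsub>Fr\<^esub> n z)"
      using insert.prems by simp
    also have "\<dots> = f (fst z) (snd z) [^]\<^bsub>A\<^esub> n z"
      using insert.prems hom_int_pow[OF h, of "frag_of z" "n z"] hf[of z] by (simp add: A.is_group)
    finally have hz: "h (frag_cmul (n z) (frag_of z)) = f (fst z) (snd z) [^]\<^bsub>A\<^esub> n z" .
    have fc: "f (fst y) (snd y) \<in> carrier A" if "y \<in> M \<times> N" for y
      using hf[OF that] hom_in_carrier[OF h, of "frag_of y"] that by auto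
    have IH: "h (\<Sum>z\<in>I. frag_cmul (n z) (frag_of z)) = finprod A (\<lambda>z. f (fst z) (snd z) [^]\<^bsub>A\<^esub> n z) I"
      "(\<Sum>z\<in>I. frag_cmul (n z) (frag_of z)) \<in> carrier Fr"
      using insert by auto
    have "h (frag_cmul (n z) (frag_of z) + (\<Sum>z\<in>I. frag_cmul (n z) (frag_of z)))
        = h (frag_cmul (n z) (frag_of z)) \<otimes>\<^bsub>A\<^esub> h (\<Sum>z\<in>I. frag_cmul (n z) (frag_of z))"
      using hom_mult[OF h z IH(2)] by simp
    moreover have "frag_cmul (n z) (frag_of z) + (\<Sum>z\<in>I. frag_cmul (n z) (frag_of z)) \<in> carrier Fr"
      using monoid.m_closed[OF group.is_monoid[OF group_free_Abelian_group] z IH(2)] by simp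
    moreover have "finprod A (\<lambda>z. f (fst z) (snd z) [^]\<^bsub>A\<^esub> n z) (insert z I)
        = f (fst z) (snd z) [^]\<^bsub>A\<^esub> n z \<otimes>\<^bsub>A\<^esub> finprod A (\<lambda>z. f (fst z) (snd z) [^]\<^bsub>A\<^esub> n z) I"
      using insert.prems insert.hyps by (intro A.finprod_insert Pi_I A.int_pow_closed fc) auto
    ultimately show ?case
      using insert.hyps by (simp add: hz IH del: carrier_free_Abelian_group_iff)
  qed
  have "c = (\<Sum>z\<in>Poly_Mapping.keys c. frag_cmul (Poly_Mapping.lookup c z) (frag_of z))"
    using frag_expansion[of c] by (simp add: frag_extend_def)
  then show ?thesis using sum[of "Poly_Mapping.keys c" "Poly_Mapping.lookup c"] c by simp
qed

text \<open>The tensor relations die under the homomorphism \<open>h\<close> of the free group, so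
  \<open>h\<close> is constant on cosets and the representative picked by \<open>SOME\<close> inside
  \<open>tensor_lift\<close> does not matter.\<close>

lemma tensor_lift_coset:
  fixes A :: "('a, 'b) monoid_scheme" and f :: "'m \<Rightarrow> 'n \<Rightarrow> 'a"
  assumes A: "comm_group A"
    and closed: "\<And>x v. x \<in> M \<Longrightarrow> v \<in> N \<Longrightarrow> f x v \<in> carrier A"
    and add_left: "\<And>x y v. x \<in> M \<Longrightarrow> y \<in> M \<Longrightarrow> v \<in> N \<Longrightarrow> f (x + y) v = f x v \<otimes>\<^bsub>A\<^esub> f y v"
    and add_right: "\<And>x v w. x \<in> M \<Longrightarrow> v \<in> N \<Longrightarrow> w \<in> N \<Longrightarrow> f x (v + w) = f x v \<otimes>\<^bsub>A\<^esub> f x w"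
    and act: "\<And>x s v. x \<in> M \<Longrightarrow> s \<in> S \<Longrightarrow> v \<in> N \<Longrightarrow> f (ract x s) v = f x (lact s v)"
  shows "tensor_lift A f \<in> hom TP A"
    and "\<And>x v. x \<in> M \<Longrightarrow> v \<in> N \<Longrightarrow> tensor_lift A f (pt x v) = f x v"
proof -
  interpret A: comm_group A by fact
  have "(\<lambda>z. f (fst z) (snd z)) ` (M \<times> N) \<subseteq> carrier A" using closed by auto
  then obtain h where h: "h \<in> hom Fr A" and hf: "\<And>z. z \<in> M \<times> N \<Longrightarrow> h (frag_of z) = f (fst z) (snd z)"
    using A.free_Abelian_group_universal[of "\<lambda>z. f (fst z) (snd z)" "M \<times> N"] by blast
  interpret h: group_hom Fr A h
    using h by (simp add: group_hom_def group_hom_axioms_def A.is_group)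
  have hdiff: "h (x - y) = h x \<otimes>\<^bsub>A\<^esub> inv\<^bsub>A\<^esub> h y" if "x \<in> carrier Fr" "y \<in> carrier Fr" for x y
    using h.hom_mult[of x "- y"] h.hom_inv[of y] that by simp
  have cancel: "a \<otimes>\<^bsub>A\<^esub> b \<otimes>\<^bsub>A\<^esub> inv\<^bsub>A\<^esub> a \<otimes>\<^bsub>A\<^esub> inv\<^bsub>A\<^esub> b = \<one>\<^bsub>A\<^esub>"
    if "a \<in> carrier A" "b \<in> carrier A" for a b
    using that by (simp add: A.m_comm[of a b] A.m_assoc[of b a])
  have fr: "frag_of z \<in> carrier Fr" if "z \<in> M \<times> N" for z using that by simp
  have diff: "x - y \<in> carrier Fr" if "x \<in> carrier Fr" "y \<in> carrier Fr" for x y :: "'m \<times> 'n \<Rightarrow>\<^sub>0 int"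
    using that keys_diff[of x y] by auto
  have "tensor_relations S ract M lact N \<subseteq> kernel Fr A h"
  proof
    fix r assume "r \<in> tensor_relations S ract M lact N"
    moreover have "h r = \<one>\<^bsub>A\<^esub>"
    proof -
      consider (l) x y v where "r = frag_of (x + y, v) - frag_of (x, v) - frag_of (y, v)" "x \<in> M" "y \<in> M" "v \<in> N"
        | (r) x v w where "r = frag_of (x, v + w) - frag_of (x, v) - frag_of (x, w)" "x \<in> M" "v \<in> N" "w \<in> N"
        | (a) x s v where "r = frag_of (ract x s, v) - frag_of (x, lact s v)" "x \<in> M" "s \<in> S" "v \<in> N"
        using \<open>r \<in> _\<close> unfolding tensor_relations_def by blast
      then show ?thesis
      proof cases
        case l
        then show ?thesis
          by (simp add: hdiff diff M_add fr hf add_left closed cancel del: carrier_free_Abelian_group_iff)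
      next
        case r
        then show ?thesis
          by (simp add: hdiff diff N_add fr hf add_right closed cancel del: carrier_free_Abelian_group_iff)
      next
        case a
        then show ?thesis
          by (simp add: hdiff M_act N_act fr hf act closed del: carrier_free_Abelian_group_iff)
      qed
    qed
    ultimately show "r \<in> kernel Fr A h" using relations_carrier unfolding kernel_def by blast
  qed
  then have Ker: "Ker \<subseteq> kernel Fr A h"
    unfolding tensor_kernel_def
    by (rule group.generate_subgroup_incl[OF group_free_Abelian_group _ h.subgroup_kernel])
  have lift: "tensor_lift A f (Ker #>\<^bsub>Fr\<^esub> c) = h c" if c: "c \<in> carrier Fr" for c
  proof -
    define c' where "c' = (SOME c'. c' \<in> Ker #>\<^bsub>Fr\<^esub> c)"
    have "c \<in> Ker #>\<^bsub>Fr\<^esub> c" using subgroup.one_closed[OF subgroup_Ker] unfolding r_coset_def by force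
    then have "c' \<in> Ker #>\<^bsub>Fr\<^esub> c" unfolding c'_def by (rule someI)
    then obtain k where k: "k \<in> Ker" "c' = k + c" unfolding r_coset_def by auto
    then have kc: "k \<in> carrier Fr" "h k = \<one>\<^bsub>A\<^esub>" using Ker by (auto simp: kernel_def)
    then have "h c' = h c" using k(2) c h.hom_mult[of k c] by (simp del: carrier_free_Abelian_group_iff)
    moreover have "c' \<in> carrier Fr"
      using monoid.m_closed[OF group.is_monoid[OF group_free_Abelian_group] kc(1) c] k by simp
    ultimately show ?thesis
      unfolding tensor_lift_def Let_def c'_def[symmetric]
      using hom_free_finprod[OF A h hf] by simp
  qed
  show "tensor_lift A f \<in> hom TP A"
  proof (rule homI)
    fix t assume "t \<in> carrier TP"
    then show "tensor_lift A f t \<in> carrier A" by (auto simp: carrier_TP lift simp del: carrier_free_Abelian_group_iff)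
  next
    fix t u assume "t \<in> carrier TP" "u \<in> carrier TP"
    then obtain a b where ab: "a \<in> carrier Fr" "b \<in> carrier Fr" "t = Ker #>\<^bsub>Fr\<^esub> a" "u = Ker #>\<^bsub>Fr\<^esub> b"
      unfolding carrier_TP by blast
    moreover have "a + b \<in> carrier Fr"
      using monoid.m_closed[OF group.is_monoid[OF group_free_Abelian_group] ab(1,2)] by simp
    ultimately show "tensor_lift A f (t \<otimes>\<^bsub>TP\<^esub> u) = tensor_lift A f t \<otimes>\<^bsub>A\<^esub> tensor_lift A f u"
      using h.hom_mult[OF ab(1,2)] by (simp add: coset_mult lift del: carrier_free_Abelian_group_iff)
  qed
  show "tensor_lift A f (pt x v) = f x v" if "x \<in> M" "v \<in> N" for x v
    unfolding pt_def using that by (subst lift) (auto simp: hf)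
qed

text \<open>The representative picked inside \<open>tensor_lift\<close> is supported on
  \<open>M \<times> N\<close>, so only values there count. Maps given by a formula on whole types
  can thus be replaced by those built from cocycles.\<close>

lemma tensor_lift_cong:
  assumes "comm_group A"
    and "\<And>x v. x \<in> M \<Longrightarrow> v \<in> N \<Longrightarrow> f x v = f' x v"
    and "\<And>x v. x \<in> M \<Longrightarrow> v \<in> N \<Longrightarrow> f' x v \<in> carrier A"
    and t: "t \<in> carrier TP"
  shows "tensor_lift A f t = tensor_lift A f' t"
proof -
  interpret A: comm_group A by fact
  obtain c where c: "c \<in> carrier Fr" "t = Ker #>\<^bsub>Fr\<^esub> c" using t unfolding carrier_TP by blast
  define c' where "c' = (SOME c'. c' \<in> t)"
  have "c \<in> t" using c subgroup.one_closed[OF subgroup_Ker] unfolding r_coset_def by force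
  then have "c' \<in> t" unfolding c'_def by (rule someI)
  then obtain k where k: "k \<in> Ker" "c' = k + c" unfolding c(2) r_coset_def by auto
  then have "c' \<in> carrier Fr"
    using monoid.m_closed[OF group.is_monoid[OF group_free_Abelian_group] subgroup.mem_carrier[OF subgroup_Ker k(1)] c(1)]
    by simp
  then have "fst z \<in> M \<and> snd z \<in> N" if "z \<in> Poly_Mapping.keys c'" for z using that by fastforce
  then show ?thesis
    unfolding tensor_lift_def Let_def c'_def[symmetric]
    using assms(2,3) by (intro A.finprod_cong) (auto simp: simp_implies_def)
qed

lemma TP_generated:
  assumes H: "subgroup H TP" and pt: "\<And>x v. x \<in> M \<Longrightarrow> v \<in> N \<Longrightarrow> pt x v \<in> H"
  shows "H = carrier TP"
proof -
  have "Ker #>\<^bsub>Fr\<^esub> c \<in> H" if "Poly_Mapping.keys c \<subseteq> M \<times> N" for c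
    using that
  proof (rule free_Abelian_group_induct[where P = "\<lambda>c. Ker #>\<^bsub>Fr\<^esub> c \<in> H"], goal_cases)
    case 1
    show ?case using coset_Ker[of 0] subgroup.one_closed[OF subgroup_Ker] subgroup.one_closed[OF H] by simp
  next
    case (2 x y)
    have y: "- y \<in> carrier Fr" using 2 by simp
    have "(Ker #>\<^bsub>Fr\<^esub> y) \<otimes>\<^bsub>TP\<^esub> (Ker #>\<^bsub>Fr\<^esub> - y) = \<one>\<^bsub>TP\<^esub>"
      using 2 y coset_Ker[of 0] subgroup.one_closed[OF subgroup_Ker] by (simp add: coset_mult)
    then have "Ker #>\<^bsub>Fr\<^esub> - y = inv\<^bsub>TP\<^esub> (Ker #>\<^bsub>Fr\<^esub> y)"
      using TP.inv_equality[of "Ker #>\<^bsub>Fr\<^esub> - y" "Ker #>\<^bsub>Fr\<^esub> y"] 2 y TP.m_comm by (simp add: carrier_TP)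
    then have "Ker #>\<^bsub>Fr\<^esub> - y \<in> H" using subgroup.m_inv_closed[OF H] 2 by simp
    then have "(Ker #>\<^bsub>Fr\<^esub> x) \<otimes>\<^bsub>TP\<^esub> (Ker #>\<^bsub>Fr\<^esub> - y) \<in> H" using subgroup.m_closed[OF H] 2 by simp
    then show ?case using 2 y by (simp add: coset_mult)
  next
    case (3 a)
    then show ?case using pt[of "fst a" "snd a"] by (auto simp: pt_def)
  qed
  then show ?thesis using subgroup.subset[OF H] by (auto simp: carrier_TP)
qed

end

subsection \<open>Tensoring with the augmentation ideal\<close>

definition aug :: "('g \<Rightarrow>\<^sub>0 int) \<Rightarrow> int" where
  "aug x = (\<Sum>g\<in>Poly_Mapping.keys x. Poly_Mapping.lookup x g)"

lemma aug_add: "aug (x + y) = aug x + aug y"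
  unfolding aug_def by (rule sum_keys_add[of "\<lambda>g n. n"]) simp_all

lemma aug_zero [simp]: "aug 0 = 0"
  by (simp add: aug_def)

lemma aug_single [simp]: "aug (Poly_Mapping.single g n) = n"
  by (simp add: aug_def)

lemma aug_sum: "aug (\<Sum>i\<in>I. f i) = (\<Sum>i\<in>I. aug (f i))"
  by (induction I rule: infinite_finite_induct) (simp_all add: aug_add)

lemma aug_diff: "aug (x - y) = aug x - aug y"
  using aug_add[of "x - y" y] by simp

lemma aug_mult: "aug (group_ring_mult G x y) = aug x * aug y"
  unfolding group_ring_mult_def aug_sum aug_single by (simp add: aug_def sum_product)

lemma keys_sum_subset:
  "(\<And>i. i \<in> I \<Longrightarrow> Poly_Mapping.keys (f i) \<subseteq> K) \<Longrightarrow> Poly_Mapping.keys (\<Sum>i\<in>I. f i) \<subseteq> K"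
proof (induction I rule: infinite_finite_induct)
  case (insert i I)
  then show ?case using keys_add[of "f i" "\<Sum>i\<in>I. f i"] by (auto simp del: keys_add)
qed auto

lemma frag_cmul_diff_distrib2: "frag_cmul c (a - b) = frag_cmul c a - frag_cmul c b"
  by (rule poly_mapping_eqI) (simp add: lookup_minus right_diff_distrib)

lemma frag_cmul_sum_left: "frag_cmul (\<Sum>i\<in>I. n i) a = (\<Sum>i\<in>I. frag_cmul (n i) a)"
  by (induction I rule: infinite_finite_induct) (simp_all add: frag_cmul_distrib)

lemma group_ring_mult_frag_of:
  "group_ring_mult G x (frag_of h)
    = (\<Sum>a\<in>Poly_Mapping.keys x. Poly_Mapping.single (a \<otimes>\<^bsub>G\<^esub> h) (Poly_Mapping.lookup x a))"
  unfolding group_ring_mult_def by simp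

lemma group_ring_mult_frag_of_add:
  "group_ring_mult G (x + y) (frag_of h) = group_ring_mult G x (frag_of h) + group_ring_mult G y (frag_of h)"
  unfolding group_ring_mult_frag_of
  by (rule sum_keys_add[of "\<lambda>a n. Poly_Mapping.single (a \<otimes>\<^bsub>G\<^esub> h) n"]) (simp_all add: single_add)

lemma group_ring_mult_frag_of_frag_of: "group_ring_mult G (frag_of g) (frag_of h) = frag_of (g \<otimes>\<^bsub>G\<^esub> h)"
  unfolding group_ring_mult_frag_of by simp

lemma group_ring_mult_diff_frag_of:
  "group_ring_mult G (frag_of g - frag_of g') (frag_of h) = frag_of (g \<otimes>\<^bsub>G\<^esub> h) - frag_of (g' \<otimes>\<^bsub>G\<^esub> h)"
  using group_ring_mult_frag_of_add[of G "frag_of g - frag_of g'" "frag_of g'" h]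
  by (simp add: group_ring_mult_frag_of_frag_of)

lemma group_ring_act_frag_of: "group_ring_act act (frag_of h) v = act h v"
  by (simp add: group_ring_act_def)

text \<open>The laws are restricted to \<open>V\<close> because \<open>bar_act\<close> chooses a
  sign of the matrix and is used as an action only on forms of even degree.\<close>

locale group_ring_module = group G for G :: "('g, 'x) monoid_scheme" (structure) +
  fixes act :: "'g \<Rightarrow> 'v :: ring_1 \<Rightarrow> 'v" and V :: "'v set"
  assumes V_zero: "0 \<in> V" and V_add: "\<And>v w. v \<in> V \<Longrightarrow> w \<in> V \<Longrightarrow> v + w \<in> V"
    and V_uminus: "\<And>v. v \<in> V \<Longrightarrow> - v \<in> V"
    and act_closed: "\<And>g v. g \<in> carrier G \<Longrightarrow> v \<in> V \<Longrightarrow> act g v \<in> V"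
    and act_add: "\<And>g v w. g \<in> carrier G \<Longrightarrow> v \<in> V \<Longrightarrow> w \<in> V \<Longrightarrow> act g (v + w) = act g v + act g w"
    and act_mult: "\<And>g h v. g \<in> carrier G \<Longrightarrow> h \<in> carrier G \<Longrightarrow> v \<in> V \<Longrightarrow> act (g \<otimes> h) v = act g (act h v)"
    and act_one: "\<And>v. v \<in> V \<Longrightarrow> act \<one> v = v"
begin

lemma V_diff: "v \<in> V \<Longrightarrow> w \<in> V \<Longrightarrow> v - w \<in> V"
  using V_add[of v "- w"] V_uminus by simp

lemma V_of_int: "v \<in> V \<Longrightarrow> of_int n * v \<in> V"
proof (induction n rule: int_induct[where k = 0])
  case base
  then show ?case by (simp add: V_zero)
next
  case (step1 i)
  then show ?case using V_add[of "of_int i * v" v] by (simp add: distrib_right)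
next
  case (step2 i)
  then show ?case using V_diff[of "of_int i * v" v] by (simp add: left_diff_distrib)
qed

lemma V_sum: "(\<And>i. i \<in> I \<Longrightarrow> f i \<in> V) \<Longrightarrow> (\<Sum>i\<in>I. f i) \<in> V"
  by (induction I rule: infinite_finite_induct) (auto simp: V_zero V_add)

lemma group_ring_add: "x \<in> group_ring G \<Longrightarrow> y \<in> group_ring G \<Longrightarrow> x + y \<in> group_ring G"
  unfolding group_ring_def using keys_add[of x y] by auto

lemma augmentation_ideal_iff: "x \<in> augmentation_ideal G \<longleftrightarrow> x \<in> group_ring G \<and> aug x = 0"
  by (auto simp: augmentation_ideal_def aug_def)

sublocale balanced_tensor "group_ring G" "group_ring_mult G" "augmentation_ideal G" "group_ring_act act" V
proof
  fix x y assume "x \<in> augmentation_ideal G" "y \<in> augmentation_ideal G"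
  then show "x + y \<in> augmentation_ideal G" by (simp add: augmentation_ideal_iff group_ring_add aug_add)
next
  show "0 \<in> augmentation_ideal G" by (simp add: augmentation_ideal_iff group_ring_def)
next
  fix x s assume "x \<in> augmentation_ideal G" "s \<in> group_ring G"
  then have x: "Poly_Mapping.keys x \<subseteq> carrier G" "aug x = 0" and s: "Poly_Mapping.keys s \<subseteq> carrier G"
    by (simp_all add: augmentation_ideal_iff group_ring_def)
  have "Poly_Mapping.keys (group_ring_mult G x s) \<subseteq> carrier G"
    unfolding group_ring_mult_def
    by (intro keys_sum_subset) (use x s in \<open>auto split: if_splits\<close>)
  then show "group_ring_mult G x s \<in> augmentation_ideal G"
    using x by (simp add: augmentation_ideal_iff aug_mult group_ring_def)
next
  fix v s assume "v \<in> V" "s \<in> group_ring G"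
  then show "group_ring_act act s v \<in> V"
    unfolding group_ring_act_def group_ring_def by (auto intro!: V_sum V_of_int act_closed)
qed (simp_all add: V_add V_zero)

abbreviation gm1 :: "'g \<Rightarrow> 'g \<Rightarrow>\<^sub>0 int" where "gm1 g \<equiv> frag_of g - frag_of \<one>"

lemma gm1_closed: "g \<in> carrier G \<Longrightarrow> gm1 g \<in> augmentation_ideal G"
  using keys_diff[of "frag_of g" "frag_of \<one>"] by (auto simp: augmentation_ideal_iff group_ring_def aug_diff)

text \<open>From \<open>g h - 1 = (g - 1) h + (h - 1)\<close>, with \<open>h\<close> moved across
  the tensor sign. This relation lets chains be evaluated on words.\<close>

lemma ptg_mult:
  assumes "g \<in> carrier G" "h \<in> carrier G" "v \<in> V"
  shows "pt (gm1 (g \<otimes> h)) v = pt (gm1 g) (act h v) \<otimes>\<^bsub>TP\<^esub> pt (gm1 h) v"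
proof -
  have h: "frag_of h \<in> group_ring G" using assms by (simp add: group_ring_def)
  have "pt (gm1 g) (act h v) = pt (group_ring_mult G (gm1 g) (frag_of h)) v"
    using assms h by (subst pt_act) (simp_all add: gm1_closed group_ring_act_frag_of)
  then have 1: "pt (gm1 g) (act h v) = pt (frag_of (g \<otimes> h) - frag_of h) v"
    using assms by (simp add: group_ring_mult_diff_frag_of)
  have "frag_of (g \<otimes> h) - frag_of h \<in> augmentation_ideal G"
    using M_act[OF gm1_closed h, of g] assms by (simp add: group_ring_mult_diff_frag_of)
  from pt_add_left[OF this gm1_closed[OF assms(2)] assms(3)] show ?thesis
    by (simp add: 1)
qed

lemma pt_frag_cmul:
  assumes "x \<in> augmentation_ideal G" "v \<in> V"
  shows "frag_cmul n x \<in> augmentation_ideal G \<and> pt (frag_cmul n x) v = pt x v [^]\<^bsub>TP\<^esub> n"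
proof (induction n rule: int_induct[where k = 0])
  case base
  then show ?case using assms by (simp add: M_zero pt_zero_left)
next
  case (step1 i)
  then show ?case
    using assms by (simp add: frag_cmul_distrib M_add pt_add_left TP.int_pow_mult pt_closed)
next
  case (step2 i)
  have e: "frag_cmul (i - 1) x = frag_cmul i x - x" by (simp add: frag_cmul_diff_distrib)
  have m: "frag_cmul i x - x \<in> augmentation_ideal G"
    using step2 assms keys_diff[of "frag_cmul i x" x]
    by (auto simp: augmentation_ideal_iff group_ring_def aug_diff)
  have "pt (frag_cmul i x) v = pt (frag_cmul i x - x) v \<otimes>\<^bsub>TP\<^esub> pt x v"
    using pt_add_left[OF m assms(1,2)] by simp
  then have "pt (frag_cmul i x - x) v = pt x v [^]\<^bsub>TP\<^esub> i \<otimes>\<^bsub>TP\<^esub> inv\<^bsub>TP\<^esub> pt x v"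
    using step2 m assms by (simp add: TP.inv_solve_right pt_closed)
  then show ?case using e m assms by (simp add: TP.int_pow_diff pt_closed)
qed

lemma pt_expand:
  assumes x: "x \<in> augmentation_ideal G" and v: "v \<in> V"
  shows "pt x v = finprod TP (\<lambda>g. pt (gm1 g) v [^]\<^bsub>TP\<^esub> Poly_Mapping.lookup x g) (Poly_Mapping.keys x)"
proof -
  have sum: "(\<Sum>g\<in>I. frag_cmul (n g) (gm1 g)) \<in> augmentation_ideal G
     \<and> pt (\<Sum>g\<in>I. frag_cmul (n g) (gm1 g)) v = finprod TP (\<lambda>g. pt (gm1 g) v [^]\<^bsub>TP\<^esub> n g) I"
    if "finite I" "I \<subseteq> carrier G" for I and n :: "'g \<Rightarrow> int"
    using that
  proof (induction I rule: finite_induct)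
    case empty
    then show ?case using v by (simp add: M_zero pt_zero_left)
  next
    case (insert g I)
    have g: "frag_cmul (n g) (gm1 g) \<in> augmentation_ideal G"
      "pt (frag_cmul (n g) (gm1 g)) v = pt (gm1 g) v [^]\<^bsub>TP\<^esub> n g"
      using pt_frag_cmul[OF gm1_closed v] insert.prems by auto
    have "finprod TP (\<lambda>g. pt (gm1 g) v [^]\<^bsub>TP\<^esub> n g) (insert g I)
       = pt (gm1 g) v [^]\<^bsub>TP\<^esub> n g \<otimes>\<^bsub>TP\<^esub> finprod TP (\<lambda>g. pt (gm1 g) v [^]\<^bsub>TP\<^esub> n g) I"
      using insert.prems insert.hyps v by (intro TP.finprod_insert Pi_I TP.int_pow_closed pt_closed gm1_closed) auto
    then show ?case using insert g v by (simp add: M_add pt_add_left)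
  qed
  have keys: "Poly_Mapping.keys x \<subseteq> carrier G" using x by (simp add: augmentation_ideal_iff group_ring_def)
  \<comment> \<open>Replacing each \<open>g\<close> by \<open>g - 1\<close> changes the sum by
    \<open>aug x\<close> times the unit, which is zero in the augmentation ideal.\<close>
  have "(\<Sum>g\<in>Poly_Mapping.keys x. frag_cmul (Poly_Mapping.lookup x g) (gm1 g))
      = (\<Sum>g\<in>Poly_Mapping.keys x. frag_cmul (Poly_Mapping.lookup x g) (frag_of g)) - frag_cmul (aug x) (frag_of \<one>)"
    by (simp add: frag_cmul_diff_distrib2 sum_subtractf aug_def frag_cmul_sum_left)
  also have "(\<Sum>g\<in>Poly_Mapping.keys x. frag_cmul (Poly_Mapping.lookup x g) (frag_of g)) = x"
    using frag_expansion[of x] by (simp add: frag_extend_def)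
  finally have "(\<Sum>g\<in>Poly_Mapping.keys x. frag_cmul (Poly_Mapping.lookup x g) (gm1 g)) = x"
    using x by (simp add: augmentation_ideal_iff)
  then show ?thesis using sum[OF _ keys, of "Poly_Mapping.lookup x"] by simp
qed

end

text \<open>A map \<open>\<phi>\<close> of this kind is what a homomorphism out of \<open>I \<otimes> V\<close> is determined by, through
  \<open>(g - 1) \<otimes> v \<mapsto> \<phi> g v\<close>.\<close>

locale tensor_cocycle = group_ring_module G act V + A: comm_group A
  for G :: "('g, 'x) monoid_scheme" (structure) and act :: "'g \<Rightarrow> 'v :: ring_1 \<Rightarrow> 'v" and V
    and A :: "('a, 'y) monoid_scheme" +
  fixes \<phi> :: "'g \<Rightarrow> 'v \<Rightarrow> 'a"
  assumes phi_closed: "\<And>g v. g \<in> carrier G \<Longrightarrow> v \<in> V \<Longrightarrow> \<phi> g v \<in> carrier A"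
    and phi_add: "\<And>g v w. g \<in> carrier G \<Longrightarrow> v \<in> V \<Longrightarrow> w \<in> V \<Longrightarrow> \<phi> g (v + w) = \<phi> g v \<otimes>\<^bsub>A\<^esub> \<phi> g w"
    and phi_mult: "\<And>g h v. g \<in> carrier G \<Longrightarrow> h \<in> carrier G \<Longrightarrow> v \<in> V \<Longrightarrow>
       \<phi> (g \<otimes> h) v = \<phi> g (act h v) \<otimes>\<^bsub>A\<^esub> \<phi> h v"
begin

text \<open>Extends \<open>\<phi>\<close> linearly from \<open>g\<close> and not from
  \<open>g - 1\<close>; both have the same image because \<open>\<phi>\<close> is trivial at the
  unit (\<open>phi_one\<close>).\<close>

definition lin :: "('g \<Rightarrow>\<^sub>0 int) \<Rightarrow> 'v \<Rightarrow> 'a" where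
  "lin x v = finprod A (\<lambda>g. \<phi> g v [^]\<^bsub>A\<^esub> Poly_Mapping.lookup x g) (Poly_Mapping.keys x)"

lemma phi_zero: "g \<in> carrier G \<Longrightarrow> \<phi> g 0 = \<one>\<^bsub>A\<^esub>"
  using phi_add[of g 0 0] A.r_cancel_one'[of "\<phi> g 0" "\<phi> g 0"] by (simp add: V_zero phi_closed)

lemma phi_one: "v \<in> V \<Longrightarrow> \<phi> \<one> v = \<one>\<^bsub>A\<^esub>"
  using phi_mult[of \<one> \<one> v] A.r_cancel_one'[of "\<phi> \<one> v" "\<phi> \<one> v"] by (simp add: act_one phi_closed)

lemma lin_closed: "x \<in> group_ring G \<Longrightarrow> v \<in> V \<Longrightarrow> lin x v \<in> carrier A"
  unfolding lin_def group_ring_def by (intro A.finprod_closed) (auto intro: phi_closed)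

lemma lin_add:
  assumes "x \<in> group_ring G" "y \<in> group_ring G" "v \<in> V"
  shows "lin (x + y) v = lin x v \<otimes>\<^bsub>A\<^esub> lin y v"
  unfolding lin_def
  by (rule A.finprod_keys_add[where K = "carrier G" and V = UNIV and \<phi> = "\<lambda>g n. \<phi> g v [^]\<^bsub>A\<^esub> n"])
    (use assms in \<open>auto simp: group_ring_def phi_closed A.int_pow_mult\<close>)

lemma lin_zero: "lin 0 v = \<one>\<^bsub>A\<^esub>"
  by (simp add: lin_def)

lemma lin_single: "g \<in> carrier G \<Longrightarrow> v \<in> V \<Longrightarrow> lin (Poly_Mapping.single g n) v = \<phi> g v [^]\<^bsub>A\<^esub> n"
  by (cases "n = 0") (auto simp: lin_def phi_closed A.finprod_insert[of "{}", simplified])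

lemma group_ring_sum: "(\<And>i. i \<in> I \<Longrightarrow> f i \<in> group_ring G) \<Longrightarrow> (\<Sum>i\<in>I. f i) \<in> group_ring G"
  unfolding group_ring_def using keys_sum_subset[of I f "carrier G"] by blast

lemma lin_sum:
  assumes "finite I" "\<And>i. i \<in> I \<Longrightarrow> f i \<in> group_ring G" "v \<in> V"
  shows "lin (\<Sum>i\<in>I. f i) v = finprod A (\<lambda>i. lin (f i) v) I"
  using assms(1,2)
proof (induction I rule: finite_induct)
  case (insert i I)
  have "finprod A (\<lambda>i. lin (f i) v) (insert i I) = lin (f i) v \<otimes>\<^bsub>A\<^esub> finprod A (\<lambda>i. lin (f i) v) I"
    using insert assms(3) by (intro A.finprod_insert) (auto intro: lin_closed)
  then show ?case using insert assms(3) by (simp add: lin_add group_ring_sum)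
qed (simp add: lin_zero)

lemma lin_add_right:
  assumes "x \<in> group_ring G" "v \<in> V" "w \<in> V"
  shows "lin x (v + w) = lin x v \<otimes>\<^bsub>A\<^esub> lin x w"
proof -
  have k: "Poly_Mapping.keys x \<subseteq> carrier G" using assms by (simp add: group_ring_def)
  have "lin x (v + w) = finprod A (\<lambda>g. \<phi> g v [^]\<^bsub>A\<^esub> Poly_Mapping.lookup x g \<otimes>\<^bsub>A\<^esub> \<phi> g w [^]\<^bsub>A\<^esub> Poly_Mapping.lookup x g)
      (Poly_Mapping.keys x)"
    unfolding lin_def
    using k assms by (intro A.finprod_cong) (auto simp: simp_implies_def phi_add phi_closed A.int_pow_distrib)
  then show ?thesis
    unfolding lin_def using k assms by (subst (asm) A.finprod_multf) (auto intro: phi_closed)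
qed

lemma phi_of_int:
  assumes "g \<in> carrier G" "v \<in> V"
  shows "\<phi> g (of_int n * v) = \<phi> g v [^]\<^bsub>A\<^esub> n"
proof (induction n rule: int_induct[where k = 0])
  case base
  then show ?case using assms by (simp add: phi_zero)
next
  case (step1 i)
  then show ?case
    using phi_add[of g "of_int i * v" v] assms by (simp add: V_of_int distrib_right A.int_pow_mult phi_closed)
next
  case (step2 i)
  have e: "of_int (i - 1) * v \<in> V" using assms(2) by (rule V_of_int)
  have "of_int (i - 1) * v + v = of_int i * v" by (simp add: left_diff_distrib)
  then have "\<phi> g (of_int i * v) = \<phi> g (of_int (i - 1) * v) \<otimes>\<^bsub>A\<^esub> \<phi> g v"
    using phi_add[OF assms(1) e assms(2)] by simp
  then have "\<phi> g (of_int (i - 1) * v) = \<phi> g v [^]\<^bsub>A\<^esub> i \<otimes>\<^bsub>A\<^esub> inv\<^bsub>A\<^esub> \<phi> g v"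
    using step2 e assms by (simp add: A.inv_solve_right phi_closed)
  then show ?case using assms by (simp add: A.int_pow_diff phi_closed)
qed

lemma phi_sum:
  assumes "finite I" "g \<in> carrier G" "\<And>i. i \<in> I \<Longrightarrow> f i \<in> V"
  shows "\<phi> g (\<Sum>i\<in>I. f i) = finprod A (\<lambda>i. \<phi> g (f i)) I"
  using assms(1,3)
proof (induction I rule: finite_induct)
  case (insert i I)
  have "finprod A (\<lambda>i. \<phi> g (f i)) (insert i I) = \<phi> g (f i) \<otimes>\<^bsub>A\<^esub> finprod A (\<lambda>i. \<phi> g (f i)) I"
    using insert assms(2) by (intro A.finprod_insert) (auto intro: phi_closed)
  then show ?case using insert assms(2) by (simp add: phi_add V_sum)
qed (simp add: phi_zero assms(2))

text \<open>By the cocycle rule the left side is the right side times a power of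
  \<open>lin s v\<close> with exponent \<open>aug x\<close>, and this exponent vanishes on the
  augmentation ideal.\<close>

lemma lin_balanced:
  assumes x: "x \<in> augmentation_ideal G" and s: "s \<in> group_ring G" and v: "v \<in> V"
  shows "lin (group_ring_mult G x s) v = lin x (group_ring_act act s v)"
proof -
  let ?X = "Poly_Mapping.lookup x" and ?S = "Poly_Mapping.lookup s"
  have kx: "a \<in> carrier G" if "a \<in> Poly_Mapping.keys x" for a
    using x that by (auto simp: augmentation_ideal_iff group_ring_def)
  have ks: "b \<in> carrier G" if "b \<in> Poly_Mapping.keys s" for b
    using s that by (auto simp: group_ring_def)
  have row: "lin (\<Sum>b\<in>Poly_Mapping.keys s. Poly_Mapping.single (a \<otimes> b) (?X a * ?S b)) v
      = (\<phi> a (group_ring_act act s v) \<otimes>\<^bsub>A\<^esub> lin s v) [^]\<^bsub>A\<^esub> ?X a" if a: "a \<in> carrier G" for a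
  proof -
    have "lin (\<Sum>b\<in>Poly_Mapping.keys s. Poly_Mapping.single (a \<otimes> b) (?X a * ?S b)) v
        = finprod A (\<lambda>b. lin (Poly_Mapping.single (a \<otimes> b) (?X a * ?S b)) v) (Poly_Mapping.keys s)"
      using a ks v by (intro lin_sum) (auto simp: group_ring_def)
    also have "\<dots> = finprod A (\<lambda>b. (\<phi> a (of_int (?S b) * act b v) \<otimes>\<^bsub>A\<^esub> \<phi> b v [^]\<^bsub>A\<^esub> ?S b) [^]\<^bsub>A\<^esub> ?X a) (Poly_Mapping.keys s)"
    proof (intro A.finprod_cong' refl)
      show "(\<lambda>b. (\<phi> a (of_int (?S b) * act b v) \<otimes>\<^bsub>A\<^esub> \<phi> b v [^]\<^bsub>A\<^esub> ?S b) [^]\<^bsub>A\<^esub> ?X a) \<in> Poly_Mapping.keys s \<rightarrow> carrier A"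
        using a ks v by (auto intro!: phi_closed V_of_int act_closed)
    next
      fix b assume "b \<in> Poly_Mapping.keys s"
      then have b: "b \<in> carrier G" by (rule ks)
      show "lin (Poly_Mapping.single (a \<otimes> b) (?X a * ?S b)) v
         = (\<phi> a (of_int (?S b) * act b v) \<otimes>\<^bsub>A\<^esub> \<phi> b v [^]\<^bsub>A\<^esub> ?S b) [^]\<^bsub>A\<^esub> ?X a"
        using a b v
        by (simp add: lin_single phi_mult phi_of_int act_closed phi_closed A.int_pow_distrib[symmetric] A.int_pow_pow
          mult.commute)
    qed
    also have "\<dots> = finprod A (\<lambda>b. \<phi> a (of_int (?S b) * act b v) \<otimes>\<^bsub>A\<^esub> \<phi> b v [^]\<^bsub>A\<^esub> ?S b) (Poly_Mapping.keys s) [^]\<^bsub>A\<^esub> ?X a"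
      using a ks v by (intro A.finprod_int_pow[symmetric]) (auto intro!: phi_closed V_of_int act_closed)
    also have "finprod A (\<lambda>b. \<phi> a (of_int (?S b) * act b v) \<otimes>\<^bsub>A\<^esub> \<phi> b v [^]\<^bsub>A\<^esub> ?S b) (Poly_Mapping.keys s)
      = finprod A (\<lambda>b. \<phi> a (of_int (?S b) * act b v)) (Poly_Mapping.keys s) \<otimes>\<^bsub>A\<^esub> lin s v"
      unfolding lin_def using a ks v by (intro A.finprod_multf) (auto intro!: phi_closed V_of_int act_closed)
    also have "finprod A (\<lambda>b. \<phi> a (of_int (?S b) * act b v)) (Poly_Mapping.keys s) = \<phi> a (group_ring_act act s v)"
      unfolding group_ring_act_def
      using a ks v by (intro phi_sum[symmetric]) (auto intro!: V_of_int act_closed)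
    finally show ?thesis .
  qed
  have sv: "group_ring_act act s v \<in> V" using v s by (rule N_act)
  have "lin (group_ring_mult G x s) v
     = finprod A (\<lambda>a. lin (\<Sum>b\<in>Poly_Mapping.keys s. Poly_Mapping.single (a \<otimes> b) (?X a * ?S b)) v) (Poly_Mapping.keys x)"
    unfolding group_ring_mult_def using v
  proof (intro lin_sum group_ring_sum)
    show "Poly_Mapping.single (a \<otimes> b) (?X a * ?S b) \<in> group_ring G"
      if "a \<in> Poly_Mapping.keys x" "b \<in> Poly_Mapping.keys s" for a b
      using kx[OF that(1)] ks[OF that(2)] by (simp add: group_ring_def)
  qed simp
  also have "\<dots> = finprod A (\<lambda>a. \<phi> a (group_ring_act act s v) [^]\<^bsub>A\<^esub> ?X a \<otimes>\<^bsub>A\<^esub> lin s v [^]\<^bsub>A\<^esub> ?X a) (Poly_Mapping.keys x)"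
    using kx sv v s
    by (intro A.finprod_cong) (auto simp: simp_implies_def row phi_closed lin_closed A.int_pow_distrib)
  also have "\<dots> = lin x (group_ring_act act s v) \<otimes>\<^bsub>A\<^esub> finprod A (\<lambda>a. lin s v [^]\<^bsub>A\<^esub> ?X a) (Poly_Mapping.keys x)"
    unfolding lin_def[of x] using kx sv v s
    by (intro A.finprod_multf) (auto intro: phi_closed lin_closed)
  also have "finprod A (\<lambda>a. lin s v [^]\<^bsub>A\<^esub> ?X a) (Poly_Mapping.keys x) = lin s v [^]\<^bsub>A\<^esub> aug x"
    unfolding aug_def using v s by (intro A.finprod_int_pow_sum lin_closed)
  also have "\<dots> = \<one>\<^bsub>A\<^esub>" using x by (simp add: augmentation_ideal_iff)
  finally show ?thesis using x sv by (simp add: lin_closed augmentation_ideal_iff)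
qed

lemma lin_gm1:
  assumes "g \<in> carrier G" "v \<in> V"
  shows "lin (gm1 g) v = \<phi> g v"
proof -
  have "lin (gm1 g + frag_of \<one>) v = lin (gm1 g) v \<otimes>\<^bsub>A\<^esub> lin (frag_of \<one>) v"
    using gm1_closed[OF assms(1)] assms(2)
    by (intro lin_add) (auto simp: augmentation_ideal_iff group_ring_def)
  then show ?thesis
    using assms gm1_closed[OF assms(1)] by (simp add: lin_single phi_one phi_closed lin_closed augmentation_ideal_iff)
qed

lemma lift_hom: "tensor_lift A lin \<in> hom TP A"
  and lift_pt: "x \<in> augmentation_ideal G \<Longrightarrow> v \<in> V \<Longrightarrow> tensor_lift A lin (pt x v) = lin x v"
  by (rule tensor_lift_coset[OF A.comm_group_axioms];
      simp add: augmentation_ideal_iff lin_closed lin_add lin_add_right lin_balanced)+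

end

section \<open>Chains and their classes in the tensor product\<close>

context group_ring_module
begin

text \<open>A chain \<open>x\<close> stands for the sum of all
  \<open>(g - 1) \<otimes> x(g)\<close>. In contrast to \<open>TP\<close> it lives in an additive
  type, so the module theory above applies to it.\<close>

definition chains :: "('g \<Rightarrow>\<^sub>0 'v) set" where
  "chains = {x. Poly_Mapping.keys x \<subseteq> carrier G \<and> (\<forall>g. Poly_Mapping.lookup x g \<in> V)}"

definition chain_class :: "('g \<Rightarrow>\<^sub>0 'v) \<Rightarrow> (('g \<Rightarrow>\<^sub>0 int) \<times> 'v \<Rightarrow>\<^sub>0 int) set" where
  "chain_class x = finprod TP (\<lambda>g. pt (gm1 g) (Poly_Mapping.lookup x g)) (Poly_Mapping.keys x)"

lemma chains_zero: "0 \<in> chains"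
  by (simp add: chains_def V_zero)

lemma chains_add: "x \<in> chains \<Longrightarrow> y \<in> chains \<Longrightarrow> x + y \<in> chains"
  unfolding chains_def using keys_add[of x y] by (auto simp: lookup_add V_add)

lemma chains_uminus: "x \<in> chains \<Longrightarrow> - x \<in> chains"
  unfolding chains_def by (auto simp: V_uminus)

lemma chains_diff: "x \<in> chains \<Longrightarrow> y \<in> chains \<Longrightarrow> x - y \<in> chains"
  using chains_add[of x "- y"] chains_uminus by simp

lemma chains_sum: "(\<And>i. i \<in> I \<Longrightarrow> f i \<in> chains) \<Longrightarrow> (\<Sum>i\<in>I. f i) \<in> chains"
  by (induction I rule: infinite_finite_induct) (auto simp: chains_zero chains_add)

lemma chains_single: "g \<in> carrier G \<Longrightarrow> v \<in> V \<Longrightarrow> Poly_Mapping.single g v \<in> chains"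
  unfolding chains_def by (auto simp: lookup_single when_def V_zero)

lemma chain_class_closed: "x \<in> chains \<Longrightarrow> chain_class x \<in> carrier TP"
  unfolding chain_class_def chains_def
  by (intro TP.finprod_closed) (auto intro!: pt_closed gm1_closed)

lemma chain_class_add:
  assumes "x \<in> chains" "y \<in> chains"
  shows "chain_class (x + y) = chain_class x \<otimes>\<^bsub>TP\<^esub> chain_class y"
  unfolding chain_class_def
  by (rule TP.finprod_keys_add[where K = "carrier G" and V = V and \<phi> = "\<lambda>g. pt (gm1 g)"])
    (use assms in \<open>auto simp: chains_def V_add pt_closed gm1_closed pt_add_right pt_zero_right\<close>)

lemma chain_class_zero: "chain_class 0 = \<one>\<^bsub>TP\<^esub>"
  by (simp add: chain_class_def)

lemma chain_class_uminus: "x \<in> chains \<Longrightarrow> chain_class (- x) = inv\<^bsub>TP\<^esub> chain_class x"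
  using chain_class_add[of "- x" x] by (intro TP.inv_equality[symmetric])
    (simp_all add: chains_uminus chain_class_closed chain_class_zero)

lemma chain_class_diff:
  "x \<in> chains \<Longrightarrow> y \<in> chains \<Longrightarrow> chain_class (x - y) = chain_class x \<otimes>\<^bsub>TP\<^esub> inv\<^bsub>TP\<^esub> chain_class y"
  using chain_class_add[of x "- y"] by (simp add: chains_uminus chain_class_uminus)

lemma chain_class_single:
  "g \<in> carrier G \<Longrightarrow> v \<in> V \<Longrightarrow> chain_class (Poly_Mapping.single g v) = pt (gm1 g) v"
  by (cases "v = 0")
    (auto simp: chain_class_def pt_closed gm1_closed pt_zero_right TP.finprod_insert[of "{}", simplified])

lemma chain_class_sum:
  assumes "\<And>i. i \<in> I \<Longrightarrow> f i \<in> chains"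
  shows "chain_class (\<Sum>i\<in>I. f i) = finprod TP (\<lambda>i. chain_class (f i)) I"
  using assms
proof (induction I rule: infinite_finite_induct)
  case (insert i I)
  have "finprod TP (\<lambda>i. chain_class (f i)) (insert i I) = chain_class (f i) \<otimes>\<^bsub>TP\<^esub> finprod TP (\<lambda>i. chain_class (f i)) I"
    using insert by (intro TP.finprod_insert) (auto intro: chain_class_closed)
  then show ?case using insert by (simp add: chain_class_add chains_sum)
qed (simp_all add: chain_class_zero)

text \<open>Pure tensors generate, and \<open>pt_expand\<close> rewrites each of them through
  elements \<open>(g - 1) \<otimes> v\<close>.\<close>

lemma chain_class_surj: "chain_class ` chains = carrier TP"
proof (rule TP_generated)
  show sub: "subgroup (chain_class ` chains) TP"
  proof (rule TP.subgroupI)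
    show "chain_class ` chains \<noteq> {}" using chains_zero by blast
  next
    fix a assume "a \<in> chain_class ` chains"
    then show "inv\<^bsub>TP\<^esub> a \<in> chain_class ` chains"
      by (auto simp: chain_class_uminus[symmetric] chains_uminus)
  next
    fix a b assume "a \<in> chain_class ` chains" "b \<in> chain_class ` chains"
    then show "a \<otimes>\<^bsub>TP\<^esub> b \<in> chain_class ` chains"
      by (auto simp: chain_class_add[symmetric] chains_add)
  qed (auto simp: chain_class_closed)
  fix x v assume x: "x \<in> augmentation_ideal G" and v: "v \<in> V"
  have k: "g \<in> carrier G" if "g \<in> Poly_Mapping.keys x" for g
    using x that by (auto simp: augmentation_ideal_iff group_ring_def)
  have pow: "pt (gm1 g) v [^]\<^bsub>TP\<^esub> (n :: int) \<in> chain_class ` chains" if "g \<in> carrier G" for g n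
    using TP.subgroup_int_pow_closed[OF sub, of "pt (gm1 g) v" n] chain_class_single[OF that v] chains_single[OF that v]
    by (metis imageI)
  have "finprod TP (\<lambda>g. pt (gm1 g) v [^]\<^bsub>TP\<^esub> n g) I \<in> chain_class ` chains"
    if "I \<subseteq> carrier G" "finite I" for n :: "'g \<Rightarrow> int" and I
    using that(2,1)
  proof (induction I rule: finite_induct)
    case empty
    then show ?case using subgroup.one_closed[OF sub] by simp
  next
    case (insert g I)
    have "finprod TP (\<lambda>g. pt (gm1 g) v [^]\<^bsub>TP\<^esub> n g) (insert g I)
       = pt (gm1 g) v [^]\<^bsub>TP\<^esub> n g \<otimes>\<^bsub>TP\<^esub> finprod TP (\<lambda>g. pt (gm1 g) v [^]\<^bsub>TP\<^esub> n g) I"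
      using insert v by (intro TP.finprod_insert) (auto intro!: pt_closed gm1_closed)
    then show ?case using insert subgroup.m_closed[OF sub] pow by auto
  qed
  from this[of "Poly_Mapping.keys x" "Poly_Mapping.lookup x"] show "pt x v \<in> chain_class ` chains"
    using pt_expand[OF x v] k by auto
qed

end

context tensor_cocycle
begin

lemma lift_chain:
  assumes "x \<in> chains"
  shows "tensor_lift A lin (chain_class x) = finprod A (\<lambda>g. \<phi> g (Poly_Mapping.lookup x g)) (Poly_Mapping.keys x)"
proof -
  have x: "g \<in> carrier G" "Poly_Mapping.lookup x g \<in> V" if "g \<in> Poly_Mapping.keys x" for g
    using assms that by (auto simp: chains_def)
  have "tensor_lift A lin (chain_class x)
     = finprod A (\<lambda>g. tensor_lift A lin (pt (gm1 g) (Poly_Mapping.lookup x g))) (Poly_Mapping.keys x)"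
    unfolding chain_class_def using x
    by (intro hom_finprod[OF lift_hom TP_comm_group A.comm_group_axioms]) (auto intro!: pt_closed gm1_closed)
  also have "\<dots> = finprod A (\<lambda>g. \<phi> g (Poly_Mapping.lookup x g)) (Poly_Mapping.keys x)"
    using x by (intro A.finprod_cong) (auto simp: simp_implies_def lift_pt gm1_closed lin_gm1 phi_closed)
  finally show ?thesis .
qed

end

section \<open>Substitution in homogeneous polynomials\<close>

lemma comm_ring_hom_poly_map_poly:
  fixes h :: "'a :: comm_ring_1 \<Rightarrow> 'b :: comm_ring_1"
  assumes "comm_ring_hom h"
  shows "comm_ring_hom (\<lambda>p. poly (map_poly h p) a)"
proof -
  interpret h: map_poly_comm_ring_hom h by (intro map_poly_comm_ring_hom.intro assms)
  show ?thesis by unfold_locales (simp_all add: h.hom_add h.hom_mult)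
qed

lemma poly_map_poly_altdef:
  fixes h :: "'a :: comm_ring_1 \<Rightarrow> 'b :: comm_ring_1"
  assumes "h 0 = 0"
  shows "poly (map_poly h p) a = (\<Sum>i\<le>degree p. h (coeff p i) * a ^ i)"
proof -
  have "h (coeff p i) = 0" if "i > degree (map_poly h p)" for i
    using coeff_eq_0[OF that] by (simp add: coeff_map_poly assms)
  then show ?thesis
    unfolding poly_altdef using degree_map_poly_le[of h p]
    by (intro sum.mono_neutral_cong_left) (auto simp: coeff_map_poly assms)
qed

lemma comm_ring_hom_const2: "comm_ring_hom (const2 :: 'r :: comm_ring_1 \<Rightarrow> 'r poly2)"
  by unfold_locales (simp_all add: const2_def one_pCons)

interpretation const2: comm_ring_hom "const2 :: 'r :: comm_ring_1 \<Rightarrow> 'r poly2"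
  by (rule comm_ring_hom_const2)

text \<open>Two nested evaluations, each a ring homomorphism; in the double sum of the definition
  multiplicativity is not visible.\<close>

lemma subst2_alt: "subst2 P U W = poly (map_poly (\<lambda>c. poly (map_poly const2 c) W) P) U"
  unfolding subst2_def
  by (subst (1 2) poly_map_poly_altdef)
    (simp_all add: sum_distrib_right sum_distrib_left mult.assoc mult.commute mult.left_commute)

lemma comm_ring_hom_subst2: "comm_ring_hom (\<lambda>P. subst2 P U W)"
  unfolding subst2_alt by (intro comm_ring_hom_poly_map_poly comm_ring_hom_const2)

interpretation subst2: comm_ring_hom "\<lambda>P. subst2 P U W" for U W :: "'r :: comm_ring_1 poly2"
  by (rule comm_ring_hom_subst2)

lemma subst2_const2 [simp]: "subst2 (const2 r) U W = const2 r"
  unfolding subst2_alt by (cases "r = 0") (simp_all add: const2_def map_poly_pCons)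

lemma subst2_X1 [simp]: "subst2 X1 U W = U"
  unfolding subst2_alt by (simp add: X1_def map_poly_pCons)

lemma subst2_X2 [simp]: "subst2 X2 U W = W"
  unfolding subst2_alt by (simp add: X2_def map_poly_pCons const2_def) (simp flip: one_pCons)

lemma subst2_subst2: "subst2 (subst2 P U W) U' W' = subst2 P (subst2 U U' W') (subst2 W U' W')"
  unfolding subst2_def[of P]
  by (simp add: subst2.hom_sum subst2.hom_mult subst2.hom_power)

lemma coeff_const2_mult: "coeff (coeff (const2 r * P) i) j = r * coeff (coeff P i) j"
  by (simp add: const2_def)

lemma coeff_X1_X2: "coeff (coeff (X1 ^ a * X2 ^ b) i) j = (if i = a \<and> j = b then 1 else 0 :: 'r :: comm_ring_1)"
proof -
  have "X1 ^ a = (monom 1 a :: 'r poly2)" by (simp only: X1_def x_as_monom x_pow_n)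
  moreover have "X2 ^ b = ([:monom 1 b:] :: 'r poly2)"
    by (simp only: X2_def x_as_monom poly_const_pow x_pow_n)
  ultimately have "X1 ^ a * X2 ^ b = (monom (monom 1 b) a :: 'r poly2)"
    by (simp add: smult_monom mult.commute[of "monom 1 a"])
  then show ?thesis by simp
qed

lemma poly2_eqI: "(\<And>i j. coeff (coeff P i) j = coeff (coeff Q i) j) \<Longrightarrow> P = Q"
  by (intro poly_eqI)

lemma homogeneous_zero: "0 \<in> homogeneous k"
  by (simp add: homogeneous_def)

lemma homogeneous_add: "P \<in> homogeneous k \<Longrightarrow> Q \<in> homogeneous k \<Longrightarrow> P + Q \<in> homogeneous k"
  unfolding homogeneous_def by (auto simp: ) (metis add_0)

lemma homogeneous_uminus: "P \<in> homogeneous k \<Longrightarrow> - P \<in> homogeneous k"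
  unfolding homogeneous_def by simp

lemma homogeneous_diff: "P \<in> homogeneous k \<Longrightarrow> Q \<in> homogeneous k \<Longrightarrow> P - Q \<in> homogeneous k"
  using homogeneous_add[of P k "- Q"] homogeneous_uminus[of Q k] by simp

lemma homogeneous_sum: "(\<And>i. i \<in> I \<Longrightarrow> f i \<in> homogeneous k) \<Longrightarrow> (\<Sum>i\<in>I. f i) \<in> homogeneous k"
  by (induction I rule: infinite_finite_induct) (auto simp: homogeneous_zero homogeneous_add)

lemma homogeneous_mult:
  assumes "P \<in> homogeneous k" "Q \<in> homogeneous l"
  shows "P * Q \<in> homogeneous (k + l)"
  unfolding homogeneous_def
proof (intro CollectI allI impI)
  fix i j assume "coeff (coeff (P * Q) i) j \<noteq> 0"
  then have "(\<Sum>i'\<le>i. \<Sum>j'\<le>j. coeff (coeff P i') j' * coeff (coeff Q (i - i')) (j - j')) \<noteq> 0"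
    by (simp add: coeff_mult coeff_sum)
  then obtain i' where i': "i' \<le> i" "(\<Sum>j'\<le>j. coeff (coeff P i') j' * coeff (coeff Q (i - i')) (j - j')) \<noteq> 0"
    by (metis (no_types, lifting) atMost_iff sum.neutral)
  then obtain j' where "j' \<le> j" "coeff (coeff P i') j' * coeff (coeff Q (i - i')) (j - j') \<noteq> 0"
    by (metis (no_types, lifting) atMost_iff sum.neutral)
  then have "j' \<le> j" "coeff (coeff P i') j' \<noteq> 0" "coeff (coeff Q (i - i')) (j - j') \<noteq> 0" by auto
  then have "j' \<le> j" "i' + j' = k" "(i - i') + (j - j') = l"
    using assms unfolding homogeneous_def by blast+
  then show "i + j = k + l" using i' by linarith
qed

lemma homogeneous_const2: "const2 r \<in> homogeneous 0"
  by (auto simp: homogeneous_def const2_def coeff_pCons split: nat.splits)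

lemma homogeneous_const2_mult: "P \<in> homogeneous k \<Longrightarrow> const2 r * P \<in> homogeneous k"
  using homogeneous_mult[OF homogeneous_const2] by fastforce

lemma of_int_const2: "of_int n = const2 (of_int n)"
  by (rule const2.hom_of_int[symmetric])

lemma of_nat_const2: "of_nat n = const2 (of_nat n)"
  by (rule const2.hom_of_nat[symmetric])

lemma homogeneous_of_int_mult: "P \<in> homogeneous k \<Longrightarrow> of_int n * P \<in> homogeneous k"
  unfolding of_int_const2 by (rule homogeneous_const2_mult)

lemma homogeneous_X1: "X1 \<in> homogeneous 1" and homogeneous_X2: "X2 \<in> homogeneous 1"
  by (auto simp: homogeneous_def X1_def X2_def coeff_pCons split: nat.splits)

lemma homogeneous_power: "P \<in> homogeneous k \<Longrightarrow> P ^ n \<in> homogeneous (n * k)"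
proof (induction n)
  case 0
  then show ?case using homogeneous_const2[of 1] by simp
next
  case (Suc n)
  then show ?case using homogeneous_mult[of P k "P ^ n" "n * k"] by simp
qed

lemma homogeneous_power1: "P \<in> homogeneous 1 \<Longrightarrow> P ^ n \<in> homogeneous n"
  using homogeneous_power[of P 1 n] by simp

lemma homogeneous_subst2:
  assumes "P \<in> homogeneous k" "U \<in> homogeneous 1" "W \<in> homogeneous 1"
  shows "subst2 P U W \<in> homogeneous k"
  unfolding subst2_def
proof (intro homogeneous_sum)
  fix i j
  show "const2 (coeff (coeff P i) j) * U ^ i * W ^ j \<in> homogeneous k"
  proof (cases "coeff (coeff P i) j = 0")
    case True
    then show ?thesis by (simp add: homogeneous_zero)
  next
    case False
    then have "k = i + j" using assms(1) by (auto simp: homogeneous_def)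
    moreover have "U ^ i * W ^ j \<in> homogeneous (i + j)"
      using assms(2,3) by (intro homogeneous_mult homogeneous_power1)
    ultimately show ?thesis by (simp add: mult.assoc homogeneous_const2_mult)
  qed
qed

lemma homogeneous_expand:
  assumes "P \<in> homogeneous k"
  shows "P = (\<Sum>i\<le>k. const2 (coeff (coeff P i) (k - i)) * (X1 ^ i * X2 ^ (k - i)))"
proof (rule poly2_eqI)
  fix i j
  have "coeff (coeff (\<Sum>i\<le>k. const2 (coeff (coeff P i) (k - i)) * (X1 ^ i * X2 ^ (k - i))) i) j
     = (\<Sum>i'\<le>k. if i' = i then (if j = k - i then coeff (coeff P i) (k - i) else 0) else 0)"
    unfolding coeff_sum coeff_const2_mult coeff_X1_X2 by (intro sum.cong) auto
  also have "\<dots> = (if i \<le> k \<and> j = k - i then coeff (coeff P i) (k - i) else 0)"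
    by (simp add: sum.delta)
  also have "\<dots> = coeff (coeff P i) j"
    using assms by (fastforce simp: homogeneous_def)
  finally show "coeff (coeff P i) j = coeff (coeff (\<Sum>i\<le>k. const2 (coeff (coeff P i) (k - i)) * (X1 ^ i * X2 ^ (k - i))) i) j" ..
qed

text \<open>The quotient \<open>W\<close> is required to be homogeneous as well, so that it is again
  an admissible coefficient and a chain with coefficient \<open>q W\<close> is q times a
  chain.\<close>

definition hcong :: "'r \<Rightarrow> nat \<Rightarrow> 'r :: comm_ring_1 poly2 \<Rightarrow> 'r poly2 \<Rightarrow> bool" where
  "hcong q k P Q \<longleftrightarrow> (\<exists>W \<in> homogeneous k. P - Q = const2 q * W)"

lemma hcong_refl: "hcong q k P P"
  unfolding hcong_def using homogeneous_zero by force

lemma hcong_add: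
  assumes "hcong q k P Q" "hcong q k P' Q'"
  shows "hcong q k (P + P') (Q + Q')"
proof -
  obtain W W' where "W \<in> homogeneous k" "P - Q = const2 q * W" "W' \<in> homogeneous k" "P' - Q' = const2 q * W'"
    using assms unfolding hcong_def by blast
  then show ?thesis unfolding hcong_def
    by (intro bexI[of _ "W + W'"]) (auto simp: distrib_left add_diff_add homogeneous_add)
qed

lemma hcong_mult:
  assumes "hcong q k P Q" "hcong q l P' Q'" "P' \<in> homogeneous l" "Q \<in> homogeneous k"
  shows "hcong q (k + l) (P * P') (Q * Q')"
proof -
  obtain W W' where W: "W \<in> homogeneous k" "P - Q = const2 q * W" "W' \<in> homogeneous l" "P' - Q' = const2 q * W'"
    using assms unfolding hcong_def by blast
  have "P * P' - Q * Q' = (P - Q) * P' + Q * (P' - Q')" by (simp add: algebra_simps)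
  also have "\<dots> = const2 q * (W * P' + Q * W')" by (simp add: W algebra_simps)
  finally show ?thesis unfolding hcong_def using W assms
    by (intro bexI[of _ "W * P' + Q * W'"]) (auto intro!: homogeneous_add homogeneous_mult)
qed

lemma hcong_power:
  assumes "hcong q k P Q" "P \<in> homogeneous k" "Q \<in> homogeneous k"
  shows "hcong q (n * k) (P ^ n) (Q ^ n)"
proof (induction n)
  case (Suc n)
  then show ?case
    using hcong_mult[OF assms(1) Suc homogeneous_power[OF assms(2)] assms(3)] by simp
qed (simp add: hcong_refl)

section \<open>Two by two matrices\<close>

lemma mat2_nth [simp]:
  "mat2 a b c d $ 1 $ 1 = a" "mat2 a b c d $ 1 $ 2 = b" "mat2 a b c d $ 2 $ 1 = c" "mat2 a b c d $ 2 $ 2 = d"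
  by (simp_all add: mat2_def)

lemma mat2_eq_iff: "A = B \<longleftrightarrow> A $ 1 $ 1 = B $ 1 $ 1 \<and> A $ 1 $ 2 = B $ 1 $ 2 \<and> A $ 2 $ 1 = B $ 2 $ 1 \<and> A $ 2 $ 2 = B $ 2 $ 2"
  for A B :: mat2
  by (auto simp: vec_eq_iff forall_2)

lemma mat2_collapse: "mat2 (A $ 1 $ 1) (A $ 1 $ 2) (A $ 2 $ 1) (A $ 2 $ 2) = A"
  by (simp add: mat2_eq_iff)

lemma mat2_exhaust: obtains a b c d where "A = mat2 a b c d"
  by (rule that[OF mat2_collapse[symmetric]])

lemma mat2_eq [simp]: "mat2 a b c d = mat2 a' b' c' d' \<longleftrightarrow> a = a' \<and> b = b' \<and> c = c' \<and> d = d'"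
  by (simp add: mat2_eq_iff)

lemma mat2_mult [simp]:
  "mat2 a b c d ** mat2 a' b' c' d' = mat2 (a * a' + b * c') (a * b' + b * d') (c * a' + d * c') (c * b' + d * d')"
  by (simp add: mat2_eq_iff matrix_matrix_mult_def sum_2)

lemma mat2_det [simp]: "det (mat2 a b c d) = a * d - b * c"
  by (simp add: det_2)

lemma mat2_one: "mat 1 = mat2 1 0 0 1"
  by (simp add: mat2_eq_iff mat_def)

lemma mat2_uminus [simp]: "- mat2 a b c d = mat2 (- a) (- b) (- c) (- d)"
  by (simp add: mat2_eq_iff)

lemma mat2_trace [simp]: "trace (mat2 a b c d) = a + d"
  by (simp add: trace_def sum_2)

lemma mat2_mult_uminus [simp]: "(- A) ** B = - (A ** B)" "A ** (- B) = - (A ** B)" for A B :: mat2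
  by (cases A rule: mat2_exhaust, cases B rule: mat2_exhaust, simp)+

lemma mat2_uminus_det [simp]: "det (- A) = det A" for A :: mat2
  by (cases A rule: mat2_exhaust) simp

definition adj2 :: "mat2 \<Rightarrow> mat2" where
  "adj2 A = mat2 (A $ 2 $ 2) (- A $ 1 $ 2) (- A $ 2 $ 1) (A $ 1 $ 1)"

lemma adj2_mat2 [simp]: "adj2 (mat2 a b c d) = mat2 d (- b) (- c) a"
  by (simp add: adj2_def)

lemma adj2_left: "det A = 1 \<Longrightarrow> adj2 A ** A = mat 1" and adj2_right: "det A = 1 \<Longrightarrow> A ** adj2 A = mat 1"
  by (cases A rule: mat2_exhaust; simp add: mat2_one algebra_simps)+

lemma adj2_det [simp]: "det (adj2 A) = det A"
  by (cases A rule: mat2_exhaust) (simp add: algebra_simps)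

text \<open>Multiplication by the adjugate stands in for the inverse of \<open>C\<close>, which need
  not be integral, and yields \<open>det C\<close> times the matrix.\<close>

lemma mat2_right_cancel:
  assumes "A ** C = B ** C" "det C \<noteq> 0"
  shows "A = (B :: mat2)"
proof -
  have e: "X ** C ** adj2 C = mat2 (det C * X $ 1 $ 1) (det C * X $ 1 $ 2) (det C * X $ 2 $ 1) (det C * X $ 2 $ 2)" for X
    by (cases X rule: mat2_exhaust, cases C rule: mat2_exhaust) (simp add: algebra_simps)
  have "A ** C ** adj2 C = B ** C ** adj2 C" by (simp add: assms)
  then show ?thesis unfolding e using assms(2) by (simp add: mat2_eq_iff)
qed

lemma carrier_SL2Z: "A \<in> carrier SL2Z \<longleftrightarrow> det A = 1"
  by (simp add: SL2Z_def)

lemma SL2Z_simps [simp]: "x \<otimes>\<^bsub>SL2Z\<^esub> y = x ** y" "\<one>\<^bsub>SL2Z\<^esub> = mat 1"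
  by (simp_all add: SL2Z_def)

lemma group_SL2Z: "group SL2Z"
proof (rule groupI)
  fix x assume "x \<in> carrier SL2Z"
  then show "\<exists>y\<in>carrier SL2Z. y \<otimes>\<^bsub>SL2Z\<^esub> x = \<one>\<^bsub>SL2Z\<^esub>"
    by (intro bexI[of _ "adj2 x"]) (auto simp: carrier_SL2Z adj2_left)
qed (auto simp: carrier_SL2Z det_mul matrix_mul_assoc[symmetric])

lemma inv_SL2Z: "A \<in> carrier SL2Z \<Longrightarrow> inv\<^bsub>SL2Z\<^esub> A = adj2 A"
  by (rule group.inv_equality[OF group_SL2Z]) (auto simp: carrier_SL2Z adj2_left)

lemma bar_eq: "bar A = {A, - A}"
  by (auto simp: bar_def r_coset_def M2plus_def)

lemma bar_eq_iff: "bar A = bar B \<longleftrightarrow> A = B \<or> A = - B"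
  unfolding bar_eq by (auto simp: doubleton_eq_iff)

lemma bar_mult: "bar A <#>\<^bsub>M2plus\<^esub> bar B = bar (A ** B)" "bar A <#>\<^bsub>SL2Z\<^esub> bar B = bar (A ** B)"
  by (auto simp: bar_eq set_mult_def M2plus_def)

lemma mult_bar_group: "bar A \<otimes>\<^bsub>bar_group \<Gamma>\<^esub> bar B = bar (A ** B)"
  by (simp add: bar_group_def PSL2Z_def bar_mult)

lemma one_bar_group: "\<one>\<^bsub>bar_group \<Gamma>\<^esub> = bar (mat 1)"
  by (simp add: bar_group_def PSL2Z_def bar_eq)

lemma carrier_bar_group: "carrier (bar_group \<Gamma>) = bar ` \<Gamma>"
  by (simp add: bar_group_def)

lemma mat_of_bar: "mat_of (bar A) = A \<or> mat_of (bar A) = - A"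
proof -
  have "mat_of (bar A) \<in> bar A" unfolding mat_of_def by (rule someI[of _ A]) (simp add: bar_eq)
  then show ?thesis by (auto simp: bar_eq)
qed

lemma bar_mat_of: "bar (mat_of (bar A)) = bar A"
  using mat_of_bar[of A] by (auto simp: bar_eq_iff)

lemma group_bar_group:
  assumes "subgroup \<Gamma> SL2Z"
  shows "group (bar_group \<Gamma>)"
proof (rule groupI)
  fix x y assume "x \<in> carrier (bar_group \<Gamma>)" "y \<in> carrier (bar_group \<Gamma>)"
  then show "x \<otimes>\<^bsub>bar_group \<Gamma>\<^esub> y \<in> carrier (bar_group \<Gamma>)"
    using subgroup.m_closed[OF assms] by (auto simp: carrier_bar_group mult_bar_group)
next
  show "\<one>\<^bsub>bar_group \<Gamma>\<^esub> \<in> carrier (bar_group \<Gamma>)"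
    using subgroup.one_closed[OF assms] by (auto simp: carrier_bar_group one_bar_group)
next
  fix x assume "x \<in> carrier (bar_group \<Gamma>)"
  then obtain A where A: "A \<in> \<Gamma>" "x = bar A" by (auto simp: carrier_bar_group)
  then have "det A = 1" using subgroup.subset[OF assms] carrier_SL2Z by blast
  moreover have "adj2 A \<in> \<Gamma>" using subgroup.m_inv_closed[OF assms A(1)] subgroup.subset[OF assms] A inv_SL2Z by auto
  ultimately show "\<exists>y\<in>carrier (bar_group \<Gamma>). y \<otimes>\<^bsub>bar_group \<Gamma>\<^esub> x = \<one>\<^bsub>bar_group \<Gamma>\<^esub>"
    using A by (intro bexI[of _ "bar (adj2 A)"]) (auto simp: carrier_bar_group one_bar_group mult_bar_group adj2_left)
qed (auto simp: carrier_bar_group one_bar_group mult_bar_group matrix_mul_assoc)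

section \<open>The action on polynomials\<close>

interpretation mat_act: comm_ring_hom "mat_act A" for A
  unfolding mat_act_def by (rule comm_ring_hom_subst2)

lemma mat_act_const2 [simp]: "mat_act A (const2 r) = const2 r"
  by (simp add: mat_act_def)

lemma mat_act_X1: "mat_act A X1 = of_int (A $ 2 $ 2) * X1 - of_int (A $ 1 $ 2) * X2"
  and mat_act_X2: "mat_act A X2 = - of_int (A $ 2 $ 1) * X1 + of_int (A $ 1 $ 1) * X2"
  by (simp_all add: mat_act_def)

lemma mat_act_subst2: "mat_act A (subst2 P U W) = subst2 P (mat_act A U) (mat_act A W)"
  by (simp add: mat_act_def subst2_subst2)

lemma mat_act_mult: "mat_act (A ** B) P = mat_act A (mat_act B P)"
proof -
  obtain a b c d where A: "A = mat2 a b c d" by (rule mat2_exhaust)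
  obtain a' b' c' d' where B: "B = mat2 a' b' c' d'" by (rule mat2_exhaust)
  have "mat_act A (mat_act B P) = subst2 P (mat_act A (of_int d' * X1 - of_int b' * X2)) (mat_act A (- of_int c' * X1 + of_int a' * X2))"
    by (simp only: mat_act_def[of B] mat_act_subst2) (simp add: B)
  also have "\<dots> = mat_act (A ** B) P"
    by (simp add: A B mat_act_def[of "mat2 _ _ _ _" P] mat_act.hom_add mat_act.hom_minus mat_act.hom_mult mat_act.hom_uminus mat_act.hom_of_int mat_act_X1 mat_act_X2 algebra_simps)
  finally show ?thesis ..
qed

lemma mat_act_homogeneous:
  assumes "P \<in> homogeneous k"
  shows "mat_act A P \<in> homogeneous k"
  unfolding mat_act_def
proof (rule homogeneous_subst2[OF assms])
  show "of_int (A $ 2 $ 2) * X1 - of_int (A $ 1 $ 2) * X2 \<in> homogeneous 1"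
    by (intro homogeneous_diff homogeneous_of_int_mult homogeneous_X1 homogeneous_X2)
  have "of_int (- A $ 2 $ 1) * X1 + of_int (A $ 1 $ 1) * X2 \<in> homogeneous 1"
    by (intro homogeneous_add homogeneous_of_int_mult homogeneous_X1 homogeneous_X2)
  then show "- of_int (A $ 2 $ 1) * X1 + of_int (A $ 1 $ 1) * X2 \<in> homogeneous 1" by simp
qed

lemma mat_act_expand:
  assumes "P \<in> homogeneous k"
  shows "mat_act A P = (\<Sum>i\<le>k. const2 (coeff (coeff P i) (k - i)) * (mat_act A X1 ^ i * mat_act A X2 ^ (k - i)))"
  using arg_cong[OF homogeneous_expand[OF assms], of "mat_act A"]
  by (simp only: mat_act.hom_sum mat_act.hom_mult mat_act.hom_power mat_act_const2)

lemma mat_act_one: "P \<in> homogeneous k \<Longrightarrow> mat_act (mat 1) P = P"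
  using mat_act_expand[of P k "mat 1"] homogeneous_expand[of P k]
  by (simp only: mat2_one mat_act_X1 mat_act_X2 mat2_nth) simp

text \<open>Every monomial has even total degree, so the signs cancel. This makes
  \<open>bar_act\<close> independent of the choice made by \<open>mat_of\<close>.\<close>

lemma mat_act_uminus:
  assumes "P \<in> homogeneous (2 * k)"
  shows "mat_act (- A) P = mat_act A P"
proof -
  have X: "mat_act (- A) X1 = - mat_act A X1" "mat_act (- A) X2 = - mat_act A X2"
    by (simp_all add: mat_act_X1 mat_act_X2)
  have "(- u) ^ i * (- v) ^ (2 * k - i) = u ^ i * v ^ (2 * k - i)" if "i \<le> 2 * k" for u v :: "'a poly2" and i
  proof -
    have "(- u) ^ i * (- v) ^ (2 * k - i) = (- 1) ^ (i + (2 * k - i)) * (u ^ i * v ^ (2 * k - i))"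
      by (simp only: power_minus[of u] power_minus[of v] power_add mult_ac)
    then show ?thesis using that by simp
  qed
  then show ?thesis unfolding mat_act_expand[OF assms] X by (intro sum.cong) auto
qed

lemma bar_act_bar: "P \<in> homogeneous (2 * k) \<Longrightarrow> bar_act (bar A) P = mat_act A P"
  unfolding bar_act_def using mat_of_bar[of A] mat_act_uminus by metis

section \<open>Finite generation of congruence subgroups\<close>

text \<open>Words without inverses, so that induction has a single step; the generating set of
  \<open>SL2Z\<close> therefore lists inverses explicitly.\<close>

inductive_set mgen :: "mat2 set \<Rightarrow> mat2 set" for E where
  one: "mat 1 \<in> mgen E"
| mult: "e \<in> E \<Longrightarrow> w \<in> mgen E \<Longrightarrow> e ** w \<in> mgen E"

lemma mgen_base: "e \<in> E \<Longrightarrow> e \<in> mgen E"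
  using mgen.mult[OF _ mgen.one, of e E] by simp

lemma mgen_mult: "v \<in> mgen E \<Longrightarrow> w \<in> mgen E \<Longrightarrow> v ** w \<in> mgen E"
  by (induction rule: mgen.induct) (auto simp: matrix_mul_assoc[symmetric] intro: mgen.mult)

lemma mgen_mono: "w \<in> mgen E \<Longrightarrow> E \<subseteq> E' \<Longrightarrow> w \<in> mgen E'"
  by (induction rule: mgen.induct) (auto intro: mgen.intros)

definition SL2Z_gens :: "mat2 set" where
  "SL2Z_gens = {mat2 1 1 0 1, mat2 1 (- 1) 0 1, mat2 0 (- 1) 1 0, mat2 0 1 (- 1) 0}"

lemma translation_mgen: "mat2 1 n 0 1 \<in> mgen SL2Z_gens"
proof (induction n rule: int_induct[where k = 0])
  case base
  then show ?case using mgen.one[of SL2Z_gens] by (simp add: mat2_one)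
next
  case (step1 i)
  have "mat2 1 1 0 1 ** mat2 1 i 0 1 \<in> mgen SL2Z_gens"
    using step1 by (intro mgen.mult) (auto simp: SL2Z_gens_def)
  then show ?case by (simp add: add.commute)
next
  case (step2 i)
  have "mat2 1 (- 1) 0 1 ** mat2 1 i 0 1 \<in> mgen SL2Z_gens"
    using step2 by (intro mgen.mult) (auto simp: SL2Z_gens_def)
  then show ?case by simp
qed

lemma minus_one_mgen: "mat2 (- 1) 0 0 (- 1) \<in> mgen SL2Z_gens"
proof -
  have "mat2 0 (- 1) 1 0 ** mat2 0 (- 1) 1 0 \<in> mgen SL2Z_gens"
    by (intro mgen.mult mgen_base) (auto simp: SL2Z_gens_def)
  then show ?thesis by simp
qed

text \<open>Euclid's algorithm on the first column, by induction on the size of the lower left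
  entry.\<close>

lemma SL2Z_generated: "det A = 1 \<Longrightarrow> A \<in> mgen SL2Z_gens"
proof (induction "nat \<bar>A $ 2 $ 1\<bar>" arbitrary: A rule: less_induct)
  case less
  obtain a b c d where A: "A = mat2 a b c d" by (rule mat2_exhaust)
  have det: "a * d - b * c = 1" using less.prems by (simp add: A)
  show ?case
  proof (cases "c = 0")
    case True
    then have "a * d = 1" using det by simp
    then consider "a = 1" "d = 1" | "a = - 1" "d = - 1" using zmult_eq_1_iff by auto
    then show ?thesis
    proof cases
      case 1
      then show ?thesis using translation_mgen[of b] True by (simp add: A)
    next
      case 2
      then show ?thesis using mgen_mult[OF minus_one_mgen translation_mgen[of "- b"]] True by (simp add: A)
    qed
  next
    case False
    define q where "q = a div c"
    have r: "a - q * c = a mod c" by (simp add: q_def minus_div_mult_eq_mod)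
    have lt: "\<bar>a - q * c\<bar> < \<bar>c\<bar>" unfolding r using False by (rule abs_mod_less)
    \<comment> \<open>This is \<open>S T^(-q) A\<close> with \<open>S = mat2 0 (- 1) 1 0\<close> and
      \<open>T = mat2 1 1 0 1\<close>; its lower left entry is \<open>a mod c\<close>.\<close>
    define A' where "A' = mat2 (- c) (- d) (a - q * c) (b - q * d)"
    have "det A' = 1" unfolding A'_def using det by (simp add: algebra_simps)
    moreover have "nat \<bar>A' $ 2 $ 1\<bar> < nat \<bar>A $ 2 $ 1\<bar>" using lt by (simp add: A A'_def)
    ultimately have "A' \<in> mgen SL2Z_gens" using less.hyps by blast
    moreover have "mat2 0 1 (- 1) 0 \<in> SL2Z_gens" by (simp add: SL2Z_gens_def)
    ultimately have "mat2 1 q 0 1 ** (mat2 0 1 (- 1) 0 ** A') \<in> mgen SL2Z_gens"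
      by (intro mgen_mult[OF translation_mgen] mgen.mult)
    also have "mat2 1 q 0 1 ** (mat2 0 1 (- 1) 0 ** A') = A" by (simp add: A A'_def)
    finally show ?thesis .
  qed
qed

definition res :: "nat \<Rightarrow> mat2 \<Rightarrow> mat2" where
  "res M A = mat2 (A $ 1 $ 1 mod int M) (A $ 1 $ 2 mod int M) (A $ 2 $ 1 mod int M) (A $ 2 $ 2 mod int M)"

lemma res_mat2 [simp]: "res M (mat2 a b c d) = mat2 (a mod int M) (b mod int M) (c mod int M) (d mod int M)"
  by (simp add: res_def)

lemma finite_res: "M > 0 \<Longrightarrow> finite (range (res M))"
proof -
  assume "M > 0"
  let ?I = "{0..<int M}"
  have "range (res M) \<subseteq> (\<lambda>(a, b, c, d). mat2 a b c d) ` (?I \<times> ?I \<times> ?I \<times> ?I)"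
    using \<open>M > 0\<close> by (auto simp: res_def image_iff)
  then show ?thesis by (rule finite_subset) auto
qed

lemma res_mult: "res M (A ** B) = res M (res M A ** res M B)"
  by (cases A rule: mat2_exhaust, cases B rule: mat2_exhaust)
    (auto intro!: mod_add_cong mod_mult_eq[symmetric])

lemma res_mult_cong: "res M A = res M A' \<Longrightarrow> res M B = res M B' \<Longrightarrow> res M (A ** B) = res M (A' ** B')"
  by (metis res_mult)

lemma Gamma_principal_iff: "A \<in> Gamma_principal M \<longleftrightarrow> det A = 1 \<and> res M A = res M (mat 1)"
  by (cases A rule: mat2_exhaust) (auto simp: Gamma_principal_def carrier_SL2Z cong_def mat2_one)

lemma Gamma_principal_adj2:
  assumes "det A = 1" "det B = 1" "res M A = res M B"
  shows "A ** adj2 B \<in> Gamma_principal M"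
  using assms res_mult_cong[of M A B "adj2 B" "adj2 B"]
  by (simp add: Gamma_principal_iff det_mul adj2_right)

text \<open>Schreier's argument for the principal subgroup, whose cosets are told apart by residues
  modulo \<open>M\<close>: with \<open>\<rho>\<close> choosing representatives, the basic generators
  are the elements \<open>r e \<rho>(r e)^(-1)\<close>.\<close>

lemma Gamma_principal_finitely_generated:
  assumes "subgroup \<Gamma> SL2Z" "M > 0" "Gamma_principal M \<subseteq> \<Gamma>"
  obtains E where "finite E" "E \<subseteq> \<Gamma>" "\<Gamma> \<subseteq> mgen E"
proof -
  define \<rho> where "\<rho> A = (SOME B. det B = 1 \<and> res M B = res M A)" for A
  have \<rho>: "det (\<rho> A) = 1 \<and> res M (\<rho> A) = res M A" if "det A = 1" for A
    unfolding \<rho>_def by (rule someI[of _ A]) (simp add: that)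
  have \<rho>_cong: "\<rho> A = \<rho> B" if "res M A = res M B" for A B using that by (simp add: \<rho>_def)
  define R where "R = \<rho> ` {A. det A = 1}"
  have "\<rho> ` {A. det A = 1} = (\<lambda>r. SOME B. det B = 1 \<and> res M B = r) ` res M ` {A. det A = 1}"
    unfolding \<rho>_def image_image ..
  moreover have "finite (res M ` {A. det A = 1})" by (rule finite_subset[OF _ finite_res[OF assms(2)]]) auto
  ultimately have finR: "finite R" unfolding R_def by simp
  have Rdet: "det r = 1" if "r \<in> R" for r using that \<rho> by (auto simp: R_def)
  define E1 where "E1 = (\<lambda>(r, e). r ** e ** adj2 (\<rho> (r ** e))) ` (R \<times> SL2Z_gens)"
  have gens: "det e = 1" if "e \<in> SL2Z_gens" for e using that by (auto simp: SL2Z_gens_def)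
  \<comment> \<open>The word is processed letter by letter; \<open>r\<close> has to be arbitrary
    because the current representative changes with each letter.\<close>
  have word: "r ** w ** adj2 (\<rho> (r ** w)) \<in> mgen E1 \<and> det w = 1" if "w \<in> mgen SL2Z_gens" "r \<in> R" for r w
    using that
  proof (induction arbitrary: r rule: mgen.induct)
    case one
    have "\<rho> r = r"
    proof -
      obtain A where "det A = 1" "r = \<rho> A" using one by (auto simp: R_def)
      then show ?thesis using \<rho>_cong[of r A] \<rho>[of A] by simp
    qed
    then show ?case using Rdet[OF one] by (simp add: adj2_right mgen.one)
  next
    case (mult e w)
    define s where "s = \<rho> (r ** e)"
    have re: "det (r ** e) = 1" using mult Rdet gens by (simp add: det_mul)
    then have s: "s \<in> R" "det s = 1" "res M s = res M (r ** e)" using \<rho>[OF re] by (auto simp: s_def R_def)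
    have IH: "s ** w ** adj2 (\<rho> (s ** w)) \<in> mgen E1" "det w = 1" using mult.IH[OF s(1)] by auto
    have e: "\<rho> (s ** w) = \<rho> (r ** (e ** w))"
      unfolding matrix_mul_assoc by (intro \<rho>_cong res_mult_cong[OF s(3) refl])
    have "r ** e ** adj2 s \<in> E1"
      unfolding E1_def s_def using mult.hyps mult.prems by (intro image_eqI[of _ _ "(r, e)"]) auto
    then have "(r ** e ** adj2 s) ** (s ** w ** adj2 (\<rho> (s ** w))) \<in> mgen E1"
      using IH(1) by (rule mgen.mult)
    also have "(r ** e ** adj2 s) ** (s ** w ** adj2 (\<rho> (s ** w)))
       = r ** e ** (adj2 s ** s) ** w ** adj2 (\<rho> (s ** w))" by (simp add: matrix_mul_assoc)
    also have "\<dots> = r ** (e ** w) ** adj2 (\<rho> (r ** (e ** w)))"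
      using s by (simp add: adj2_left e matrix_mul_assoc)
    finally show ?case using IH gens mult.hyps by (simp add: det_mul)
  qed
  \<comment> \<open>\<open>\<rho>\<close> need not fix the unit matrix, hence the second set; the
    third supplies representatives for the cosets inside \<open>\<Gamma>\<close>.\<close>
  define E where "E = E1 \<union> {adj2 (\<rho> (mat 1))} \<union> \<rho> ` \<Gamma>"
  have \<Gamma>det: "det A = 1" if "A \<in> \<Gamma>" for A using subgroup.subset[OF assms(1)] that carrier_SL2Z by blast
  show ?thesis
  proof (rule that[of E])
    have "\<rho> ` \<Gamma> \<subseteq> R" using \<Gamma>det by (auto simp: R_def)
    then show "finite E" unfolding E_def E1_def using finR finite_subset by (auto simp: SL2Z_gens_def)
    have one: "det (\<rho> (mat 1)) = 1" "res M (\<rho> (mat 1)) = res M (mat 1)" using \<rho>[of "mat 1"] by auto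
    show "E \<subseteq> \<Gamma>"
    proof
      fix e assume "e \<in> E"
      then consider "e \<in> E1" | "e = adj2 (\<rho> (mat 1))" | A where "A \<in> \<Gamma>" "e = \<rho> A" unfolding E_def by blast
      then show "e \<in> \<Gamma>"
      proof cases
        case 1
        then obtain r g where rg: "r \<in> R" "g \<in> SL2Z_gens" "e = r ** g ** adj2 (\<rho> (r ** g))" unfolding E1_def by auto
        then have "det (r ** g) = 1" using Rdet gens by (simp add: det_mul)
        then show ?thesis using Gamma_principal_adj2[of "r ** g" "\<rho> (r ** g)" M] \<rho>[of "r ** g"] rg assms(3) by auto
      next
        case 2
        have "mat 1 ** adj2 (\<rho> (mat 1)) \<in> Gamma_principal M"
          using one by (intro Gamma_principal_adj2) auto
        then show ?thesis using 2 assms(3) by auto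
      next
        case 3
        then have "\<rho> A ** adj2 A \<in> \<Gamma>"
          using Gamma_principal_adj2[of "\<rho> A" A M] \<rho>[OF \<Gamma>det[OF 3(1)]] \<Gamma>det assms(3) by auto
        then have "\<rho> A ** adj2 A ** A \<in> \<Gamma>" using subgroup.m_closed[OF assms(1)] 3(1) by fastforce
        then show ?thesis using 3 \<Gamma>det by (simp add: matrix_mul_assoc[symmetric] adj2_left)
      qed
    qed
    show "\<Gamma> \<subseteq> mgen E"
    proof
      fix A assume A: "A \<in> \<Gamma>"
      define r where "r = \<rho> (mat 1)"
      have r: "r \<in> R" "det r = 1" "res M r = res M (mat 1)" using one by (auto simp: r_def R_def)
      have eA: "\<rho> (r ** A) = \<rho> A" using res_mult_cong[OF r(3), of A A] by (intro \<rho>_cong) simp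
      have \<rho>A: "det (\<rho> A) = 1" using \<rho> \<Gamma>det A by blast
      have "r ** A ** adj2 (\<rho> A) \<in> mgen E1"
        using word[OF SL2Z_generated[OF \<Gamma>det[OF A]] r(1)] eA by simp
      then have "r ** A ** adj2 (\<rho> A) \<in> mgen E" by (rule mgen_mono) (auto simp: E_def)
      moreover have "adj2 r \<in> mgen E" "\<rho> A \<in> mgen E" using A by (auto simp: E_def r_def intro: mgen_base)
      ultimately have "adj2 r ** ((r ** A ** adj2 (\<rho> A)) ** \<rho> A) \<in> mgen E" by (metis mgen_mult)
      also have "adj2 r ** ((r ** A ** adj2 (\<rho> A)) ** \<rho> A) = (adj2 r ** r) ** A ** (adj2 (\<rho> A) ** \<rho> A)"
        by (simp only: matrix_mul_assoc)
      also have "\<dots> = A" using r \<rho>A by (simp add: adj2_left)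
      finally show "A \<in> mgen E" .
    qed
  qed
qed

section \<open>Coset representatives of the Hecke correspondence\<close>

abbreviation bm :: "mat2 set \<Rightarrow> mat2 set \<Rightarrow> mat2 set" (infixl "\<odot>" 70) where
  "x \<odot> y \<equiv> x <#>\<^bsub>M2plus\<^esub> y"

lemma bm_assoc: "x \<odot> y \<odot> z = x \<odot> (y \<odot> z)"
  unfolding set_mult_def M2plus_def by (auto simp: matrix_mul_assoc)

lemma mult_bar_group_bm [simp]: "x \<otimes>\<^bsub>bar_group \<Gamma>\<^esub> y = x \<odot> y"
proof -
  have "x \<otimes>\<^bsub>bar_group \<Gamma>\<^esub> y = x <#>\<^bsub>SL2Z\<^esub> y" by (simp add: bar_group_def PSL2Z_def)
  then show ?thesis by (simp only: set_mult_def SL2Z_def M2plus_def monoid.simps)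
qed

lemma mult_M2plus_bar_bm [simp]: "x \<otimes>\<^bsub>M2plus_bar\<^esub> y = x \<odot> y"
  by (simp add: M2plus_bar_def)

lemma r_coset_M2plus_bar: "C #>\<^bsub>M2plus_bar\<^esub> g = (\<lambda>x. x \<odot> g) ` C"
  by (auto simp: r_coset_def)

lemma bar_bm: "bar A \<odot> bar B = bar (A ** B)"
  by (rule bar_mult)

text \<open>Secures uniqueness of the element chosen by \<open>THE\<close> in
  \<open>hecke_transfer\<close>.\<close>

lemma bar_right_cancel:
  assumes "bar A \<odot> bar R = bar B \<odot> bar R" "det R \<noteq> 0"
  shows "bar A = bar B"
proof -
  have "A ** R = B ** R \<or> A ** R = (- B) ** R" using assms(1) by (auto simp: bar_bm bar_eq_iff)
  then have "A = B \<or> A = - B" using mat2_right_cancel assms(2) by blast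
  then show ?thesis by (simp only: bar_eq_iff)
qed

locale hecke_setup =
  fixes \<Gamma> :: "mat2 set" and M p :: nat
  assumes subgroup: "subgroup \<Gamma> SL2Z" and M: "M > 0" "Gamma_principal M \<subseteq> \<Gamma>" and p: "p > 0"
begin

abbreviation "\<alpha> \<equiv> mat2 1 0 0 (int p)"
abbreviation "Q \<equiv> double_coset_quotient \<Gamma> \<alpha> \<Gamma>"
abbreviation "G \<equiv> bar ` \<Gamma>"

lemma \<Gamma>_det: "A \<in> \<Gamma> \<Longrightarrow> det A = 1"
  using subgroup.subset[OF subgroup] carrier_SL2Z by blast

lemma \<Gamma>_mult: "A \<in> \<Gamma> \<Longrightarrow> B \<in> \<Gamma> \<Longrightarrow> A ** B \<in> \<Gamma>"
  using subgroup.m_closed[OF subgroup, of A B] by simp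

lemma \<Gamma>_one: "mat 1 \<in> \<Gamma>"
  using subgroup.one_closed[OF subgroup] by simp

lemma \<Gamma>_adj2: "A \<in> \<Gamma> \<Longrightarrow> adj2 A \<in> \<Gamma>"
  using subgroup.m_inv_closed[OF subgroup, of A] inv_SL2Z[of A] subgroup.subset[OF subgroup] by auto

lemma \<Gamma>_right: "B \<in> \<Gamma> \<Longrightarrow> (\<lambda>h. h ** B) ` \<Gamma> = \<Gamma>"
proof (intro equalityI subsetI)
  fix A assume B: "B \<in> \<Gamma>" and A: "A \<in> \<Gamma>"
  have "A = (A ** adj2 B) ** B" using \<Gamma>_det[OF B] by (simp add: matrix_mul_assoc[symmetric] adj2_left)
  then show "A \<in> (\<lambda>h. h ** B) ` \<Gamma>" using \<Gamma>_mult[OF A \<Gamma>_adj2[OF B]] by blast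
qed (auto intro: \<Gamma>_mult)

text \<open>The coset \<open>\<Gamma> \<alpha> A\<close> modulo sign; by \<open>Q_eq\<close> those
  with \<open>A\<close> in \<open>\<Gamma>\<close> index the Hecke sum.\<close>

definition dc :: "mat2 \<Rightarrow> mat2 set set" where
  "dc A = (\<lambda>h. bar (h ** \<alpha> ** A)) ` \<Gamma>"

lemma dc_shift: "h \<in> \<Gamma> \<Longrightarrow> (\<lambda>h'. bar (h' ** h ** \<alpha> ** A)) ` \<Gamma> = dc A"
proof -
  assume "h \<in> \<Gamma>"
  then have "dc A = (\<lambda>h. bar (h ** \<alpha> ** A)) ` (\<lambda>h'. h' ** h) ` \<Gamma>" by (simp only: \<Gamma>_right dc_def)
  then show ?thesis by (simp only: image_image)
qed

lemma Q_eq: "Q = dc ` \<Gamma>"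
proof -
  have coset: "G #>\<^bsub>M2plus_bar\<^esub> (bar (A ** (\<alpha> ** B))) = dc B" if "A \<in> \<Gamma>" for A B
    using dc_shift[OF that, of B] by (simp add: r_coset_M2plus_bar image_image bar_bm matrix_mul_assoc)
  have "G <#>\<^bsub>M2plus_bar\<^esub> (bar \<alpha> <#\<^bsub>M2plus_bar\<^esub> G) = {bar (A ** (\<alpha> ** B)) | A B. A \<in> \<Gamma> \<and> B \<in> \<Gamma>}"
    by (auto simp: set_mult_def[of M2plus_bar] l_coset_def bar_bm)
  then have Q: "Q = {G #>\<^bsub>M2plus_bar\<^esub> (bar (A ** (\<alpha> ** B))) | A B. A \<in> \<Gamma> \<and> B \<in> \<Gamma>}"
    unfolding double_coset_quotient_def by auto
  show ?thesis
  proof (intro equalityI subsetI)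
    fix C assume "C \<in> Q"
    then obtain A B where "A \<in> \<Gamma>" "B \<in> \<Gamma>" "C = G #>\<^bsub>M2plus_bar\<^esub> (bar (A ** (\<alpha> ** B)))"
      unfolding Q by blast
    then show "C \<in> dc ` \<Gamma>" by (simp add: coset)
  next
    fix C assume "C \<in> dc ` \<Gamma>"
    then obtain B where "B \<in> \<Gamma>" "C = G #>\<^bsub>M2plus_bar\<^esub> (bar (mat 1 ** (\<alpha> ** B)))"
      using coset[OF \<Gamma>_one] by auto
    then show "C \<in> Q" unfolding Q using \<Gamma>_one by blast
  qed
qed

lemma dc_act: "dc A #>\<^bsub>M2plus_bar\<^esub> bar B = dc (A ** B)"
  by (simp add: r_coset_M2plus_bar dc_def image_image bar_bm matrix_mul_assoc)

lemma dc_eqD: "dc A = dc B \<Longrightarrow> \<exists>h \<in> \<Gamma>. bar (\<alpha> ** A) = bar (h ** \<alpha> ** B)"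
proof -
  assume "dc A = dc B"
  moreover have "bar (\<alpha> ** A) \<in> dc A" unfolding dc_def using \<Gamma>_one by (intro image_eqI[of _ _ "mat 1"]) auto
  ultimately show ?thesis unfolding dc_def by auto
qed

lemma coset_rep_decomposition:
  assumes "C \<in> Q"
  shows "\<exists>x. fst x \<in> \<Gamma> \<and> snd x \<in> \<Gamma> \<and> C = dc (snd x) \<and> coset_rep C = bar (fst x ** \<alpha> ** snd x)"
proof -
  obtain A where A: "A \<in> \<Gamma>" "C = dc A" using assms by (auto simp: Q_eq)
  have "C \<noteq> {}" using A \<Gamma>_one by (auto simp: dc_def)
  then have "coset_rep C \<in> C" unfolding coset_rep_def by (simp add: some_in_eq)
  then obtain D where "D \<in> \<Gamma>" "coset_rep C = bar (D ** \<alpha> ** A)" using A by (auto simp: dc_def)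
  then show ?thesis using A by (intro exI[of _ "(D, A)"]) auto
qed

text \<open>\<open>coset_rep\<close> yields some element \<open>dl C \<alpha> rr C\<close> of the
  coset; the left factor \<open>dl C\<close> is its deviation from the convenient representative
  \<open>\<alpha> rr C\<close>.\<close>

definition decomp :: "mat2 set set \<Rightarrow> mat2 \<times> mat2" where
  "decomp C = (SOME x. fst x \<in> \<Gamma> \<and> snd x \<in> \<Gamma> \<and> C = dc (snd x) \<and> coset_rep C = bar (fst x ** \<alpha> ** snd x))"

definition dl :: "mat2 set set \<Rightarrow> mat2" where "dl C = fst (decomp C)"

definition rr :: "mat2 set set \<Rightarrow> mat2" where "rr C = snd (decomp C)"

lemma decomp:
  assumes "C \<in> Q"
  shows "dl C \<in> \<Gamma>" "rr C \<in> \<Gamma>" "dc (rr C) = C" "coset_rep C = bar (dl C) \<odot> (bar \<alpha> \<odot> bar (rr C))"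
proof -
  note x = someI_ex[OF coset_rep_decomposition[OF assms], folded decomp_def dl_def rr_def]
  show "dl C \<in> \<Gamma>" "rr C \<in> \<Gamma>" using x by blast+
  show "dc (rr C) = C" using x by (elim conjE) (rule sym)
  show "coset_rep C = bar (dl C) \<odot> (bar \<alpha> \<odot> bar (rr C))"
    unfolding bar_bm matrix_mul_assoc using x by blast
qed

abbreviation act_right :: "mat2 set set \<Rightarrow> mat2 set \<Rightarrow> mat2 set set" (infixl "\<triangleleft>" 70) where
  "C \<triangleleft> g \<equiv> C #>\<^bsub>M2plus_bar\<^esub> g"

lemma Q_act: "C \<in> Q \<Longrightarrow> g \<in> G \<Longrightarrow> C \<triangleleft> g \<in> Q"
  unfolding Q_eq by (auto simp: dc_act intro!: imageI \<Gamma>_mult)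

lemma Q_act_mult: "C \<triangleleft> (g \<odot> h) = C \<triangleleft> g \<triangleleft> h"
  by (simp add: r_coset_M2plus_bar image_image bm_assoc)

lemma Q_act_bij: "g \<in> G \<Longrightarrow> bij_betw (\<lambda>C. C \<triangleleft> g) Q Q"
proof -
  assume "g \<in> G"
  then obtain A where A: "A \<in> \<Gamma>" "g = bar A" by blast
  have 1: "C \<triangleleft> bar X \<triangleleft> bar Y = C" if "X ** Y = mat 1" "C \<in> Q" for C X Y
  proof -
    obtain B where "C = dc B" using \<open>C \<in> Q\<close> by (auto simp: Q_eq)
    then show ?thesis using that(1) by (simp add: dc_act matrix_mul_assoc[symmetric])
  qed
  have "A ** adj2 A = mat 1" "adj2 A ** A = mat 1" using A \<Gamma>_det by (auto simp: adj2_left adj2_right)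
  then show ?thesis
    using A \<Gamma>_adj2[of A] 1 Q_act by (intro bij_betwI[of _ _ _ "\<lambda>C. C \<triangleleft> bar (adj2 A)"]) auto
qed

text \<open>With representatives \<open>\<alpha> rr C\<close> the transfer \<open>h\<close>
  satisfies \<open>h \<alpha> = \<alpha> W\<close> up to sign for an integral matrix
  \<open>W\<close>, so its lower left entry is, up to sign, p times that of
  \<open>W\<close>.\<close>

lemma eta_exists:
  assumes "C \<in> Q" "g \<in> G"
  shows "\<exists>e. e \<in> bar ` (\<Gamma> \<inter> Gamma0 p) \<and> bar \<alpha> \<odot> bar (rr C) \<odot> g = e \<odot> (bar \<alpha> \<odot> bar (rr (C \<triangleleft> g)))"
proof -
  obtain B where B: "B \<in> \<Gamma>" "g = bar B" using assms(2) by blast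
  define Y where "Y = rr (C \<triangleleft> g)"
  have Y: "Y \<in> \<Gamma>" using decomp(2)[OF Q_act[OF assms]] by (simp add: Y_def)
  have "dc (rr C ** B) = dc Y"
    using decomp(3)[OF assms(1)] decomp(3)[OF Q_act[OF assms]] dc_act[of "rr C" B] B by (simp add: Y_def)
  then obtain h where h: "h \<in> \<Gamma>" "bar (\<alpha> ** (rr C ** B)) = bar (h ** \<alpha> ** Y)" using dc_eqD by blast
  have "bar (\<alpha> ** (rr C ** B ** adj2 Y)) = bar (h ** \<alpha>)"
    using arg_cong[OF h(2), of "\<lambda>x. x \<odot> bar (adj2 Y)"] \<Gamma>_det[OF Y]
    by (simp add: bar_bm matrix_mul_assoc[symmetric] adj2_right)
  moreover obtain x y z w where "rr C ** B ** adj2 Y = mat2 x y z w" by (rule mat2_exhaust)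
  moreover obtain a b c d where "h = mat2 a b c d" by (rule mat2_exhaust)
  ultimately have "h \<in> Gamma0 p"
    using \<Gamma>_det[OF h(1)] by (auto simp: Gamma0_def carrier_SL2Z bar_eq_iff cong_0_iff)
      (metis dvd_minus_iff dvd_triv_left)
  moreover have "bar \<alpha> \<odot> bar (rr C) \<odot> g = bar h \<odot> (bar \<alpha> \<odot> bar Y)"
    using h(2) by (simp add: B bar_bm matrix_mul_assoc)
  ultimately show ?thesis using h(1) unfolding Y_def by blast
qed

definition eta :: "mat2 set set \<Rightarrow> mat2 set \<Rightarrow> mat2 set" where
  "eta C g = (SOME e. e \<in> bar ` (\<Gamma> \<inter> Gamma0 p) \<and>
     bar \<alpha> \<odot> bar (rr C) \<odot> g = e \<odot> (bar \<alpha> \<odot> bar (rr (C \<triangleleft> g))))"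

lemma eta:
  assumes "C \<in> Q" "g \<in> G"
  shows "eta C g \<in> bar ` (\<Gamma> \<inter> Gamma0 p)"
    and "bar \<alpha> \<odot> bar (rr C) \<odot> g = eta C g \<odot> (bar \<alpha> \<odot> bar (rr (C \<triangleleft> g)))"
  using someI_ex[OF eta_exists[OF assms], folded eta_def] by auto

abbreviation "tau \<equiv> hecke_transfer \<Gamma>"

lemma rep_bar: "C \<in> Q \<Longrightarrow> \<exists>R. coset_rep C = bar R \<and> det R > 0"
  using decomp[of C] \<Gamma>_det p
  by (intro exI[of _ "dl C ** (\<alpha> ** rr C)"]) (auto simp: bar_bm det_mul)

lemma tau_unique:
  assumes "C \<in> Q" "g \<in> G" "e \<in> G" "coset_rep C \<odot> g = e \<odot> coset_rep (C \<triangleleft> g)"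
  shows "tau C g = e"
  unfolding hecke_transfer_def mult_M2plus_bar_bm
proof (rule the_equality)
  show "e \<in> G \<and> coset_rep C \<odot> g = e \<odot> coset_rep (C \<triangleleft> g)" using assms by simp
  fix e' assume e': "e' \<in> G \<and> coset_rep C \<odot> g = e' \<odot> coset_rep (C \<triangleleft> g)"
  obtain R where R: "coset_rep (C \<triangleleft> g) = bar R" "det R > 0" using rep_bar Q_act assms by blast
  have "e' \<odot> bar R = e \<odot> bar R" using e' assms(4) R(1) by metis
  then show "e' = e" using e' assms(3) R(2) bar_right_cancel by (metis imageE less_irrefl)
qed

lemma bar_one_right: "x \<in> range bar \<Longrightarrow> x \<odot> bar (mat 1) = x"
  by (auto simp: bar_bm)

lemma eta_G: "C \<in> Q \<Longrightarrow> g \<in> G \<Longrightarrow> eta C g \<in> G"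
  using eta(1) by blast

lemma G_mult: "g \<in> G \<Longrightarrow> h \<in> G \<Longrightarrow> g \<odot> h \<in> G"
  by (auto simp: bar_bm intro!: imageI \<Gamma>_mult)

text \<open>A change of representatives by left factors in \<open>\<Gamma>\<close> alters the
  transfer by a coboundary.\<close>

lemma tau_eta:
  assumes "C \<in> Q" "g \<in> G"
  shows "tau C g = bar (dl C) \<odot> eta C g \<odot> bar (adj2 (dl (C \<triangleleft> g)))" (is "_ = ?e")
proof (rule tau_unique[OF assms])
  have C': "C \<triangleleft> g \<in> Q" using assms by (rule Q_act)
  show "?e \<in> G"
    using decomp(1)[OF assms(1)] \<Gamma>_adj2[OF decomp(1)[OF C']] eta_G[OF assms] by (intro G_mult) auto
  have em: "eta C g \<odot> bar (mat 1) = eta C g" using eta_G[OF assms] by (intro bar_one_right) auto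
  have "coset_rep C \<odot> g = bar (dl C) \<odot> (bar \<alpha> \<odot> bar (rr C) \<odot> g)"
    by (simp only: decomp(4)[OF assms(1)] bm_assoc)
  also have "\<dots> = bar (dl C) \<odot> (eta C g \<odot> bar (mat 1) \<odot> (bar \<alpha> \<odot> bar (rr (C \<triangleleft> g))))"
    by (simp only: em eta(2)[OF assms])
  also have "bar (mat 1) = bar (adj2 (dl (C \<triangleleft> g))) \<odot> bar (dl (C \<triangleleft> g))"
    using \<Gamma>_det[OF decomp(1)[OF C']] by (simp add: bar_bm adj2_left)
  finally show "coset_rep C \<odot> g = ?e \<odot> coset_rep (C \<triangleleft> g)"
    by (simp only: decomp(4)[OF C'] bm_assoc)
qed

lemma tau:
  assumes "C \<in> Q" "g \<in> G"
  shows "tau C g \<in> G" "coset_rep C \<odot> g = tau C g \<odot> coset_rep (C \<triangleleft> g)"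
    and "tau C g \<odot> bar (dl (C \<triangleleft> g)) = bar (dl C) \<odot> eta C g"
proof -
  have C': "C \<triangleleft> g \<in> Q" using assms by (rule Q_act)
  show "tau C g \<in> G"
    unfolding tau_eta[OF assms]
    using decomp(1)[OF assms(1)] \<Gamma>_adj2[OF decomp(1)[OF C']] eta_G[OF assms] by (intro G_mult) auto
  have e: "\<exists>h. eta C g = bar h" using eta_G[OF assms] by blast
  have d: "bar (adj2 (dl (C \<triangleleft> g))) \<odot> bar (dl (C \<triangleleft> g)) = bar (mat 1)"
    using \<Gamma>_det[OF decomp(1)[OF C']] by (simp add: bar_bm adj2_left)
  show *: "tau C g \<odot> bar (dl (C \<triangleleft> g)) = bar (dl C) \<odot> eta C g"
    unfolding tau_eta[OF assms] bm_assoc d using e by (auto simp: bar_bm)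
  have "tau C g \<odot> coset_rep (C \<triangleleft> g) = tau C g \<odot> bar (dl (C \<triangleleft> g)) \<odot> (bar \<alpha> \<odot> bar (rr (C \<triangleleft> g)))"
    unfolding decomp(4)[OF C'] bm_assoc ..
  also have "\<dots> = bar (dl C) \<odot> (bar \<alpha> \<odot> bar (rr C) \<odot> g)"
    by (simp only: * eta(2)[OF assms] bm_assoc[of "bar (dl C)" "eta C g"])
  also have "\<dots> = coset_rep C \<odot> g" by (simp only: decomp(4)[OF assms(1)] bm_assoc)
  finally show "coset_rep C \<odot> g = tau C g \<odot> coset_rep (C \<triangleleft> g)" ..
qed

lemma tau_mult:
  assumes "C \<in> Q" "g \<in> G" "h \<in> G"
  shows "tau C (g \<odot> h) = tau C g \<odot> tau (C \<triangleleft> g) h"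
proof (rule tau_unique[OF assms(1) G_mult[OF assms(2,3)]])
  have C': "C \<triangleleft> g \<in> Q" using assms by (intro Q_act)
  show "tau C g \<odot> tau (C \<triangleleft> g) h \<in> G" using tau(1) assms C' by (intro G_mult)
  show "coset_rep C \<odot> (g \<odot> h) = tau C g \<odot> tau (C \<triangleleft> g) h \<odot> coset_rep (C \<triangleleft> (g \<odot> h))"
    using tau(2)[OF assms(1,2)] tau(2)[OF C' assms(3)] by (metis bm_assoc Q_act_mult)
qed

end

section \<open>The Hecke operator, scalars and the boundary on chains\<close>

lemma comm_group_additive:
  assumes "0 \<in> S" "\<And>x y. x \<in> S \<Longrightarrow> y \<in> S \<Longrightarrow> x + y \<in> S" "\<And>x. x \<in> S \<Longrightarrow> - x \<in> S"
  shows "comm_group (additive_group S)"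
proof (rule comm_groupI)
  fix x assume "x \<in> carrier (additive_group S)"
  then show "\<exists>y\<in>carrier (additive_group S). y \<otimes>\<^bsub>additive_group S\<^esub> x = \<one>\<^bsub>additive_group S\<^esub>"
    using assms(3) by (intro bexI[of _ "- x"]) (auto simp: additive_group_def)
qed (use assms in \<open>auto simp: additive_group_def ac_simps\<close>)

lemma finprod_additive:
  assumes "comm_group (additive_group S)" "\<And>i. i \<in> I \<Longrightarrow> f i \<in> S"
  shows "finprod (additive_group S) f I = sum f I"
proof -
  interpret comm_group "additive_group S" by fact
  have one: "\<one>\<^bsub>additive_group S\<^esub> = 0" by (simp add: additive_group_def)
  show ?thesis
    using assms(2)
  proof (induction I rule: infinite_finite_induct)
    case (insert i I)
    have "finprod (additive_group S) f (insert i I) = f i \<otimes>\<^bsub>additive_group S\<^esub> finprod (additive_group S) f I"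
      using insert by (intro finprod_insert) (auto simp: additive_group_def)
    then show ?case using insert by (simp add: additive_group_def)
  qed (simp_all add: one)
qed

lemma int_pow_additive:
  fixes v :: "'v :: ring_1"
  assumes "comm_group (additive_group S)" "v \<in> S"
  shows "v [^]\<^bsub>additive_group S\<^esub> (n :: int) = of_int n * v"
proof -
  interpret comm_group "additive_group S" by fact
  have v: "v \<in> carrier (additive_group S)" using assms by (simp add: additive_group_def)
  have mult: "x \<otimes>\<^bsub>additive_group S\<^esub> y = x + y" for x y :: 'v by (simp add: additive_group_def)
  show ?thesis
  proof (induction n rule: int_induct[where k = 0])
    case base
    then show ?case using v by (simp add: additive_group_def)
  next
    case (step1 i)
    have "v [^]\<^bsub>additive_group S\<^esub> (i + 1) = v [^]\<^bsub>additive_group S\<^esub> i \<otimes>\<^bsub>additive_group S\<^esub> v"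
      using int_pow_mult[OF v, of i 1] v by simp
    then show ?case using step1 by (simp add: mult distrib_right)
  next
    case (step2 i)
    have "v [^]\<^bsub>additive_group S\<^esub> (i - 1 + 1) = v [^]\<^bsub>additive_group S\<^esub> (i - 1) \<otimes>\<^bsub>additive_group S\<^esub> v"
      using int_pow_mult[OF v, of "i - 1" 1] v by simp
    then have "of_int i * v = v [^]\<^bsub>additive_group S\<^esub> (i - 1) + v" using step2 by (simp add: mult)
    then have "v [^]\<^bsub>additive_group S\<^esub> (i - 1) = of_int i * v - v" by (metis add_diff_cancel_right')
    then show ?case by (simp add: left_diff_distrib)
  qed
qed

definition scl :: "'r :: comm_ring_1 \<Rightarrow> (mat2 set \<Rightarrow>\<^sub>0 'r poly2) \<Rightarrow> (mat2 set \<Rightarrow>\<^sub>0 'r poly2)" where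
  "scl r = Poly_Mapping.map (\<lambda>P. const2 r * P)"

lemma lookup_scl [simp]: "Poly_Mapping.lookup (scl r x) g = const2 r * Poly_Mapping.lookup x g"
  by (simp add: scl_def map.rep_eq when_def)

lemma keys_scl: "Poly_Mapping.keys (scl r x) \<subseteq> Poly_Mapping.keys x"
  by (auto simp: in_keys_iff)

lemma scl_single [simp]: "scl r (Poly_Mapping.single g v) = Poly_Mapping.single g (const2 r * v)"
  by (rule poly_mapping_eqI) (simp add: lookup_single when_def)

lemma module_scl: "Modules.module (scl :: 'r :: comm_ring_1 \<Rightarrow> _)"
  by unfold_locales
    (rule poly_mapping_eqI, simp add: lookup_add const2.hom_add const2.hom_mult algebra_simps)+

lemma bar_act_add: "bar_act g (v + w) = bar_act g v + bar_act g w"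
  by (simp add: bar_act_def mat_act.hom_add)

lemma bar_act_zero [simp]: "bar_act g 0 = 0"
  by (simp add: bar_act_def)

lemma bar_act_const2: "bar_act g (const2 r * v) = const2 r * bar_act g v"
  by (simp add: bar_act_def mat_act.hom_mult)

lemma bar_act_homogeneous: "v \<in> homogeneous n \<Longrightarrow> bar_act g v \<in> homogeneous n"
  unfolding bar_act_def by (rule mat_act_homogeneous)

lemma bar_act_bm:
  assumes "x \<in> range bar" "y \<in> range bar" "v \<in> homogeneous (2 * k)"
  shows "bar_act (x \<odot> y) v = bar_act x (bar_act y v)"
proof -
  obtain A B where "x = bar A" "y = bar B" using assms by blast
  then show ?thesis
    by (simp only: bar_bm bar_act_bar[OF assms(3)] bar_act_bar[OF mat_act_homogeneous[OF assms(3)]] mat_act_mult)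
qed

lemma IV_eq: "IV \<Gamma> k = tensor (group_ring (bar_group \<Gamma>)) (group_ring_mult (bar_group \<Gamma>))
    (augmentation_ideal (bar_group \<Gamma>)) (group_ring_act bar_act) (homogeneous (2 * k))"
  by (rule IV_def)

locale hecke_module = hecke_setup +
  fixes k :: nat and ty :: "'r :: comm_ring_1 itself"
begin

abbreviation V :: "'r poly2 set" where "V \<equiv> homogeneous (2 * k)"

sublocale gm: group_ring_module "bar_group \<Gamma>" bar_act V
proof (intro group_ring_module.intro group_ring_module_axioms.intro group_bar_group[OF subgroup])
  fix g h :: "mat2 set" and v :: "'r poly2"
  assume "g \<in> carrier (bar_group \<Gamma>)" "h \<in> carrier (bar_group \<Gamma>)" "v \<in> V"
  then show "bar_act (g \<otimes>\<^bsub>bar_group \<Gamma>\<^esub> h) v = bar_act g (bar_act h v)"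
    by (simp only: mult_bar_group_bm) (rule bar_act_bm; auto simp: carrier_bar_group)
next
  fix v :: "'r poly2" assume "v \<in> V"
  then show "bar_act \<one>\<^bsub>bar_group \<Gamma>\<^esub> v = v"
    by (simp add: one_bar_group bar_act_bar mat_act_one)
qed (auto simp: homogeneous_zero homogeneous_add homogeneous_uminus bar_act_homogeneous bar_act_add)

lemma IV_TP: "(IV \<Gamma> k :: 'r chain monoid) = gm.TP"
  by (rule IV_eq)

lemma pure_tensor_pt: "pure_tensor \<Gamma> k x v = gm.pt x (v :: 'r poly2)"
  by (simp add: pure_tensor_def gm.pt_def)

lemma minus_one_gm1: "minus_one g = gm.gm1 g"
  by (simp add: minus_one_def one_bar_group)

text \<open>Lifts \<open>hecke_basic\<close> from classes to chains, as
  \<open>hecke_basic_eq\<close> records.\<close>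

definition u :: "mat2 set \<Rightarrow> 'r poly2 \<Rightarrow> (mat2 set \<Rightarrow>\<^sub>0 'r poly2)" where
  "u g v = (\<Sum>C\<in>Q. Poly_Mapping.single (tau C g) (bar_act (coset_rep (C \<triangleleft> g)) v))"

lemma u_add: "u g (v + w) = u g v + u g w"
  by (simp add: u_def bar_act_add single_add sum.distrib)

lemma u_zero [simp]: "u g 0 = 0"
  by (simp add: u_def)

lemma scl_sum: "scl r (\<Sum>i\<in>I. f i) = (\<Sum>i\<in>I. scl r (f i))"
  by (rule poly_mapping_eqI) (simp add: lookup_sum sum_distrib_left)

lemma u_scl: "u g (const2 r * v) = scl r (u g v)"
  by (simp add: u_def bar_act_const2 scl_sum)

lemma tau_carrier: "C \<in> Q \<Longrightarrow> g \<in> G \<Longrightarrow> tau C g \<in> carrier (bar_group \<Gamma>)"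
  by (simp add: carrier_bar_group tau(1))

lemma u_chains: "g \<in> G \<Longrightarrow> v \<in> V \<Longrightarrow> u g v \<in> gm.chains"
  unfolding u_def by (intro gm.chains_sum gm.chains_single tau_carrier bar_act_homogeneous)

lemma chain_class_u:
  assumes "g \<in> G" "v \<in> V"
  shows "gm.chain_class (u g v)
    = finprod gm.TP (\<lambda>C. gm.pt (gm.gm1 (tau C g)) (bar_act (coset_rep (C \<triangleleft> g)) v)) Q"
proof -
  have "gm.chain_class (u g v)
     = finprod gm.TP (\<lambda>C. gm.chain_class (Poly_Mapping.single (tau C g) (bar_act (coset_rep (C \<triangleleft> g)) v))) Q"
    unfolding u_def using assms by (intro gm.chain_class_sum gm.chains_single tau_carrier bar_act_homogeneous)
  also have "\<dots> = finprod gm.TP (\<lambda>C. gm.pt (gm.gm1 (tau C g)) (bar_act (coset_rep (C \<triangleleft> g)) v)) Q"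
    using assms
    by (intro gm.TP.finprod_cong' refl)
      (auto intro!: gm.pt_closed gm.gm1_closed gm.chain_class_single tau_carrier bar_act_homogeneous)
  finally show ?thesis .
qed

lemma hecke_basic_eq:
  assumes "g \<in> G" "v \<in> V"
  shows "hecke_basic \<Gamma> \<alpha> \<Gamma> k g v = gm.chain_class (u g v)"
  unfolding chain_class_u[OF assms] hecke_basic_def IV_TP pure_tensor_pt minus_one_gm1 ..

sublocale hk: tensor_cocycle "bar_group \<Gamma>" bar_act V gm.TP "\<lambda>g v. gm.chain_class (u g v)"
proof (intro tensor_cocycle.intro tensor_cocycle_axioms.intro gm.group_ring_module_axioms gm.TP_comm_group)
  fix g v assume "g \<in> carrier (bar_group \<Gamma>)" "v \<in> V"
  then show "gm.chain_class (u g v) \<in> carrier gm.TP"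
    by (intro gm.chain_class_closed u_chains) (auto simp: carrier_bar_group)
next
  fix g v w assume "g \<in> carrier (bar_group \<Gamma>)" "v \<in> V" "w \<in> V"
  then show "gm.chain_class (u g (v + w)) = gm.chain_class (u g v) \<otimes>\<^bsub>gm.TP\<^esub> gm.chain_class (u g w)"
    unfolding u_add by (intro gm.chain_class_add u_chains) (auto simp: carrier_bar_group)
next
  fix g h v assume "g \<in> carrier (bar_group \<Gamma>)" "h \<in> carrier (bar_group \<Gamma>)" and v: "v \<in> V"
  then have g: "g \<in> G" and h: "h \<in> G" by (auto simp: carrier_bar_group)
  have hv: "bar_act h v \<in> V" using v by (rule bar_act_homogeneous)
  define t where "t C = gm.pt (gm.gm1 (tau C h)) (bar_act (coset_rep (C \<triangleleft> h)) v)" for C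
  have t: "t C \<in> carrier gm.TP" if "C \<in> Q" for C
    unfolding t_def using that h v by (intro gm.pt_closed gm.gm1_closed tau_carrier bar_act_homogeneous)
  define s where "s C = gm.pt (gm.gm1 (tau C g)) (bar_act (coset_rep (C \<triangleleft> g)) (bar_act h v))" for C
  have s: "s C \<in> carrier gm.TP" if "C \<in> Q" for C
    unfolding s_def using that g by (intro gm.pt_closed gm.gm1_closed tau_carrier bar_act_homogeneous[OF hv])
  \<comment> \<open>\<open>tau_mult\<close> splits the term at \<open>C\<close>; its second part is
    the term of \<open>h\<close> at \<open>C \<triangleleft> g\<close>, and reindexing by this
    permutation of the cosets restores the full sum.\<close>
  have step: "gm.pt (gm.gm1 (tau C (g \<odot> h))) (bar_act (coset_rep (C \<triangleleft> (g \<odot> h))) v) = s C \<otimes>\<^bsub>gm.TP\<^esub> t (C \<triangleleft> g)"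
    if C: "C \<in> Q" for C
  proof -
    have C': "C \<triangleleft> g \<in> Q" using C g by (rule Q_act)
    let ?w = "bar_act (coset_rep (C \<triangleleft> g \<triangleleft> h)) v"
    have w: "?w \<in> V" using v by (rule bar_act_homogeneous)
    have rb: "coset_rep D \<in> range bar" if "D \<in> Q" for D using rep_bar[OF that] by blast
    have tb: "tau (C \<triangleleft> g) h \<in> range bar" using tau(1)[OF C' h] by blast
    have hb: "h \<in> range bar" using h by blast
    have "bar_act (tau (C \<triangleleft> g) h) ?w = bar_act (tau (C \<triangleleft> g) h \<odot> coset_rep (C \<triangleleft> g \<triangleleft> h)) v"
      using tb rb[OF Q_act[OF C' h]] v by (rule bar_act_bm[symmetric])
    also have "\<dots> = bar_act (coset_rep (C \<triangleleft> g) \<odot> h) v" by (simp only: tau(2)[OF C' h])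
    also have "\<dots> = bar_act (coset_rep (C \<triangleleft> g)) (bar_act h v)" using rb[OF C'] hb v by (rule bar_act_bm)
    finally have e: "bar_act (tau (C \<triangleleft> g) h) ?w = bar_act (coset_rep (C \<triangleleft> g)) (bar_act h v)" .
    have "gm.pt (gm.gm1 (tau C g \<odot> tau (C \<triangleleft> g) h)) ?w
       = gm.pt (gm.gm1 (tau C g)) (bar_act (tau (C \<triangleleft> g) h) ?w) \<otimes>\<^bsub>gm.TP\<^esub> gm.pt (gm.gm1 (tau (C \<triangleleft> g) h)) ?w"
      using gm.ptg_mult[OF tau_carrier[OF C g] tau_carrier[OF C' h] w] by (simp only: mult_bar_group_bm)
    then show ?thesis unfolding s_def t_def e Q_act_mult tau_mult[OF C g h] .
  qed
  have "gm.chain_class (u (g \<odot> h) v) = finprod gm.TP (\<lambda>C. s C \<otimes>\<^bsub>gm.TP\<^esub> t (C \<triangleleft> g)) Q"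
    unfolding chain_class_u[OF G_mult[OF g h] v]
    using s t Q_act[OF _ g] by (intro gm.TP.finprod_cong' refl step) auto
  also have "\<dots> = finprod gm.TP s Q \<otimes>\<^bsub>gm.TP\<^esub> finprod gm.TP (\<lambda>C. t (C \<triangleleft> g)) Q"
    using s t Q_act[OF _ g] by (intro gm.TP.finprod_multf) auto
  also have "finprod gm.TP (\<lambda>C. t (C \<triangleleft> g)) Q = finprod gm.TP t ((\<lambda>C. C \<triangleleft> g) ` Q)"
    using t Q_act[OF _ g] bij_betw_imp_inj_on[OF Q_act_bij[OF g]]
    by (intro gm.TP.finprod_reindex[symmetric]) auto
  also have "(\<lambda>C. C \<triangleleft> g) ` Q = Q" by (rule bij_betw_imp_surj_on[OF Q_act_bij[OF g]])
  also have "finprod gm.TP s Q = gm.chain_class (u g (bar_act h v))"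
    unfolding chain_class_u[OF g hv] s_def ..
  also have "finprod gm.TP t Q = gm.chain_class (u h v)"
    unfolding chain_class_u[OF h v] t_def ..
  finally show "gm.chain_class (u (g \<otimes>\<^bsub>bar_group \<Gamma>\<^esub> h) v)
      = gm.chain_class (u g (bar_act h v)) \<otimes>\<^bsub>gm.TP\<^esub> gm.chain_class (u h v)"
    by (simp only: mult_bar_group_bm)
qed

definition Utilde :: "(mat2 set \<Rightarrow>\<^sub>0 'r poly2) \<Rightarrow> (mat2 set \<Rightarrow>\<^sub>0 'r poly2)" where
  "Utilde x = (\<Sum>g\<in>Poly_Mapping.keys x. u g (Poly_Mapping.lookup x g))"

lemma chainsD:
  assumes "x \<in> gm.chains"
  shows "g \<in> Poly_Mapping.keys x \<Longrightarrow> g \<in> G" "Poly_Mapping.lookup x g \<in> V"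
  using assms by (auto simp: gm.chains_def carrier_bar_group)

lemma Utilde_chains: "x \<in> gm.chains \<Longrightarrow> Utilde x \<in> gm.chains"
  unfolding Utilde_def by (intro gm.chains_sum u_chains chainsD)

lemma Utilde_hom: "module_hom scl scl Utilde"
proof -
  have "Utilde (x + y) = Utilde x + Utilde y" for x y
    unfolding Utilde_def by (rule sum_keys_add[of u]) (simp_all add: u_add)
  moreover have "Utilde (scl r x) = scl r (Utilde x)" for r x
  proof -
    have "Utilde (scl r x) = (\<Sum>g\<in>Poly_Mapping.keys x. u g (Poly_Mapping.lookup (scl r x) g))"
      unfolding Utilde_def by (rule sum_keys_superset) (simp_all add: keys_scl)
    then show ?thesis by (simp add: Utilde_def u_scl scl_sum)
  qed
  ultimately show ?thesis
    by (intro module_hom.intro module_hom_axioms.intro module_scl)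
qed

lemma hecke_chain:
  assumes "x \<in> gm.chains"
  shows "hecke \<Gamma> \<alpha> \<Gamma> k (gm.chain_class x) = gm.chain_class (Utilde x)"
proof -
  have "hecke \<Gamma> \<alpha> \<Gamma> k (gm.chain_class x) = tensor_lift gm.TP hk.lin (gm.chain_class x)"
    unfolding hecke_def IV_TP
  proof (rule gm.tensor_lift_cong[OF gm.TP_comm_group])
    fix y v assume y: "y \<in> augmentation_ideal (bar_group \<Gamma>)" and v: "v \<in> V"
    then have k: "g \<in> G" if "g \<in> Poly_Mapping.keys y" for g
      using that by (auto simp: gm.augmentation_ideal_iff group_ring_def carrier_bar_group)
    show "hk.lin y v \<in> carrier gm.TP"
      using y v by (intro hk.lin_closed) (simp_all add: gm.augmentation_ideal_iff)
    show "finprod gm.TP (\<lambda>g. hecke_basic \<Gamma> \<alpha> \<Gamma> k g v [^]\<^bsub>gm.TP\<^esub> Poly_Mapping.lookup y g) (Poly_Mapping.keys y) = hk.lin y v"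
      unfolding hk.lin_def using k v
      by (intro gm.TP.finprod_cong' refl) (auto simp: hecke_basic_eq intro!: gm.chain_class_closed u_chains)
  qed (rule gm.chain_class_closed[OF assms])
  also have "\<dots> = finprod gm.TP (\<lambda>g. gm.chain_class (u g (Poly_Mapping.lookup x g))) (Poly_Mapping.keys x)"
    by (rule hk.lift_chain[OF assms])
  also have "\<dots> = gm.chain_class (Utilde x)"
    unfolding Utilde_def by (intro gm.chain_class_sum[symmetric] u_chains chainsD[OF assms])
  finally show ?thesis .
qed

lemma scl_chains: "x \<in> gm.chains \<Longrightarrow> scl r x \<in> gm.chains"
  using keys_scl[of r x] by (auto simp: gm.chains_def homogeneous_const2_mult)

lemma scalar_chain:
  assumes "x \<in> gm.chains"
  shows "scalar_mult \<Gamma> k r (gm.chain_class x) = gm.chain_class (scl r x)"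
proof -
  interpret sc: tensor_cocycle "bar_group \<Gamma>" bar_act V gm.TP "\<lambda>g v. gm.pt (gm.gm1 g) (const2 r * v)"
  proof (intro tensor_cocycle.intro tensor_cocycle_axioms.intro gm.group_ring_module_axioms gm.TP_comm_group)
    fix g h v assume "g \<in> carrier (bar_group \<Gamma>)" "h \<in> carrier (bar_group \<Gamma>)" "v \<in> V"
    then show "gm.pt (gm.gm1 (g \<otimes>\<^bsub>bar_group \<Gamma>\<^esub> h)) (const2 r * v)
      = gm.pt (gm.gm1 g) (const2 r * bar_act h v) \<otimes>\<^bsub>gm.TP\<^esub> gm.pt (gm.gm1 h) (const2 r * v)"
      unfolding bar_act_const2[symmetric] by (intro gm.ptg_mult homogeneous_const2_mult)
  next
    fix g v w assume "g \<in> carrier (bar_group \<Gamma>)" "v \<in> V" "w \<in> V"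
    then show "gm.pt (gm.gm1 g) (const2 r * (v + w))
      = gm.pt (gm.gm1 g) (const2 r * v) \<otimes>\<^bsub>gm.TP\<^esub> gm.pt (gm.gm1 g) (const2 r * w)"
      unfolding distrib_left by (intro gm.pt_add_right gm.gm1_closed homogeneous_const2_mult)
  qed (auto intro!: gm.pt_closed gm.gm1_closed homogeneous_const2_mult)
  have "scalar_mult \<Gamma> k r (gm.chain_class x) = tensor_lift gm.TP sc.lin (gm.chain_class x)"
    unfolding scalar_mult_def IV_TP pure_tensor_pt
  proof (rule gm.tensor_lift_cong[OF gm.TP_comm_group])
    fix y v assume y: "y \<in> augmentation_ideal (bar_group \<Gamma>)" and v: "v \<in> V"
    show "sc.lin y v \<in> carrier gm.TP"
      using y v by (intro sc.lin_closed) (simp_all add: gm.augmentation_ideal_iff)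
    show "gm.pt y (const2 r * v) = sc.lin y v"
      unfolding sc.lin_def by (rule gm.pt_expand[OF y homogeneous_const2_mult[OF v]])
  qed (rule gm.chain_class_closed[OF assms])
  also have "\<dots> = finprod gm.TP (\<lambda>g. gm.pt (gm.gm1 g) (Poly_Mapping.lookup (scl r x) g)) (Poly_Mapping.keys x)"
    by (simp only: sc.lift_chain[OF assms] lookup_scl)
  also have "\<dots> = gm.chain_class (scl r x)"
    unfolding gm.chain_class_def
  proof (rule gm.TP.finprod_keys_superset[symmetric, where \<phi> = "\<lambda>g. gm.pt (gm.gm1 g)"])
    fix g assume "g \<in> Poly_Mapping.keys x"
    then have g: "g \<in> carrier (bar_group \<Gamma>)" using chainsD(1)[OF assms] by (simp add: carrier_bar_group)
    show "gm.pt (gm.gm1 g) 0 = \<one>\<^bsub>gm.TP\<^esub>" by (rule gm.pt_zero_right[OF gm.gm1_closed[OF g]])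
    show "gm.pt (gm.gm1 g) (Poly_Mapping.lookup (scl r x) g) \<in> carrier gm.TP"
      using g chainsD(2)[OF scl_chains[OF assms]] by (intro gm.pt_closed gm.gm1_closed)
  qed (simp_all add: keys_scl)
  finally show ?thesis .
qed

definition bd :: "(mat2 set \<Rightarrow>\<^sub>0 'r poly2) \<Rightarrow> 'r poly2" where
  "bd x = (\<Sum>g\<in>Poly_Mapping.keys x. bar_act g (Poly_Mapping.lookup x g) - Poly_Mapping.lookup x g)"

lemma bd_add: "bd (x + y) = bd x + bd y"
  unfolding bd_def
  by (rule sum_keys_add[of "\<lambda>g v. bar_act g v - v"]) (simp_all add: bar_act_add)

lemma bd_scl: "bd (scl r x) = const2 r * bd x"
proof -
  have "bd (scl r x) = (\<Sum>g\<in>Poly_Mapping.keys x. bar_act g (Poly_Mapping.lookup (scl r x) g) - Poly_Mapping.lookup (scl r x) g)"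
    unfolding bd_def by (rule sum_keys_superset[of _ _ "\<lambda>g v. bar_act g v - v"]) (simp_all add: keys_scl)
  then show ?thesis by (simp add: bd_def bar_act_const2 right_diff_distrib sum_distrib_left)
qed

lemma bd_single: "bd (Poly_Mapping.single g v) = bar_act g v - v"
  by (simp add: bd_def)

lemma bd_zero [simp]: "bd 0 = 0"
  by (simp add: bd_def)

lemma comm_group_V: "comm_group (additive_group V)"
  by (intro comm_group_additive homogeneous_zero homogeneous_add homogeneous_uminus)

lemma H1_iff:
  assumes "x \<in> gm.chains"
  shows "gm.chain_class x \<in> H1 \<Gamma> k \<longleftrightarrow> bd x = 0"
proof -
  let ?A = "additive_group V"
  have cV: "carrier ?A = V" and oneV: "\<one>\<^bsub>?A\<^esub> = 0" by (simp_all add: additive_group_def)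
  interpret bo: tensor_cocycle "bar_group \<Gamma>" bar_act V ?A "\<lambda>g v. bar_act g v - v"
  proof (intro tensor_cocycle.intro tensor_cocycle_axioms.intro gm.group_ring_module_axioms comm_group_V)
    fix g v assume "g \<in> carrier (bar_group \<Gamma>)" "v \<in> V"
    then show "bar_act g v - v \<in> carrier ?A" unfolding cV by (intro homogeneous_diff bar_act_homogeneous)
  next
    fix g h v assume "g \<in> carrier (bar_group \<Gamma>)" "h \<in> carrier (bar_group \<Gamma>)" "v \<in> V"
    then show "bar_act (g \<otimes>\<^bsub>bar_group \<Gamma>\<^esub> h) v - v
      = (bar_act g (bar_act h v) - bar_act h v) \<otimes>\<^bsub>?A\<^esub> (bar_act h v - v)"
      by (simp only: gm.act_mult) (simp add: additive_group_def)
  qed (simp add: additive_group_def bar_act_add)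
  have "tensor_lift ?A (group_ring_act bar_act) (gm.chain_class x) = tensor_lift ?A bo.lin (gm.chain_class x)"
  proof (rule gm.tensor_lift_cong[OF comm_group_V])
    fix y and v :: "'r poly2"
    assume y: "y \<in> augmentation_ideal (bar_group \<Gamma>)" and v: "v \<in> V"
    show "bo.lin y v \<in> carrier ?A"
      using y v by (intro bo.lin_closed) (simp_all add: gm.augmentation_ideal_iff)
    have d: "bar_act g v - v \<in> V" for g using v by (intro homogeneous_diff bar_act_homogeneous)
    have "bo.lin y v = (\<Sum>g\<in>Poly_Mapping.keys y. of_int (Poly_Mapping.lookup y g) * (bar_act g v - v))"
      unfolding bo.lin_def int_pow_additive[OF comm_group_V d]
      by (intro finprod_additive comm_group_V homogeneous_of_int_mult d)
    also have "\<dots> = group_ring_act bar_act y v - of_int (aug y) * v"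
      by (simp add: group_ring_act_def aug_def right_diff_distrib sum_subtractf sum_distrib_right)
    \<comment> \<open>This removes the subtracted copy of \<open>v\<close>, so the boundary may be
      computed as \<open>g v - v\<close> on each \<open>(g - 1) \<otimes> v\<close>.\<close>
    also have "aug y = 0" using y by (simp add: gm.augmentation_ideal_iff)
    finally show "group_ring_act bar_act y v = bo.lin y v" by simp
  qed (rule gm.chain_class_closed[OF assms])
  also have "\<dots> = bd x"
    unfolding bo.lift_chain[OF assms] bd_def
    by (intro finprod_additive comm_group_V homogeneous_diff bar_act_homogeneous chainsD(2)[OF assms])
  finally have "tensor_lift ?A (group_ring_act bar_act) (gm.chain_class x) = bd x" .
  then show ?thesis
    unfolding H1_def kernel_def IV_TP using gm.chain_class_closed[OF assms] by (simp add: oneV)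
qed

end

section \<open>Reduction modulo \<open>p\<close>\<close>

lemma single_sum: "Poly_Mapping.single g (\<Sum>i\<in>I. f i) = (\<Sum>i\<in>I. Poly_Mapping.single g (f i))"
  by (induction I rule: infinite_finite_induct) (simp_all add: single_add)

lemma sum_singles: "x = (\<Sum>g\<in>Poly_Mapping.keys x. Poly_Mapping.single g (Poly_Mapping.lookup x g))"
  by (rule poly_mapping_eqI) (simp add: lookup_sum lookup_single when_def in_keys_iff)

lemma comm_ring_hom_map_poly:
  fixes h :: "'a :: comm_ring_1 \<Rightarrow> 'b :: comm_ring_1"
  assumes "comm_ring_hom h"
  shows "comm_ring_hom (map_poly h)"
proof -
  interpret h: map_poly_comm_ring_hom h by (intro map_poly_comm_ring_hom.intro assms)
  show ?thesis by unfold_locales (simp_all add: h.hom_add h.hom_mult)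
qed

locale hecke_padic = hecke_module \<Gamma> M p k ty for \<Gamma> M p k and ty :: "'p :: prime_card padic_int itself" +
  fixes N :: nat
  assumes card_p: "CARD('p) = p" and N: "N > 0" and Gamma1: "Gamma1 N \<subseteq> \<Gamma>"
begin

sublocale pm: padic_module "scl :: 'p padic_int \<Rightarrow> _"
  by (intro padic_module.intro module_scl)

lemma prime_p: "prime p"
  using CARD_prime[where 'p = 'p] card_p by simp

lemma prime_int_p: "prime (int p)"
  using prime_p by simp

text \<open>These are the relations among chains, so that homology appears as \<open>Zc\<close>
  modulo \<open>B\<close> without a quotient being formed.\<close>

definition B :: "(mat2 set \<Rightarrow>\<^sub>0 'p padic_int poly2) set" where
  "B = {x \<in> gm.chains. gm.chain_class x = \<one>\<^bsub>gm.TP\<^esub>}"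

definition Zc :: "(mat2 set \<Rightarrow>\<^sub>0 'p padic_int poly2) set" where
  "Zc = {x \<in> gm.chains. bd x = 0}"

definition Y :: "(mat2 set \<Rightarrow>\<^sub>0 'p padic_int poly2) set" where
  "Y = (\<lambda>g. Poly_Mapping.single g (base_change (Q_form g ^ k))) ` hyperbolic_elements \<Gamma>"

lemma subspace_chains: "pm.subspace gm.chains"
  by (intro pm.subspaceI gm.chains_zero gm.chains_add scl_chains)

lemma chain_class_eq_iff:
  assumes "x \<in> gm.chains" "y \<in> gm.chains"
  shows "gm.chain_class x = gm.chain_class y \<longleftrightarrow> x - y \<in> B"
proof -
  have "gm.chain_class (x - y) = gm.chain_class x \<otimes>\<^bsub>gm.TP\<^esub> inv\<^bsub>gm.TP\<^esub> gm.chain_class y"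
    using assms by (rule gm.chain_class_diff)
  moreover have "gm.chain_class x \<otimes>\<^bsub>gm.TP\<^esub> inv\<^bsub>gm.TP\<^esub> gm.chain_class y = \<one>\<^bsub>gm.TP\<^esub>
      \<longleftrightarrow> gm.chain_class x = gm.chain_class y"
    using gm.chain_class_closed[OF assms(1)] gm.chain_class_closed[OF assms(2)]
      gm.TP.inv_solve_right'[of "\<one>\<^bsub>gm.TP\<^esub>" "gm.chain_class x" "gm.chain_class y"] by auto
  ultimately show ?thesis using gm.chains_diff[OF assms] by (simp add: B_def)
qed

lemma subspace_B: "pm.subspace B"
proof (rule pm.subspaceI)
  show "0 \<in> B" by (simp add: B_def gm.chains_zero gm.chain_class_zero)
next
  fix x y assume "x \<in> B" "y \<in> B"
  then show "x + y \<in> B" by (auto simp: B_def gm.chains_add gm.chain_class_add)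
next
  fix r x assume x: "x \<in> B"
  then have xc: "x \<in> gm.chains" and "gm.chain_class x = gm.chain_class 0" by (simp_all add: B_def gm.chain_class_zero)
  then have "gm.chain_class (scl r x) = gm.chain_class (scl r 0)"
    by (simp only: scalar_chain[OF xc, symmetric] scalar_chain[OF gm.chains_zero, symmetric])
  then show "scl r x \<in> B" using scl_chains[OF xc] by (simp add: B_def gm.chain_class_zero)
qed

lemma subspace_Zc: "pm.subspace Zc"
  unfolding Zc_def
  by (rule pm.subspaceI) (auto simp: gm.chains_zero gm.chains_add scl_chains bd_add bd_scl)

lemma Zc_iff_H1: "x \<in> gm.chains \<Longrightarrow> x \<in> Zc \<longleftrightarrow> gm.chain_class x \<in> H1 \<Gamma> k"
  by (simp add: Zc_def H1_iff)

lemma B_subset_Zc: "B \<subseteq> Zc"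
proof
  fix x assume "x \<in> B"
  then have x: "x \<in> gm.chains" "gm.chain_class x = gm.chain_class 0" by (auto simp: B_def gm.chain_class_zero)
  have "0 \<in> Zc" by (simp add: Zc_def gm.chains_zero)
  then show "x \<in> Zc" using Zc_iff_H1[OF x(1)] Zc_iff_H1[OF gm.chains_zero] x(2) by simp
qed

lemma Utilde_zero: "Utilde 0 = 0"
  by (simp add: Utilde_def)

lemma Utilde_B: "x \<in> B \<Longrightarrow> Utilde x \<in> B"
proof -
  assume "x \<in> B"
  then have x: "x \<in> gm.chains" "gm.chain_class x = gm.chain_class 0" by (auto simp: B_def gm.chain_class_zero)
  have "gm.chain_class (Utilde x) = gm.chain_class (Utilde 0)"
    by (simp only: hecke_chain[OF x(1), symmetric] hecke_chain[OF gm.chains_zero, symmetric] x(2))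
  then show ?thesis using Utilde_chains[OF x(1)] by (simp add: B_def Utilde_zero gm.chain_class_zero)
qed

lemma range_bar: "g \<in> G \<Longrightarrow> g \<in> range bar" "C \<in> Q \<Longrightarrow> coset_rep C \<in> range bar"
  using rep_bar by blast+

text \<open>The chain map property: each transfer relation carries the action of \<open>g\<close>
  past a representative, and the sum with \<open>C \<triangleleft> g\<close> in place of
  \<open>C\<close> is the same sum permuted.\<close>

lemma bd_u:
  assumes "g \<in> G" "v \<in> V"
  shows "bd (u g v) = (\<Sum>C\<in>Q. bar_act (coset_rep C) (bar_act g v)) - (\<Sum>C\<in>Q. bar_act (coset_rep C) v)"
proof -
  have bd_sum: "bd (\<Sum>C\<in>I. f C) = (\<Sum>C\<in>I. bd (f C))" for f :: "mat2 set set \<Rightarrow> _" and I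
    by (induction I rule: infinite_finite_induct) (simp_all add: bd_add)
  have "bar_act (tau C g) (bar_act (coset_rep (C \<triangleleft> g)) v) = bar_act (coset_rep C) (bar_act g v)" if C: "C \<in> Q" for C
  proof -
    have "bar_act (tau C g) (bar_act (coset_rep (C \<triangleleft> g)) v) = bar_act (tau C g \<odot> coset_rep (C \<triangleleft> g)) v"
      using range_bar(1)[OF tau(1)[OF C assms(1)]] range_bar(2)[OF Q_act[OF C assms(1)]] assms(2)
      by (rule bar_act_bm[symmetric])
    also have "\<dots> = bar_act (coset_rep C \<odot> g) v" by (simp only: tau(2)[OF C assms(1)])
    also have "\<dots> = bar_act (coset_rep C) (bar_act g v)"
      using range_bar(2)[OF C] range_bar(1)[OF assms(1)] assms(2) by (rule bar_act_bm)
    finally show ?thesis .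
  qed
  then have "bd (u g v) = (\<Sum>C\<in>Q. bar_act (coset_rep C) (bar_act g v)) - (\<Sum>C\<in>Q. bar_act (coset_rep (C \<triangleleft> g)) v)"
    by (simp add: u_def bd_sum bd_single sum_subtractf)
  also have "(\<Sum>C\<in>Q. bar_act (coset_rep (C \<triangleleft> g)) v) = (\<Sum>C\<in>Q. bar_act (coset_rep C) v)"
    by (rule sum.reindex_bij_betw[OF Q_act_bij[OF assms(1)]])
  finally show ?thesis .
qed

lemma bar_act_sum: "bar_act g (\<Sum>i\<in>I. f i) = (\<Sum>i\<in>I. bar_act g (f i))"
  by (simp add: bar_act_def mat_act.hom_sum)

lemma bar_act_diff: "bar_act g (v - w) = bar_act g v - bar_act g w"
  by (simp add: bar_act_def mat_act.hom_minus)

lemma Utilde_Zc: "x \<in> Zc \<Longrightarrow> Utilde x \<in> Zc"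
proof -
  assume "x \<in> Zc"
  then have x: "x \<in> gm.chains" "bd x = 0" by (auto simp: Zc_def)
  have bd_sum: "bd (\<Sum>g\<in>I. f g) = (\<Sum>g\<in>I. bd (f g))" for f :: "mat2 set \<Rightarrow> _" and I
    by (induction I rule: infinite_finite_induct) (simp_all add: bd_add)
  have "bd (Utilde x) = (\<Sum>g\<in>Poly_Mapping.keys x. \<Sum>C\<in>Q.
      bar_act (coset_rep C) (bar_act g (Poly_Mapping.lookup x g) - Poly_Mapping.lookup x g))"
    unfolding Utilde_def bd_sum
    by (intro sum.cong refl) (simp add: bd_u chainsD[OF x(1)] bar_act_diff sum_subtractf)
  also have "\<dots> = (\<Sum>C\<in>Q. bar_act (coset_rep C) (bd x))"
    unfolding bd_def bar_act_sum by (rule sum.swap)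
  finally show ?thesis using x Utilde_chains[OF x(1)] by (simp add: Zc_def)
qed

abbreviation sg :: "mat2 set \<Rightarrow> 'p padic_int poly2 \<Rightarrow> (mat2 set \<Rightarrow>\<^sub>0 'p padic_int poly2)" where
  "sg \<equiv> Poly_Mapping.single"

lemma sg_chains: "g \<in> G \<Longrightarrow> v \<in> V \<Longrightarrow> sg g v \<in> gm.chains"
  by (intro gm.chains_single) (simp_all add: carrier_bar_group)

lemma sg_mult:
  assumes "g \<in> G" "h \<in> G" "v \<in> V"
  shows "sg (g \<odot> h) v - (sg g (bar_act h v) + sg h v) \<in> B"
proof -
  have gh: "g \<odot> h \<in> G" using assms G_mult by blast
  have hv: "bar_act h v \<in> V" using assms(3) by (rule bar_act_homogeneous)
  have c: "g \<in> carrier (bar_group \<Gamma>)" "h \<in> carrier (bar_group \<Gamma>)" "g \<odot> h \<in> carrier (bar_group \<Gamma>)"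
    using assms gh by (simp_all add: carrier_bar_group)
  have "gm.chain_class (sg (g \<odot> h) v) = gm.chain_class (sg g (bar_act h v)) \<otimes>\<^bsub>gm.TP\<^esub> gm.chain_class (sg h v)"
    using gm.ptg_mult[OF c(1,2) assms(3)] assms(3) hv c by (simp only: gm.chain_class_single mult_bar_group_bm)
  also have "\<dots> = gm.chain_class (sg g (bar_act h v) + sg h v)"
    using assms hv by (intro gm.chain_class_add[symmetric] sg_chains)
  finally show ?thesis
    using assms gh hv by (subst chain_class_eq_iff[symmetric]) (auto intro!: gm.chains_add sg_chains)
qed

text \<open>\<open>sg_mult\<close> splits a word into its letters at the cost of acting on the
  coefficient, which is then expanded in the finitely many monomials of degree
  \<open>2 k\<close>.\<close>

lemma chains_finitely_generated: "\<exists>S. finite S \<and> gm.chains \<subseteq> pm.span (S \<union> B)"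
proof -
  obtain E where E: "finite E" "E \<subseteq> \<Gamma>" "\<Gamma> \<subseteq> mgen E"
    using Gamma_principal_finitely_generated[OF subgroup M] by blast
  define S where "S = (\<lambda>(e, i). sg (bar e) (X1 ^ i * X2 ^ (2 * k - i))) ` (E \<times> {..2 * k})"
  let ?W = "pm.span (S \<union> B)"
  have "A \<in> \<Gamma> \<and> (\<forall>v \<in> V. sg (bar A) v \<in> ?W)" if "A \<in> mgen E" for A
    using that
  proof (induction rule: mgen.induct)
    case one
    have "sg (bar (mat 1)) v \<in> ?W" if v: "v \<in> V" for v
    proof -
      have g: "bar (mat 1) \<in> G" using \<Gamma>_one by blast
      have e: "bar (mat 1) \<odot> bar (mat 1) = bar (mat 1)" by (simp add: bar_bm)
      \<comment> \<open>The relation \<open>1 1 = 1\<close> forces the class at the unit to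
        vanish.\<close>
      have "sg (bar (mat 1)) v - (sg (bar (mat 1)) v + sg (bar (mat 1)) v) \<in> B"
        using sg_mult[OF g g v] v by (simp only: e bar_act_bar[OF v] mat_act_one[OF v])
      then have "- sg (bar (mat 1)) v \<in> ?W" by (simp add: pm.span_base)
      then show ?thesis using pm.span_neg by fastforce
    qed
    then show ?case using \<Gamma>_one by blast
  next
    case (mult e w)
    have eG: "e \<in> \<Gamma>" using E mult by blast
    have "sg (bar (e ** w)) v \<in> ?W" if v: "v \<in> V" for v
    proof -
      have wv: "bar_act (bar w) v \<in> V" using v by (rule bar_act_homogeneous)
      have 1: "sg (bar e \<odot> bar w) v - (sg (bar e) (bar_act (bar w) v) + sg (bar w) v) \<in> ?W"
        using sg_mult[of "bar e" "bar w" v] eG mult.IH v by (intro pm.span_base) auto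
      have "sg (bar e) (bar_act (bar w) v)
         = (\<Sum>i\<le>2 * k. scl (coeff (coeff (bar_act (bar w) v) i) (2 * k - i)) (sg (bar e) (X1 ^ i * X2 ^ (2 * k - i))))"
        by (subst homogeneous_expand[OF wv]) (simp add: single_sum)
      also have "\<dots> \<in> ?W"
        using mult.hyps by (intro pm.span_sum pm.span_scale pm.span_base) (auto simp: S_def)
      finally have "sg (bar e) (bar_act (bar w) v) + sg (bar w) v \<in> ?W"
        using mult.IH v by (intro pm.span_add) auto
      from pm.span_add[OF 1 this] show ?thesis by (simp add: bar_bm)
    qed
    then show ?case using \<Gamma>_mult[OF eG] mult.IH by blast
  qed
  then have sg: "sg g v \<in> ?W" if "g \<in> G" "v \<in> V" for g v using that E(3) by blast
  have "x \<in> ?W" if x: "x \<in> gm.chains" for x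
  proof -
    have "x = (\<Sum>g\<in>Poly_Mapping.keys x. sg g (Poly_Mapping.lookup x g))"
      by (rule sum_singles)
    also have "\<dots> \<in> ?W" using chainsD[OF x] by (intro pm.span_sum sg)
    finally show ?thesis .
  qed
  moreover have "finite S" using E by (simp add: S_def)
  ultimately show ?thesis by blast
qed

text \<open>The target for \<open>Utilde z\<close>. It contains p times all chains and not just p
  times cycles, so that the terms of a cycle can be treated separately;
  \<open>main_congruence\<close> returns to cycles.\<close>

definition L :: "(mat2 set \<Rightarrow>\<^sub>0 'p padic_int poly2) set" where
  "L = pm.span (Y \<union> (B \<union> scl pm.\<pi> ` gm.chains))"

lemma L_add: "x \<in> L \<Longrightarrow> y \<in> L \<Longrightarrow> x + y \<in> L" and L_diff: "x \<in> L \<Longrightarrow> y \<in> L \<Longrightarrow> x - y \<in> L"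
  and L_scl: "x \<in> L \<Longrightarrow> scl r x \<in> L" and L_zero: "0 \<in> L"
  unfolding L_def by (auto intro: pm.span_add pm.span_diff pm.span_scale pm.span_zero)

lemma L_subspace: "pm.subspace L"
  by (simp add: L_def)

lemma L_sum: "(\<And>i. i \<in> I \<Longrightarrow> f i \<in> L) \<Longrightarrow> (\<Sum>i\<in>I. f i) \<in> L"
  by (rule pm.subspace_sum[OF L_subspace])

lemma L_cancel: "x - y \<in> L \<Longrightarrow> y \<in> L \<Longrightarrow> x \<in> L"
  using L_add[of "x - y" y] by simp

lemma L_cancel': "x - y \<in> L \<Longrightarrow> x \<in> L \<Longrightarrow> y \<in> L"
  using L_diff[of x "x - y"] by simp

lemma B_subset_L: "x \<in> B \<Longrightarrow> x \<in> L"
  unfolding L_def by (rule pm.span_base) simp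

lemma L_pi: "x \<in> gm.chains \<Longrightarrow> scl pm.\<pi> x \<in> L"
  unfolding L_def by (rule pm.span_base) simp

lemma L_Y: "x \<in> Y \<Longrightarrow> x \<in> L"
  unfolding L_def by (rule pm.span_base) simp

lemma L_hcong:
  assumes "g \<in> G" "hcong pm.\<pi> (2 * k) v w"
  shows "sg g v - sg g w \<in> L"
proof -
  obtain W where W: "W \<in> V" "v - w = const2 pm.\<pi> * W" using assms(2) unfolding hcong_def by blast
  have "sg g v - sg g w = scl pm.\<pi> (sg g W)" by (simp add: single_diff[symmetric] W)
  then show ?thesis using L_pi[OF sg_chains[OF assms(1) W(1)]] by simp
qed

lemma L_int_cong:
  assumes "x \<in> gm.chains" "int p dvd n - m"
  shows "scl (of_int n) x - scl (of_int m) x \<in> L"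
proof -
  obtain j where "n - m = int p * j" using assms(2) by blast
  then have "n = m + int p * j" by simp
  then have "(of_int n :: 'p padic_int) = of_int m + pm.\<pi> * of_int j" by (simp add: card_p)
  then have "scl (of_int n) x - scl (of_int m) x = scl pm.\<pi> (scl (of_int j) x)"
    by (simp add: pm.scale_left_distrib)
  then show ?thesis using L_pi[OF scl_chains[OF assms(1)]] by simp
qed

text \<open>An integer prime to p has an inverse modulo p, and p times any chain lies in
  \<open>L\<close>.\<close>

lemma L_unit:
  assumes "x \<in> gm.chains" "\<not> int p dvd n" "scl (of_int n) x \<in> L"
  shows "x \<in> L"
proof -
  obtain b y where b: "of_int n * of_int b = (1 :: 'p padic_int) - pm.\<pi> * of_int y"
    using padic_unit_of_int[where 'p = 'p, of n] assms(2) card_p by auto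
  have "scl (of_int b) (scl (of_int n) x) = scl (of_int n * of_int b) x" by (simp add: mult.commute)
  also have "\<dots> = x - scl pm.\<pi> (scl (of_int y) x)" unfolding b by (simp add: pm.scale_left_diff_distrib)
  finally have "x - scl pm.\<pi> (scl (of_int y) x) \<in> L" using L_scl[OF assms(3), of "of_int b"] by simp
  then show ?thesis using L_pi[OF scl_chains[OF assms(1)]] by (rule L_cancel)
qed

section \<open>The crossed homomorphism \<open>F\<close> modulo \<open>L\<close>\<close>

abbreviation X :: "'p padic_int poly2" where "X \<equiv> X2 ^ (2 * k)"

lemma X_V: "X \<in> V"
  by (intro homogeneous_power1 homogeneous_X2)

definition F :: "mat2 \<Rightarrow> (mat2 set \<Rightarrow>\<^sub>0 'p padic_int poly2)" where
  "F A = sg (bar A) X"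

lemma F_chains: "A \<in> \<Gamma> \<Longrightarrow> F A \<in> gm.chains"
  unfolding F_def by (intro sg_chains X_V) auto

abbreviation chi :: "mat2 \<Rightarrow> int" where "chi A \<equiv> (A $ 1 $ 1) ^ (2 * k)"

text \<open>\<open>X2\<close> goes to \<open>- c X1 + a X2\<close>, and p divides
  \<open>c\<close>.\<close>

lemma hcong_chi:
  assumes "int p dvd A $ 2 $ 1"
  shows "hcong pm.\<pi> (2 * k) (mat_act A X) (const2 (of_int (chi A)) * X)"
proof -
  obtain c where c: "A $ 2 $ 1 = int p * c" using assms by blast
  let ?P = "- of_int (A $ 2 $ 1) * X1 + of_int (A $ 1 $ 1) * X2 :: 'p padic_int poly2"
  let ?Q = "of_int (A $ 1 $ 1) * X2 :: 'p padic_int poly2"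
  have Q: "?Q \<in> homogeneous 1" by (intro homogeneous_of_int_mult homogeneous_X2)
  have P: "?P \<in> homogeneous 1"
    using mat_act_homogeneous[OF homogeneous_X2, of A] by (simp only: mat_act_X2)
  have "?P - ?Q = const2 pm.\<pi> * (of_int (- c) * X1)"
    by (simp add: c card_p of_nat_const2[symmetric])
  then have "hcong pm.\<pi> 1 ?P ?Q"
    unfolding hcong_def by (intro bexI[of _ "of_int (- c) * X1"] homogeneous_of_int_mult homogeneous_X1)
  from hcong_power[OF this P Q, of "2 * k"]
  have "hcong pm.\<pi> (2 * k) (?P ^ (2 * k)) (?Q ^ (2 * k))" by simp
  moreover have "?Q ^ (2 * k) = of_int (chi A) * X" by (simp only: power_mult_distrib of_int_power[symmetric])
  ultimately have "hcong pm.\<pi> (2 * k) (mat_act A X) (of_int (chi A) * X)"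
    by (simp only: mat_act.hom_power mat_act_X2)
  then show ?thesis by (simp only: of_int_const2[of "chi A"])
qed

text \<open>Modulo \<open>L\<close>, \<open>F\<close> is a crossed homomorphism for the character
  \<open>chi\<close>. The divisibility condition falls on the right factor because that factor acts
  on the coefficient.\<close>

lemma F_mult:
  assumes "A \<in> \<Gamma>" "D \<in> \<Gamma>" "int p dvd D $ 2 $ 1"
  shows "F (A ** D) - (scl (of_int (chi D)) (F A) + F D) \<in> L"
proof -
  have G: "bar A \<in> G" "bar D \<in> G" using assms by auto
  have 1: "F (A ** D) - (sg (bar A) (mat_act D X) + F D) \<in> L"
    using B_subset_L[OF sg_mult[OF G X_V]] by (simp only: F_def bar_bm bar_act_bar[OF X_V])
  have 2: "sg (bar A) (mat_act D X) - scl (of_int (chi D)) (F A) \<in> L"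
    using L_hcong[OF G(1) hcong_chi[OF assms(3)]] by (simp only: F_def scl_single)
  from L_add[OF 1 2] show ?thesis by (simp add: algebra_simps)
qed

text \<open>Modulo p these matrices are a scalar times an upper unipotent one. On them
  \<open>chi\<close> is trivial, and the form \<open>c X1^2 - (a - d) X1 X2 - b X2^2\<close> reduces
  to a multiple of \<open>X2^2\<close>.\<close>

definition Ksub :: "mat2 set" where
  "Ksub = {A \<in> \<Gamma>. int p dvd A $ 2 $ 1 \<and> int p dvd A $ 1 $ 1 - A $ 2 $ 2}"

text \<open>Modulo p, \<open>a d = 1\<close> and \<open>a = d\<close>, so \<open>a^2 = 1\<close>,
  and the exponent \<open>2 k\<close> is even.\<close>

lemma chi_Ksub: "A \<in> Ksub \<Longrightarrow> int p dvd chi A - 1"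
proof -
  assume A: "A \<in> Ksub"
  obtain a b c d where e: "A = mat2 a b c d" by (rule mat2_exhaust)
  have det: "a * d - b * c = 1" and p: "int p dvd c" "int p dvd a - d"
    using A \<Gamma>_det[of A] by (auto simp: Ksub_def e)
  have "a ^ 2 - 1 = a * (a - d) + b * c" using det by (simp add: algebra_simps power2_eq_square)
  then have "int p dvd a ^ 2 - 1" using p by simp
  then have "[a ^ 2 = 1] (mod int p)" by (simp add: cong_iff_dvd_diff)
  then have "[(a ^ 2) ^ k = 1 ^ k] (mod int p)" by (rule cong_pow)
  then show ?thesis by (simp add: e cong_iff_dvd_diff power_mult)
qed

lemma F_mult_Ksub:
  assumes "A \<in> \<Gamma>" "D \<in> Ksub"
  shows "F (A ** D) - (F A + F D) \<in> L"
proof -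
  have D: "D \<in> \<Gamma>" "int p dvd D $ 2 $ 1" using assms by (auto simp: Ksub_def)
  have "scl (of_int (chi D)) (F A) - scl (of_int 1) (F A) \<in> L"
    using F_chains[OF assms(1)] chi_Ksub[OF assms(2)] by (rule L_int_cong)
  from L_add[OF this F_mult[OF assms(1) D]] show ?thesis by (simp add: algebra_simps)
qed

section \<open>Hyperbolic cycles and their quadratic forms\<close>

lemma comm_ring_hom_base_change: "comm_ring_hom (base_change :: int poly2 \<Rightarrow> 'p padic_int poly2)"
proof -
  have h: "comm_ring_hom (of_int :: int \<Rightarrow> 'p padic_int)" by unfold_locales simp_all
  show ?thesis unfolding base_change_def by (intro comm_ring_hom_map_poly h)
qed

sublocale bc: comm_ring_hom "base_change :: int poly2 \<Rightarrow> 'p padic_int poly2"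
  by (rule comm_ring_hom_base_change)

lemma base_change_simps:
  "(base_change (const2 n) :: 'p padic_int poly2) = of_int n"
  "(base_change X1 :: 'p padic_int poly2) = X1" "(base_change X2 :: 'p padic_int poly2) = X2"
proof -
  have "(base_change (of_int n) :: 'p padic_int poly2) = of_int n" by (rule bc.hom_of_int)
  then show "(base_change (const2 n) :: 'p padic_int poly2) = of_int n" by (simp add: of_int_const2)
  show "(base_change X1 :: 'p padic_int poly2) = X1" by (simp add: base_change_def X1_def map_poly_pCons)
  show "(base_change X2 :: 'p padic_int poly2) = X2" by (simp add: base_change_def X2_def map_poly_pCons)
qed

text \<open>The integers \<open>c1, t1, b1\<close> are the coefficients of the primitive form attached to
  \<open>g\<close>.\<close>

lemma Q_form_shape:
  assumes "g \<in> hyperbolic_elements \<Gamma>"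
  obtains a b c d e c1 t1 b1 s where
    "g = bar (mat2 a b c d)" "mat2 a b c d = mat_of g" "a * d - b * c = 1"
    "c = e * c1" "a - d = e * t1" "b = e * b1" "s = 1 \<or> s = - 1" "\<bar>a + d\<bar> > 2"
    "(base_change (Q_form g) :: 'p padic_int poly2)
       = - of_int s * (of_int c1 * X1 ^ 2 - of_int t1 * (X1 * X2) - of_int b1 * X2 ^ 2)"
proof -
  obtain a b c d where m: "mat_of g = mat2 a b c d" by (rule mat2_exhaust)
  obtain A where A: "A \<in> \<Gamma>" "g = bar A" "hyperbolic g" using assms by (auto simp: hyperbolic_elements_def)
  have "det (mat_of g) = 1" using mat_of_bar[of A] \<Gamma>_det[OF A(1)] A(2) by auto
  then have det: "a * d - b * c = 1" by (simp add: m)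
  have tr: "\<bar>a + d\<bar> > 2" using A(3) by (simp add: hyperbolic_def m)
  define e where "e = gcd c (gcd (a - d) b)"
  have dv: "e dvd c" "e dvd a - d" "e dvd b" unfolding e_def by (auto intro: gcd_dvd1 gcd_dvd2 dvd_trans[OF gcd_dvd2])
  show ?thesis
  proof (rule that[of a b c d e "c div e" "(a - d) div e" "b div e" "sgn (a + d)"])
    show "g = bar (mat2 a b c d)" using bar_mat_of[of A] by (simp add: A(2)[symmetric] m)
    show "sgn (a + d) = 1 \<or> sgn (a + d) = - 1" using tr by (auto simp: sgn_if)
    show "(base_change (Q_form g) :: 'p padic_int poly2) = - of_int (sgn (a + d)) *
      (of_int (c div e) * X1 ^ 2 - of_int ((a - d) div e) * (X1 * X2) - of_int (b div e) * X2 ^ 2)"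
      unfolding Q_form_def Let_def m mat2_nth e_def[symmetric]
      by (simp only: bc.hom_mult bc.hom_minus bc.hom_uminus bc.hom_power base_change_simps mult.assoc)
  qed (use det tr dv in \<open>simp_all add: m\<close>)
qed

lemma homogeneous_form:
  "- of_int s * (of_int c1 * X1 ^ 2 - of_int t1 * (X1 * X2) - of_int b1 * X2 ^ 2) \<in> (homogeneous 2 :: 'p padic_int poly2 set)"
proof -
  have "X1 * X2 \<in> (homogeneous (1 + 1) :: 'p padic_int poly2 set)" by (intro homogeneous_mult homogeneous_X1 homogeneous_X2)
  then have x: "X1 * X2 \<in> (homogeneous 2 :: 'p padic_int poly2 set)" by (simp only: one_add_one)
  have "of_int (- s) * (of_int c1 * X1 ^ 2 - of_int t1 * (X1 * X2) - of_int b1 * X2 ^ 2) \<in> (homogeneous 2 :: 'p padic_int poly2 set)"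
    by (intro homogeneous_of_int_mult homogeneous_diff x homogeneous_power1 homogeneous_X1 homogeneous_X2)
  then show ?thesis by simp
qed

text \<open>\<open>c1, t1, b1\<close> are proportional to \<open>c, a - d, b\<close>, so mixed
  products can be exchanged, as in \<open>t1 c = c1 (a - d)\<close>; the coefficients of the
  transformed form then become \<open>a d - b c\<close> times the old ones.\<close>

lemma Q_form_invariant:
  assumes "g \<in> hyperbolic_elements \<Gamma>"
  shows "(base_change (Q_form g ^ k) :: 'p padic_int poly2) \<in> V"
    and "bar_act g (base_change (Q_form g ^ k)) = (base_change (Q_form g ^ k) :: 'p padic_int poly2)"
proof -
  from assms obtain a b c d e c1 t1 b1 s where *:
    "g = bar (mat2 a b c d)" "mat2 a b c d = mat_of g" "a * d - b * c = 1"
    "c = e * c1" "a - d = e * t1" "b = e * b1"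
    and q: "(base_change (Q_form g) :: 'p padic_int poly2)
       = - of_int s * (of_int c1 * X1 ^ 2 - of_int t1 * (X1 * X2) - of_int b1 * X2 ^ 2)"
    by (rule Q_form_shape) blast
  let ?q = "- of_int s * (of_int c1 * X1 ^ 2 - of_int t1 * (X1 * X2) - of_int b1 * X2 ^ 2) :: 'p padic_int poly2"
  have "?q ^ k \<in> homogeneous (k * 2)" by (intro homogeneous_power homogeneous_form)
  then show "(base_change (Q_form g ^ k) :: 'p padic_int poly2) \<in> V"
    by (simp add: bc.hom_power q mult.commute)
  \<comment> \<open>The three identities treat the coefficients of \<open>X1 ^ 2\<close>,
    \<open>X2 ^ 2\<close> and \<open>X1 X2\<close> in turn.\<close>
  have i1: "c1 * d\<^sup>2 + t1 * d * c - b1 * c\<^sup>2 = c1"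
  proof -
    have e1: "t1 * d * c = c1 * ((a - d) * d)" unfolding *(4) *(5) by (simp only: mult_ac)
    have e2: "b1 * c\<^sup>2 = c1 * (b * c)" unfolding *(4) *(6) power2_eq_square by (simp only: mult_ac)
    have "c1 * d\<^sup>2 + t1 * d * c - b1 * c\<^sup>2 = c1 * (a * d - b * c)"
      unfolding e1 e2 by (simp add: algebra_simps power2_eq_square)
    then show ?thesis by (simp add: *(3))
  qed
  have i3: "c1 * b\<^sup>2 + t1 * b * a - b1 * a\<^sup>2 = - b1"
  proof -
    have e1: "t1 * b * a = b1 * ((a - d) * a)" unfolding *(5) *(6) by (simp only: mult_ac)
    have e2: "c1 * b\<^sup>2 = b1 * (b * c)" unfolding *(4) *(6) power2_eq_square by (simp only: mult_ac)
    have "c1 * b\<^sup>2 + t1 * b * a - b1 * a\<^sup>2 = - (b1 * (a * d - b * c))"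
      unfolding e1 e2 by (simp add: algebra_simps power2_eq_square)
    then show ?thesis by (simp add: *(3))
  qed
  have i2: "2 * b1 * c * a - 2 * c1 * d * b - t1 * (a * d + b * c) = - t1"
  proof -
    have "2 * b1 * c * a - 2 * c1 * d * b = 2 * b1 * c1 * e * (a - d)" by (simp add: *(4) *(6) algebra_simps)
    also have "\<dots> = 2 * (b * c) * t1" unfolding *(4) *(5) *(6) by (simp only: mult_ac)
    finally have e: "2 * b1 * c * a - 2 * c1 * d * b = 2 * (b * c) * t1" .
    have "2 * b1 * c * a - 2 * c1 * d * b - t1 * (a * d + b * c) = - (t1 * (a * d - b * c))"
      unfolding e by (simp add: algebra_simps)
    then show ?thesis by (simp add: *(3))
  qed
  let ?u = "of_int d * X1 - of_int b * X2 :: 'p padic_int poly2" and ?v = "- of_int c * X1 + of_int a * X2 :: 'p padic_int poly2"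
  have "of_int c1 * ?u ^ 2 - of_int t1 * (?u * ?v) - of_int b1 * ?v ^ 2
     = of_int (c1 * d\<^sup>2 + t1 * d * c - b1 * c\<^sup>2) * X1 ^ 2
       + of_int (2 * b1 * c * a - 2 * c1 * d * b - t1 * (a * d + b * c)) * (X1 * X2)
       + of_int (c1 * b\<^sup>2 + t1 * b * a - b1 * a\<^sup>2) * X2 ^ 2"
    by (simp add: algebra_simps power2_eq_square)
  also have "\<dots> = of_int c1 * X1 ^ 2 - of_int t1 * (X1 * X2) - of_int b1 * X2 ^ 2"
    unfolding i1 i2 i3 by simp
  finally have "mat_act (mat2 a b c d) ?q = ?q"
    by (simp only: mat_act.hom_mult mat_act.hom_minus mat_act.hom_uminus mat_act.hom_power mat_act.hom_of_int
        mat_act_X1 mat_act_X2 mat2_nth)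
  then show "bar_act g (base_change (Q_form g ^ k)) = (base_change (Q_form g ^ k) :: 'p padic_int poly2)"
    unfolding bar_act_def *(2)[symmetric] bc.hom_power q mat_act.hom_power by simp
qed

lemma Y_Zc: "Y \<subseteq> Zc"
proof
  fix y assume "y \<in> Y"
  then obtain g where g: "g \<in> hyperbolic_elements \<Gamma>" "y = sg g (base_change (Q_form g ^ k))" by (auto simp: Y_def)
  then have "g \<in> G" by (auto simp: hyperbolic_elements_def)
  then show "y \<in> Zc" using Q_form_invariant[OF g(1)] by (simp add: Zc_def g(2) sg_chains bd_single)
qed

text \<open>As p does not divide \<open>b\<close>, it does not divide the gcd \<open>e\<close>;
  hence it divides \<open>c1\<close> and \<open>t1\<close> but not \<open>b1\<close>, and the
  primitive form is a unit times \<open>X2 ^ 2\<close> modulo p. Cancelling the unit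
  \<open>(s * b1) ^ k\<close> leaves \<open>F A\<close>.\<close>

lemma F_hyperbolic:
  assumes A: "A \<in> Ksub" and b: "\<not> int p dvd A $ 1 $ 2" and tr: "\<bar>trace A\<bar> > 2"
  shows "F A \<in> L"
proof -
  define g where "g = bar A"
  have A\<Gamma>: "A \<in> \<Gamma>" using A by (simp add: Ksub_def)
  have mo: "mat_of g = A \<or> mat_of g = - A" unfolding g_def by (rule mat_of_bar)
  obtain a0 b0 c0 d0 where A0: "A = mat2 a0 b0 c0 d0" by (rule mat2_exhaust)
  have gh: "g \<in> hyperbolic_elements \<Gamma>"
    using mo tr A\<Gamma> by (auto simp: hyperbolic_elements_def hyperbolic_def g_def A0)
  from gh obtain a b c d e c1 t1 b1 s where *:
    "mat2 a b c d = mat_of g" "c = e * c1" "a - d = e * t1" "b = e * b1" "s = 1 \<or> s = - 1"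
    and q: "(base_change (Q_form g) :: 'p padic_int poly2)
       = - of_int s * (of_int c1 * X1 ^ 2 - of_int t1 * (X1 * X2) - of_int b1 * X2 ^ 2)"
    by (rule Q_form_shape) blast
  have abcd: "(a = a0 \<and> b = b0 \<and> c = c0 \<and> d = d0) \<or> (a = - a0 \<and> b = - b0 \<and> c = - c0 \<and> d = - d0)"
    using mo *(1) by (auto simp: A0)
  have pc: "int p dvd c" "\<not> int p dvd b"
    using abcd A b by (auto simp: Ksub_def A0)
  have pad: "int p dvd a - d"
  proof -
    have "int p dvd a0 - d0" using A by (simp add: Ksub_def A0)
    moreover have "int p dvd d0 - a0" using calculation by (simp only: dvd_diff_commute)
    ultimately show ?thesis using abcd by auto
  qed
  have pe: "\<not> int p dvd e" "\<not> int p dvd b1" using pc(2) by (auto simp: *(4))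
  have "int p dvd c1" "int p dvd t1"
    using pc(1) pad pe(1) prime_dvd_mult_iff[OF prime_int_p] by (auto simp: *(2,3))
  then obtain c2 t2 where ct: "c1 = int p * c2" "t1 = int p * t2" by blast
  let ?q = "- of_int s * (of_int c1 * X1 ^ 2 - of_int t1 * (X1 * X2) - of_int b1 * X2 ^ 2) :: 'p padic_int poly2"
  let ?r = "of_int (s * b1) * X2 ^ 2 :: 'p padic_int poly2"
  have r: "?r \<in> homogeneous 2" by (intro homogeneous_of_int_mult homogeneous_power1 homogeneous_X2)
  \<comment> \<open>The zero multiple of \<open>X2 ^ 2\<close> is kept so that the quotient has the
    shape covered by \<open>homogeneous_form\<close>.\<close>
  have "?q - ?r = const2 pm.\<pi> * (- of_int s * (of_int c2 * X1 ^ 2 - of_int t2 * (X1 * X2) - of_int 0 * X2 ^ 2))"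
    by (simp add: ct card_p of_nat_const2[symmetric] algebra_simps)
  then have "hcong pm.\<pi> 2 ?q ?r" unfolding hcong_def using homogeneous_form by blast
  from hcong_power[OF this homogeneous_form r, of k]
  have "hcong pm.\<pi> (2 * k) (?q ^ k) (?r ^ k)" by (simp add: mult.commute)
  moreover have "?r ^ k = const2 (of_int ((s * b1) ^ k)) * X"
    by (simp only: power_mult_distrib[of "of_int (s * b1)"] of_int_power[symmetric] power_mult of_int_const2[of "(s * b1) ^ k", symmetric])
  ultimately have hc: "hcong pm.\<pi> (2 * k) (base_change (Q_form g ^ k)) (const2 (of_int ((s * b1) ^ k)) * X)"
    by (simp only: bc.hom_power q)
  have gG: "g \<in> G" using A\<Gamma> by (simp add: g_def)
  have "sg g (base_change (Q_form g ^ k)) - scl (of_int ((s * b1) ^ k)) (F A) \<in> L"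
    using L_hcong[OF gG hc] by (simp only: F_def scl_single g_def)
  moreover have "sg g (base_change (Q_form g ^ k)) \<in> L" using gh by (intro L_Y) (auto simp: Y_def)
  ultimately have "scl (of_int ((s * b1) ^ k)) (F A) \<in> L" by (rule L_cancel')
  moreover have "\<not> int p dvd (s * b1) ^ k"
  proof -
    have "\<not> int p dvd s * b1" using pe(2) *(5) by auto
    then show ?thesis using prime_dvd_power[OF prime_int_p] by blast
  qed
  ultimately show ?thesis using F_chains[OF A\<Gamma>] L_unit by blast
qed

end

section \<open>Vanishing of \<open>F\<close> modulo \<open>L\<close>\<close>

lemma int_fermat:
  assumes "prime p" "\<not> int p dvd a"
  shows "int p dvd a ^ (p - 1) - 1"
proof -
  define n where "n = nat (a mod int p)"
  have n: "int n = a mod int p" using prime_gt_0_nat[OF assms(1)] by (simp add: n_def)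
  have "\<not> p dvd n"
  proof
    assume "p dvd n"
    then have "int p dvd a mod int p" unfolding n[symmetric] by simp
    then show False using assms(2) by (simp add: dvd_mod_iff)
  qed
  then have "[n ^ (p - 1) = 1] (mod p)" using assms(1) by (intro fermat_theorem)
  then have "[int n ^ (p - 1) = 1] (mod int p)" by (metis cong_int_iff of_nat_1 of_nat_power)
  moreover have "[a = int n] (mod int p)" by (simp add: n cong_def)
  ultimately have "[a ^ (p - 1) = 1] (mod int p)" by (meson cong_pow cong_trans)
  then show ?thesis by (simp add: cong_iff_dvd_diff)
qed

lemma hcong_scale: "hcong q n P R \<Longrightarrow> hcong q n (const2 r * P) (const2 r * R)"
proof -
  assume "hcong q n P R"
  then obtain W where W: "W \<in> homogeneous n" "P - R = const2 q * W" unfolding hcong_def by blast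
  have "const2 r * P - const2 r * R = const2 r * (P - R)" by (simp only: right_diff_distrib)
  then have "const2 r * P - const2 r * R = const2 q * (const2 r * W)" by (simp only: W(2) mult.left_commute)
  then show ?thesis unfolding hcong_def using homogeneous_const2_mult[OF W(1)] by blast
qed

context hecke_padic
begin

lemma p_pos: "p > 0" and p_gt_1: "p > 1"
  using prime_p prime_gt_1_nat prime_gt_0_nat by auto

definition T :: "int \<Rightarrow> mat2" where "T m = mat2 1 m 0 1"

text \<open>The factor \<open>N\<close> puts it into \<open>Gamma1 N\<close>; the factor p makes it
  upper triangular modulo p.\<close>

definition g0 :: mat2 where "g0 = mat2 1 0 (int (N * p)) 1"

lemma T_Ksub: "T m \<in> Ksub"
proof -
  have "T m \<in> Gamma1 N" by (simp add: T_def Gamma1_def carrier_SL2Z cong_def)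
  then show ?thesis using Gamma1 by (auto simp: Ksub_def T_def)
qed

lemma g0_Ksub: "g0 \<in> Ksub"
proof -
  have "g0 \<in> Gamma1 N" by (simp add: g0_def Gamma1_def carrier_SL2Z cong_def)
  then show ?thesis using Gamma1 by (auto simp: Ksub_def g0_def)
qed

lemma Ksub_\<Gamma>: "A \<in> Ksub \<Longrightarrow> A \<in> \<Gamma>"
  by (simp add: Ksub_def)

lemma F_T_multiple: "F (T (int m)) - scl (of_int (int m)) (F (T 1)) \<in> L"
proof (induction m)
  case 0
  have "F (T 0 ** T 0) - (F (T 0) + F (T 0)) \<in> L" by (intro F_mult_Ksub Ksub_\<Gamma> T_Ksub)
  moreover have "T 0 ** T 0 = T 0" by (simp add: T_def)
  ultimately have "0 - F (T 0) \<in> L" by simp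
  from L_diff[OF L_zero this] show ?case by simp
next
  case (Suc m)
  have "F (T (int m) ** T 1) - (F (T (int m)) + F (T 1)) \<in> L" by (intro F_mult_Ksub Ksub_\<Gamma> T_Ksub)
  moreover have "T (int m) ** T 1 = T (int (Suc m))" by (simp add: T_def)
  ultimately have 1: "F (T (int (Suc m))) - (F (T (int m)) + F (T 1)) \<in> L" by simp
  have "scl (of_int (int (Suc m))) (F (T 1)) = scl (of_int (int m)) (F (T 1)) + F (T 1)"
    by (simp add: pm.scale_left_distrib add.commute)
  then have "F (T (int (Suc m))) - scl (of_int (int (Suc m))) (F (T 1))
    = (F (T (int (Suc m))) - (F (T (int m)) + F (T 1))) + (F (T (int m)) - scl (of_int (int m)) (F (T 1)))"
    by simp
  then show ?case using L_add[OF 1 Suc] by (simp only:)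
qed

text \<open>\<open>T 1\<close> and \<open>g0\<close> are parabolic, so \<open>F_hyperbolic\<close>
  does not reach them directly. But \<open>g0 T\<close> and \<open>g0 g0 T\<close>, with
  \<open>T = T 1\<close>, have traces \<open>2 + N p\<close> and \<open>2 + 2 N p\<close> and upper
  right entry 1; additivity on \<open>Ksub\<close> puts \<open>F g0 + F T\<close> and
  \<open>2 F g0 + F T\<close> into \<open>L\<close>, and both terms can be recovered from
  these.\<close>

lemma F_g0: "F g0 \<in> L" and F_T1: "F (T 1) \<in> L"
proof -
  have Np: "int (N * p) > 0" using N p_pos by simp
  have h: "F (mat2 1 1 c (1 + c)) \<in> L" if "mat2 1 1 c (1 + c) \<in> Ksub" "c > 0" for c
    using that p_gt_1 by (intro F_hyperbolic) (auto simp: zdvd1_eq)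
  have K1: "g0 ** T 1 = mat2 1 1 (int (N * p)) (1 + int (N * p))"
    and K2: "(g0 ** g0) ** T 1 = mat2 1 1 (2 * int (N * p)) (1 + 2 * int (N * p))"
    by (simp_all add: g0_def T_def algebra_simps)
  have \<Gamma>: "g0 \<in> \<Gamma>" "T 1 \<in> \<Gamma>" "g0 ** g0 \<in> \<Gamma>" using g0_Ksub T_Ksub Ksub_\<Gamma> \<Gamma>_mult by blast+
  have "g0 ** T 1 \<in> \<Gamma>" "(g0 ** g0) ** T 1 \<in> \<Gamma>" using \<Gamma> \<Gamma>_mult by blast+
  then have "g0 ** T 1 \<in> Ksub" "(g0 ** g0) ** T 1 \<in> Ksub" unfolding K1 K2 by (auto simp: Ksub_def)
  then have f1: "F (g0 ** T 1) \<in> L" and f2: "F ((g0 ** g0) ** T 1) \<in> L"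
    unfolding K1 K2 using Np by (auto intro: h)
  have e1: "F g0 + F (T 1) \<in> L" using L_cancel'[OF F_mult_Ksub[OF \<Gamma>(1) T_Ksub] f1] .
  have e2: "F (g0 ** g0) + F (T 1) \<in> L" using L_cancel'[OF F_mult_Ksub[OF \<Gamma>(3) T_Ksub] f2] .
  have e3: "F (g0 ** g0) - (F g0 + F g0) \<in> L" by (rule F_mult_Ksub[OF \<Gamma>(1) g0_Ksub])
  have "F g0 = (F (g0 ** g0) + F (T 1)) - (F (g0 ** g0) - (F g0 + F g0)) - (F g0 + F (T 1))" by simp
  then show g: "F g0 \<in> L" using L_diff[OF L_diff[OF e2 e3] e1] by (simp only:)
  show "F (T 1) \<in> L" using L_diff[OF e1 g] by simp
qed

lemma F_T: "F (T (int m)) \<in> L"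
  using L_cancel[OF F_T_multiple L_scl[OF F_T1]] .

text \<open>Multiplying by a power of the translation makes the element hyperbolic with a form
  congruent to a unit multiple of \<open>X2\<^sup>2\<close>.\<close>

lemma F_Ksub:
  assumes "A \<in> Ksub"
  shows "F A \<in> L"
proof -
  have main: "F A \<in> L" if A: "A \<in> Ksub" "A $ 2 $ 1 \<noteq> 0" for A
  proof -
    obtain a b c d where e: "A = mat2 a b c d" by (rule mat2_exhaust)
    have A\<Gamma>: "A \<in> \<Gamma>" using A by (simp add: Ksub_def)
    have det: "a * d - b * c = 1" and c: "int p dvd c" "c \<noteq> 0" and ad: "int p dvd a - d"
      using A \<Gamma>_det[OF A\<Gamma>] by (auto simp: Ksub_def e)
    have a: "\<not> int p dvd a"
    proof
      assume "int p dvd a"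
      then have "int p dvd a * d - b * c" using c(1) by simp
      then show False using det p_gt_1 by (simp add: zdvd1_eq)
    qed
    \<comment> \<open>For \<open>m\<close> at least this large the summand \<open>c m\<close> of the
      trace exceeds \<open>a + d\<close> in absolute value by 3 or more, since \<open>c\<close> is
      nonzero.\<close>
    define m0 where "m0 = nat (\<bar>a + d\<bar> + 3)"
    \<comment> \<open>Consecutive values of \<open>a m + b\<close> differ by \<open>a\<close>, which
      is prime to p, so they are not both divisible by p.\<close>
    have "\<exists>m \<ge> m0. \<not> int p dvd a * int m + b"
    proof (cases "int p dvd a * int m0 + b")
      case True
      have "a * int (Suc m0) + b = (a * int m0 + b) + a" by (simp add: algebra_simps)
      then have "\<not> int p dvd a * int (Suc m0) + b" using a True by (simp only: dvd_add_right_iff) simp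
      then show ?thesis by (intro exI[of _ "Suc m0"]) simp
    qed blast
    then obtain m where m: "m \<ge> m0" "\<not> int p dvd a * int m + b" by blast
    have AT: "A ** T (int m) = mat2 a (a * int m + b) c (c * int m + d)" by (simp add: e T_def)
    have K: "A ** T (int m) \<in> Ksub"
    proof -
      have "A ** T (int m) \<in> \<Gamma>" using A\<Gamma> T_Ksub Ksub_\<Gamma> \<Gamma>_mult by blast
      moreover have "int p dvd a - (c * int m + d)"
      proof -
        have e: "a - (c * int m + d) = (a - d) - c * int m" by simp
        show ?thesis unfolding e by (rule dvd_diff[OF ad dvd_mult2[OF c(1)]])
      qed
      ultimately show ?thesis using c(1) ad unfolding Ksub_def AT by simp
    qed
    have "\<bar>c * int m\<bar> \<ge> int m"
    proof -
      have "1 * int m \<le> \<bar>c\<bar> * int m" using c(2) by (intro mult_right_mono) auto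
      then show ?thesis by (simp add: abs_mult)
    qed
    moreover have "int m \<ge> \<bar>a + d\<bar> + 3" using m(1) by (simp add: m0_def)
    ultimately have "\<bar>a + (c * int m + d)\<bar> > 2" by linarith
    then have "F (A ** T (int m)) \<in> L" using K m(2) by (intro F_hyperbolic) (auto simp: AT)
    then have "F A + F (T (int m)) \<in> L" using L_cancel'[OF F_mult_Ksub[OF A\<Gamma> T_Ksub]] by blast
    from L_diff[OF this F_T[of m]] show "F A \<in> L" by simp
  qed
  show ?thesis
  proof (cases "A $ 2 $ 1 = 0")
    case False
    then show ?thesis using main assms by blast
  next
    case True
    obtain a b c d where e: "A = mat2 a b c d" by (rule mat2_exhaust)
    have A\<Gamma>: "A \<in> \<Gamma>" using assms by (simp add: Ksub_def)
    have det: "a * d = 1" and c: "c = 0" and ad: "int p dvd a - d"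
      using assms True \<Gamma>_det[OF A\<Gamma>] by (auto simp: Ksub_def e)
    \<comment> \<open>With lower left entry zero, translations do not change the trace. Multiplying
      by \<open>g0\<close> first makes that entry \<open>d N p\<close>, which is nonzero.\<close>
    have Ag: "A ** g0 = mat2 (a + b * int (N * p)) b (d * int (N * p)) d" by (simp add: e g0_def c)
    have "A ** g0 \<in> \<Gamma>" using A\<Gamma> g0_Ksub Ksub_\<Gamma> \<Gamma>_mult by blast
    moreover have "int p dvd a + b * int (N * p) - d"
    proof -
      have e: "a + b * int (N * p) - d = (a - d) + (b * int N) * int p" by simp
      show ?thesis unfolding e using ad by (intro dvd_add dvd_triv_right)
    qed
    ultimately have "A ** g0 \<in> Ksub" using ad unfolding Ksub_def Ag by simp
    moreover have "d \<noteq> 0" using det by auto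
    ultimately have "F (A ** g0) \<in> L" using N p_pos by (intro main) (auto simp: Ag)
    then have "F A + F g0 \<in> L" using L_cancel'[OF F_mult_Ksub[OF A\<Gamma> g0_Ksub]] by blast
    from L_diff[OF this F_g0] show ?thesis by simp
  qed
qed

abbreviation \<Gamma>p :: "mat2 set" where "\<Gamma>p \<equiv> \<Gamma> \<inter> Gamma0 p"

lemma \<Gamma>pD: "A \<in> \<Gamma>p \<Longrightarrow> A \<in> \<Gamma>" "A \<in> \<Gamma>p \<Longrightarrow> int p dvd A $ 2 $ 1"
  by (auto simp: Gamma0_def cong_0_iff)

text \<open>Modulo p both factors are upper triangular, so their commutator \<open>\<kappa>\<close>
  is upper unipotent there, which places it in \<open>Ksub\<close>.\<close>

lemma F_commute:
  assumes A: "A \<in> \<Gamma>p" and D: "D \<in> \<Gamma>p"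
  shows "F (A ** D) - F (D ** A) \<in> L"
proof -
  define \<kappa> where "\<kappa> = A ** D ** (adj2 A ** adj2 D)"
  obtain a b c d where a: "A = mat2 a b c d" by (rule mat2_exhaust)
  obtain a' b' c' d' where d: "D = mat2 a' b' c' d'" by (rule mat2_exhaust)
  have c: "int p dvd c" "int p dvd c'" using \<Gamma>pD(2)[OF A] \<Gamma>pD(2)[OF D] by (simp_all add: a d)
  have \<Gamma>: "A \<in> \<Gamma>" "D \<in> \<Gamma>" using A D by auto
  have \<kappa>\<Gamma>: "\<kappa> \<in> \<Gamma>" unfolding \<kappa>_def using \<Gamma> by (intro \<Gamma>_mult \<Gamma>_adj2)
  \<comment> \<open>Grouped so that every term carries a factor \<open>c\<close> or
    \<open>c'\<close>, which displays the divisibility by p.\<close>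
  have "\<kappa> $ 2 $ 1 = c * (a' * (d * d' + b * c') - b' * (c * d' + a * c') - d * d' * d')
      + c' * (d * (d * d' + b * c') - d * d' * a)"
    by (simp add: \<kappa>_def a d algebra_simps)
  then have k1: "int p dvd \<kappa> $ 2 $ 1" using c by simp
  have "\<kappa> $ 1 $ 1 - \<kappa> $ 2 $ 2
    = c' * (a * a' * b + b * d * d' + b * b * c' - (a * b' + b * d') * a + d * (d * b' + b * a'))
      + c * (- (a * b' + b * d') * d' + a' * (d * b' + b * a') - b' * c * b' - b' * a * a' - d * d' * b')"
    by (simp add: \<kappa>_def a d algebra_simps)
  then have k2: "int p dvd \<kappa> $ 1 $ 1 - \<kappa> $ 2 $ 2" using c by simp
  have \<kappa>K: "\<kappa> \<in> Ksub" using \<kappa>\<Gamma> k1 k2 by (simp add: Ksub_def)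
  have DA: "D ** A \<in> \<Gamma>" "int p dvd (D ** A) $ 2 $ 1"
    using \<Gamma>_mult[OF \<Gamma>(2,1)] c by (simp_all add: a d)
  have "\<kappa> ** (D ** A) = A ** D ** adj2 A ** (adj2 D ** D) ** A"
    by (simp only: \<kappa>_def matrix_mul_assoc)
  also have "\<dots> = A ** D ** (adj2 A ** A)"
    using \<Gamma>_det[OF \<Gamma>(2)] by (simp add: adj2_left matrix_mul_assoc)
  also have "\<dots> = A ** D" using \<Gamma>_det[OF \<Gamma>(1)] by (simp add: adj2_left)
  finally have e: "\<kappa> ** (D ** A) = A ** D" .
  have 1: "F (A ** D) - (scl (of_int (chi (D ** A))) (F \<kappa>) + F (D ** A)) \<in> L"
    using F_mult[OF \<kappa>\<Gamma> DA] by (simp only: e)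
  have "F (A ** D) - F (D ** A) = (F (A ** D) - (scl (of_int (chi (D ** A))) (F \<kappa>) + F (D ** A)))
     + scl (of_int (chi (D ** A))) (F \<kappa>)" by simp
  then show ?thesis using L_add[OF 1 L_scl[OF F_Ksub[OF \<kappa>K]]] by (simp only:)
qed

text \<open>The commutator of two elements of \<open>\<Gamma>p\<close> lies in \<open>Ksub\<close>, so the cocycle may be expanded in either
  order.\<close>

lemma F_exchange:
  assumes A: "A \<in> \<Gamma>p" and D: "D \<in> \<Gamma>p"
  shows "scl (of_int (chi D - 1)) (F A) - scl (of_int (chi A - 1)) (F D) \<in> L"
proof -
  have 1: "F (A ** D) - (scl (of_int (chi D)) (F A) + F D) \<in> L"
    by (rule F_mult[OF \<Gamma>pD(1)[OF A] \<Gamma>pD[OF D]])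
  have 2: "F (D ** A) - (scl (of_int (chi A)) (F D) + F A) \<in> L"
    by (rule F_mult[OF \<Gamma>pD(1)[OF D] \<Gamma>pD[OF A]])
  have e: "scl (of_int (n - 1)) x = scl (of_int n) x - x" for n and x :: "mat2 set \<Rightarrow>\<^sub>0 'p padic_int poly2"
    by (simp add: pm.scale_left_diff_distrib)
  have "scl (of_int (chi D - 1)) (F A) - scl (of_int (chi A - 1)) (F D)
    = (F (A ** D) - F (D ** A)) - (F (A ** D) - (scl (of_int (chi D)) (F A) + F D))
      + (F (D ** A) - (scl (of_int (chi A)) (F D) + F A))"
    unfolding e by simp
  then show ?thesis using L_add[OF L_diff[OF F_commute[OF A D] 1] 2] by (simp only:)
qed

text \<open>The boundary recovers \<open>chi A - 1\<close>, the very coefficient that occurs in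
  \<open>F_exchange\<close>.\<close>

lemma bd_F:
  assumes "A \<in> \<Gamma>p"
  shows "hcong pm.\<pi> (2 * k) (bd (F A)) (const2 (of_int (chi A - 1)) * X)"
proof -
  have "hcong pm.\<pi> (2 * k) (mat_act A X + - X) (const2 (of_int (chi A)) * X + - X)"
    by (intro hcong_add hcong_chi hcong_refl \<Gamma>pD(2)[OF assms])
  then show ?thesis
    by (simp add: F_def bd_single bar_act_bar[OF X_V] const2.hom_minus left_diff_distrib)
qed

lemma coeff_X: "coeff (coeff X 0) (2 * k) = (1 :: 'p padic_int)"
  using coeff_X1_X2[of 0 "2 * k" 0 "2 * k", where 'r = "'p padic_int"] by simp

definition F0 :: "(mat2 set \<Rightarrow>\<^sub>0 'p padic_int poly2) set" where
  "F0 = pm.span (F ` \<Gamma>p)"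

lemma F0_chains: "F0 \<subseteq> gm.chains"
  unfolding F0_def by (intro pm.span_minimal subspace_chains) (auto intro: F_chains)

text \<open>Compares the coefficients of \<open>X2 ^ (2 * k)\<close>, which is 1 in
  \<open>X\<close>.\<close>

lemma hcong_X_zero:
  assumes "hcong pm.\<pi> (2 * k) v (const2 t * X)" "hcong pm.\<pi> (2 * k) v 0"
  shows "\<exists>r. t = pm.\<pi> * r"
proof -
  obtain W W' where W: "v - const2 t * X = const2 pm.\<pi> * W" "v - 0 = const2 pm.\<pi> * W'"
    using assms unfolding hcong_def by blast
  have "const2 t * X = (v - 0) - (v - const2 t * X)" by simp
  also have "\<dots> = const2 pm.\<pi> * (W' - W)" unfolding W by (simp add: right_diff_distrib)
  finally have "coeff (coeff (const2 t * X) 0) (2 * k) = coeff (coeff (const2 pm.\<pi> * (W' - W)) 0) (2 * k)"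
    by simp
  then show ?thesis unfolding coeff_const2_mult coeff_X by (intro exI) simp
qed

text \<open>If some \<open>D\<close> has \<open>chi D - 1\<close> prime to p, then
  \<open>F_exchange\<close> turns a unit multiple of \<open>f\<close> into \<open>t F D\<close>,
  where \<open>bd f\<close> is \<open>t X\<close> modulo p; the hypothesis on the boundary forces p
  to divide \<open>t\<close>. If \<open>chi\<close> is trivial modulo p, then \<open>F\<close> is
  additive on \<open>\<Gamma>p\<close>, so a power of \<open>A\<close> that lies in
  \<open>Ksub\<close> decides about \<open>A\<close>.\<close>

lemma F0_L:
  assumes f: "f \<in> F0" and bd: "hcong pm.\<pi> (2 * k) (bd f) 0"
  shows "f \<in> L"
proof (cases "\<exists>D \<in> \<Gamma>p. \<not> int p dvd chi D - 1")
  case True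
  then obtain D where D: "D \<in> \<Gamma>p" "\<not> int p dvd chi D - 1" by blast
  \<comment> \<open>The same \<open>t\<close> occurs in both conditions; this link survives linear
    combinations and lets the boundary control the multiple of \<open>F D\<close>.\<close>
  define S1 where "S1 = {f. \<exists>t. scl (of_int (chi D - 1)) f - scl t (F D) \<in> L
      \<and> hcong pm.\<pi> (2 * k) (bd f) (const2 t * X)}"
  have "pm.subspace S1"
  proof (rule pm.subspaceI)
    show "0 \<in> S1" unfolding S1_def using L_zero hcong_refl by (intro CollectI exI[of _ 0]) simp
  next
    fix x y assume "x \<in> S1" "y \<in> S1"
    then obtain s t where s: "scl (of_int (chi D - 1)) x - scl s (F D) \<in> L" "hcong pm.\<pi> (2 * k) (bd x) (const2 s * X)"
      and t: "scl (of_int (chi D - 1)) y - scl t (F D) \<in> L" "hcong pm.\<pi> (2 * k) (bd y) (const2 t * X)"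
      unfolding S1_def by blast
    have "scl (of_int (chi D - 1)) (x + y) - scl (s + t) (F D)
      = (scl (of_int (chi D - 1)) x - scl s (F D)) + (scl (of_int (chi D - 1)) y - scl t (F D))"
      by (simp add: pm.scale_left_distrib pm.scale_right_distrib)
    then have "scl (of_int (chi D - 1)) (x + y) - scl (s + t) (F D) \<in> L" using L_add[OF s(1) t(1)] by (simp only:)
    moreover have "hcong pm.\<pi> (2 * k) (bd (x + y)) (const2 (s + t) * X)"
      using hcong_add[OF s(2) t(2)] by (simp only: bd_add const2.hom_add distrib_right)
    ultimately show "x + y \<in> S1" unfolding S1_def by blast
  next
    fix r x assume "x \<in> S1"
    then obtain s where s: "scl (of_int (chi D - 1)) x - scl s (F D) \<in> L" "hcong pm.\<pi> (2 * k) (bd x) (const2 s * X)"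
      unfolding S1_def by blast
    have "scl (of_int (chi D - 1)) (scl r x) - scl (r * s) (F D) = scl r (scl (of_int (chi D - 1)) x - scl s (F D))"
      by (simp add: pm.scale_right_diff_distrib mult.commute)
    then have "scl (of_int (chi D - 1)) (scl r x) - scl (r * s) (F D) \<in> L" using L_scl[OF s(1)] by (simp only:)
    moreover have "hcong pm.\<pi> (2 * k) (bd (scl r x)) (const2 (r * s) * X)"
      using hcong_scale[OF s(2), of r] by (simp only: bd_scl const2.hom_mult mult.assoc)
    ultimately show "scl r x \<in> S1" unfolding S1_def by blast
  qed
  moreover have "F ` \<Gamma>p \<subseteq> S1"
    unfolding S1_def using F_exchange[OF _ D(1)] bd_F by blast
  ultimately have "F0 \<subseteq> S1" unfolding F0_def by (intro pm.span_minimal)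
  then obtain t where t: "scl (of_int (chi D - 1)) f - scl t (F D) \<in> L" "hcong pm.\<pi> (2 * k) (bd f) (const2 t * X)"
    using f unfolding S1_def by blast
  obtain r where r: "t = pm.\<pi> * r" using hcong_X_zero[OF t(2) bd] by blast
  have FD: "F D \<in> gm.chains" by (rule F_chains[OF \<Gamma>pD(1)[OF D(1)]])
  have "scl t (F D) = scl pm.\<pi> (scl r (F D))" by (simp add: r)
  then have "scl t (F D) \<in> L" using L_pi[OF scl_chains[OF FD]] by (simp only:)
  from L_cancel[OF t(1) this] show ?thesis using f F0_chains D(2) L_unit by blast
next
  case False
  then have all: "int p dvd chi D - 1" if "D \<in> \<Gamma>p" for D using that by blast
  have "F A \<in> L" if A: "A \<in> \<Gamma>p" for A
  proof -
    obtain a b c d where e: "A = mat2 a b c d" by (rule mat2_exhaust)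
    have A\<Gamma>: "A \<in> \<Gamma>" and c: "int p dvd c" using \<Gamma>pD[OF A] by (auto simp: e)
    have det: "a * d - b * c = 1" using \<Gamma>_det[OF A\<Gamma>] by (simp add: e)
    \<comment> \<open>\<open>P\<close> plays the role of \<open>A ^ n\<close>; only its diagonal
      modulo p, the divisibility of its lower left entry and its value under \<open>F\<close> are
      recorded.\<close>
    have pow: "\<exists>P \<in> \<Gamma>. int p dvd P $ 2 $ 1 \<and> int p dvd P $ 1 $ 1 - a ^ n \<and> int p dvd P $ 2 $ 2 - d ^ n
       \<and> F P - scl (of_int (int n)) (F A) \<in> L" for n
    proof (induction n)
      case 0
      have "F (T (int 0)) \<in> L" by (rule F_T)
      then show ?case using Ksub_\<Gamma>[OF T_Ksub, of 0] by (intro bexI[of _ "T 0"]) (auto simp: T_def)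
    next
      case (Suc n)
      then obtain P where P: "P \<in> \<Gamma>" "int p dvd P $ 2 $ 1" "int p dvd P $ 1 $ 1 - a ^ n" "int p dvd P $ 2 $ 2 - d ^ n"
        "F P - scl (of_int (int n)) (F A) \<in> L" by blast
      obtain x y z w where q: "P = mat2 x y z w" by (rule mat2_exhaust)
      have 1: "F (P ** A) - (scl (of_int (chi A)) (F P) + F A) \<in> L" by (rule F_mult[OF P(1) \<Gamma>pD[OF A]])
      have 2: "scl (of_int (chi A)) (F P) - scl (of_int 1) (F P) \<in> L"
        by (rule L_int_cong[OF F_chains[OF P(1)] all[OF A]])
      have "scl (of_int (int (Suc n))) (F A) = scl (of_int (int n)) (F A) + F A"
        by (simp add: pm.scale_left_distrib add.commute)
      then have "F (P ** A) - scl (of_int (int (Suc n))) (F A)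
        = (F (P ** A) - (scl (of_int (chi A)) (F P) + F A)) + (scl (of_int (chi A)) (F P) - scl (of_int 1) (F P))
          + (F P - scl (of_int (int n)) (F A))" by simp
      then have 3: "F (P ** A) - scl (of_int (int (Suc n))) (F A) \<in> L"
        using L_add[OF L_add[OF 1 2] P(5)] by (simp only:)
      have 4: "P ** A = mat2 (x * a + y * c) (x * b + y * d) (z * a + w * c) (z * b + w * d)" by (simp add: q e)
      have zxw: "int p dvd z" "int p dvd x - a ^ n" "int p dvd w - d ^ n" using P by (simp_all add: q)
      have e1: "x * a + y * c - a ^ Suc n = (x - a ^ n) * a + y * c"
        and e2: "z * b + w * d - d ^ Suc n = (w - d ^ n) * d + z * b"
        by (simp_all add: algebra_simps)
      have "int p dvd z * a + w * c" by (rule dvd_add[OF dvd_mult2[OF zxw(1)] dvd_mult[OF c]])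
      moreover have "int p dvd x * a + y * c - a ^ Suc n"
        unfolding e1 by (rule dvd_add[OF dvd_mult2[OF zxw(2)] dvd_mult[OF c]])
      moreover have "int p dvd z * b + w * d - d ^ Suc n"
        unfolding e2 by (rule dvd_add[OF dvd_mult2[OF zxw(3)] dvd_mult2[OF zxw(1)]])
      ultimately show ?case using 3 \<Gamma>_mult[OF P(1) A\<Gamma>] by (intro bexI[of _ "P ** A"]) (auto simp: 4)
    qed
    obtain P where P: "P \<in> \<Gamma>" "int p dvd P $ 2 $ 1" "int p dvd P $ 1 $ 1 - a ^ (p - 1)" "int p dvd P $ 2 $ 2 - d ^ (p - 1)"
      "F P - scl (of_int (int (p - 1))) (F A) \<in> L" using pow[of "p - 1"] by blast
    have nd: "\<not> int p dvd a" "\<not> int p dvd d"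
    proof -
      have "\<not> int p dvd 1" using p_gt_1 by (simp add: zdvd1_eq)
      then show "\<not> int p dvd a" "\<not> int p dvd d" using c unfolding det[symmetric] by auto
    qed
    have "P $ 1 $ 1 - P $ 2 $ 2 = (P $ 1 $ 1 - a ^ (p - 1)) + (a ^ (p - 1) - 1) - (P $ 2 $ 2 - d ^ (p - 1)) - (d ^ (p - 1) - 1)"
      by simp
    also have "int p dvd \<dots>" by (rule dvd_diff[OF dvd_diff[OF dvd_add[OF P(3) int_fermat[OF prime_p nd(1)]] P(4)] int_fermat[OF prime_p nd(2)]])
    finally have "P \<in> Ksub" using P by (simp add: Ksub_def)
    then have "scl (of_int (int (p - 1))) (F A) \<in> L" using L_cancel'[OF P(5)] F_Ksub by blast
    \<comment> \<open>The multiplier \<open>p - 1\<close> is prime to p, so it can be cancelled from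
      the multiple of \<open>F A\<close>.\<close>
    moreover have "\<not> int p dvd int (p - 1)" using p_gt_1 by (auto dest: zdvd_imp_le)
    ultimately show ?thesis using F_chains[OF A\<Gamma>] L_unit by blast
  qed
  then have "F0 \<subseteq> L" unfolding F0_def by (intro pm.span_minimal L_subspace) auto
  then show ?thesis using f by blast
qed

end

section \<open>The Hecke operator on cycles modulo p\<close>

context hecke_padic
begin

text \<open>\<open>X1\<close> goes to \<open>p X1\<close> and \<open>X2\<close> is fixed, so only
  the monomial free of \<open>X1\<close> survives modulo p.\<close>

lemma hcong_alpha:
  assumes "P \<in> V"
  shows "\<exists>r. hcong pm.\<pi> (2 * k) (mat_act \<alpha> P) (const2 r * X)"
proof -
  define c where "c i = coeff (coeff P i) (2 * k - i)" for i
  have X1: "mat_act \<alpha> X1 = const2 pm.\<pi> * X1" and X2: "mat_act \<alpha> X2 = X2"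
    by (simp_all add: mat_act_X1 mat_act_X2 card_p of_nat_const2[symmetric])
  have "mat_act \<alpha> P = (\<Sum>i\<le>2 * k. const2 (c i) * ((const2 pm.\<pi> * X1) ^ i * X2 ^ (2 * k - i)))"
    unfolding mat_act_expand[OF assms] X1 X2 c_def ..
  also have "\<dots> = const2 (c 0) * X + (\<Sum>i\<in>{..2 * k} - {0}. const2 (c i) * ((const2 pm.\<pi> * X1) ^ i * X2 ^ (2 * k - i)))"
    by (subst sum.remove[of _ 0]) auto
  also have "(\<Sum>i\<in>{..2 * k} - {0}. const2 (c i) * ((const2 pm.\<pi> * X1) ^ i * X2 ^ (2 * k - i)))
     = const2 pm.\<pi> * (\<Sum>i\<in>{..2 * k} - {0}. const2 (c i * pm.\<pi> ^ (i - 1)) * (X1 ^ i * X2 ^ (2 * k - i)))"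
    unfolding sum_distrib_left
  proof (intro sum.cong refl)
    fix i assume "i \<in> {..2 * k} - {0}"
    then have "(const2 pm.\<pi> * X1) ^ i = const2 pm.\<pi> * (const2 (pm.\<pi> ^ (i - 1)) * X1 ^ i)"
      by (cases i) (simp_all add: power_mult_distrib const2.hom_power mult_ac)
    then show "const2 (c i) * ((const2 pm.\<pi> * X1) ^ i * X2 ^ (2 * k - i))
      = const2 pm.\<pi> * (const2 (c i * pm.\<pi> ^ (i - 1)) * (X1 ^ i * X2 ^ (2 * k - i)))"
      by (simp only: const2.hom_mult mult_ac)
  qed
  finally have e: "mat_act \<alpha> P - const2 (c 0) * X
     = const2 pm.\<pi> * (\<Sum>i\<in>{..2 * k} - {0}. const2 (c i * pm.\<pi> ^ (i - 1)) * (X1 ^ i * X2 ^ (2 * k - i)))"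
    by (simp only: add_diff_cancel_left')
  have "X1 ^ i * X2 ^ (2 * k - i) \<in> V" if "i \<in> {..2 * k} - {0}" for i
    using homogeneous_mult[OF homogeneous_power1[OF homogeneous_X1] homogeneous_power1[OF homogeneous_X2], of i "2 * k - i"] that
    by simp
  then have "(\<Sum>i\<in>{..2 * k} - {0}. const2 (c i * pm.\<pi> ^ (i - 1)) * (X1 ^ i * X2 ^ (2 * k - i))) \<in> V"
    by (intro homogeneous_sum homogeneous_const2_mult)
  then show ?thesis unfolding hcong_def using e by blast
qed

text \<open>The correction caused by the left factors \<open>dl C\<close> of the chosen
  representatives. It is additive in \<open>v\<close>, so summed over a cycle \<open>z\<close> it
  becomes \<open>Phi (bd z)\<close>, which is zero.\<close>

definition Phi :: "'p padic_int poly2 \<Rightarrow> (mat2 set \<Rightarrow>\<^sub>0 'p padic_int poly2)" where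
  "Phi v = (\<Sum>C\<in>Q. sg (bar (dl C)) (bar_act (bar \<alpha> \<odot> bar (rr C)) v))"

lemma Phi_zero: "Phi 0 = 0"
  by (simp add: Phi_def)

lemma Phi_diff: "Phi (v - w) = Phi v - Phi w"
  by (simp add: Phi_def bar_act_diff single_diff sum_subtractf)

lemma Phi_sum: "Phi (\<Sum>i\<in>I. f i) = (\<Sum>i\<in>I. Phi (f i))"
  by (induction I rule: infinite_finite_induct) (simp_all add: Phi_zero Phi_def bar_act_add single_add sum.distrib)

text \<open>The representatives may be moved to the form \<open>\<alpha> g\<close> at the cost of the coboundary
  of \<open>Phi\<close>; afterwards the transfer lands in the subgroup of lower left entry divisible by
  \<open>p\<close>, and all coefficients are multiples of \<open>X\<close> modulo \<open>p\<close>.\<close>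

lemma u_mod_L:
  assumes g: "g \<in> G" and v: "v \<in> V"
  shows "\<exists>f \<in> F0. u g v - f - (Phi (bar_act g v) - Phi v) \<in> L"
proof -
  define \<beta> where "\<beta> C = bar \<alpha> \<odot> bar (rr C)" for C
  define w where "w C = bar_act (\<beta> (C \<triangleleft> g)) v" for C
  have wV: "w C \<in> V" for C unfolding w_def using v by (rule bar_act_homogeneous)
  have \<beta>r: "\<beta> C \<in> range bar" for C by (simp add: \<beta>_def bar_bm)
  have gr: "g \<in> range bar" using g by blast
  have step: "\<exists>f \<in> F0. sg (tau C g) (bar_act (coset_rep (C \<triangleleft> g)) v) - f
      - (sg (bar (dl C)) (bar_act (\<beta> C) (bar_act g v)) - sg (bar (dl (C \<triangleleft> g))) (w C)) \<in> L" if C: "C \<in> Q" for C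
  proof -
    have C': "C \<triangleleft> g \<in> Q" using C g by (rule Q_act)
    let ?d = "bar (dl C)" and ?d' = "bar (dl (C \<triangleleft> g))" and ?e = "eta C g" and ?t = "tau C g"
    have d: "?d \<in> G" "?d' \<in> G" using decomp(1)[OF C] decomp(1)[OF C'] by auto
    have dr: "?d' \<in> range bar" by blast
    have e: "?e \<in> G" "?t \<in> G" using eta_G[OF C g] tau(1)[OF C g] .
    have er: "?e \<in> range bar" using e(1) by blast
    have "bar_act (coset_rep (C \<triangleleft> g)) v = bar_act (?d' \<odot> \<beta> (C \<triangleleft> g)) v"
      by (simp only: decomp(4)[OF C'] \<beta>_def)
    also have "\<dots> = bar_act ?d' (w C)" unfolding w_def using dr \<beta>r v by (rule bar_act_bm)
    finally have b1: "bar_act (coset_rep (C \<triangleleft> g)) v = bar_act ?d' (w C)" .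
    have "bar_act ?e (w C) = bar_act (?e \<odot> \<beta> (C \<triangleleft> g)) v" unfolding w_def using er \<beta>r v by (rule bar_act_bm[symmetric])
    also have "\<dots> = bar_act (\<beta> C \<odot> g) v" by (simp only: \<beta>_def eta(2)[OF C g])
    also have "\<dots> = bar_act (\<beta> C) (bar_act g v)" using \<beta>r gr v by (rule bar_act_bm)
    finally have b2: "bar_act ?e (w C) = bar_act (\<beta> C) (bar_act g v)" .
    \<comment> \<open>By \<open>tau\<close> the products of \<open>?t\<close> with
      \<open>?d'\<close> and of \<open>?d\<close> with \<open>?e\<close> are equal; expanding both
      relates the term of the chosen representative to that of \<open>\<alpha> rr C\<close>.\<close>
    have r1: "sg (?t \<odot> ?d') (w C) - (sg ?t (bar_act ?d' (w C)) + sg ?d' (w C)) \<in> L"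
      using e d wV by (intro B_subset_L sg_mult)
    have r2: "sg (?d \<odot> ?e) (w C) - (sg ?d (bar_act ?e (w C)) + sg ?e (w C)) \<in> L"
      using e d wV by (intro B_subset_L sg_mult)
    obtain h where h: "h \<in> \<Gamma>p" "?e = bar h" using eta(1)[OF C g] by blast
    have rv: "mat_act (rr (C \<triangleleft> g)) v \<in> V" using v by (rule mat_act_homogeneous)
    have "w C = mat_act \<alpha> (mat_act (rr (C \<triangleleft> g)) v)"
      by (simp only: w_def \<beta>_def bar_bm bar_act_bar[OF v] mat_act_mult)
    then obtain r where "hcong pm.\<pi> (2 * k) (w C) (const2 r * X)" using hcong_alpha[OF rv] by auto
    then have r3: "sg ?e (w C) - scl r (F h) \<in> L" using L_hcong[OF e(1)] by (simp only: F_def scl_single h(2))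
    have "sg ?t (bar_act (coset_rep (C \<triangleleft> g)) v) - scl r (F h) - (sg ?d (bar_act (\<beta> C) (bar_act g v)) - sg ?d' (w C))
       = (sg (?d \<odot> ?e) (w C) - (sg ?d (bar_act ?e (w C)) + sg ?e (w C)))
         - (sg (?t \<odot> ?d') (w C) - (sg ?t (bar_act ?d' (w C)) + sg ?d' (w C))) + (sg ?e (w C) - scl r (F h))"
      unfolding b1 b2 tau(3)[OF C g] by simp
    moreover have "scl r (F h) \<in> F0" unfolding F0_def using h(1) by (intro pm.span_scale pm.span_base) simp
    ultimately show ?thesis using L_add[OF L_diff[OF r2 r1] r3] by (intro bexI[of _ "scl r (F h)"]) (simp only:)
  qed
  then obtain f where f: "\<And>C. C \<in> Q \<Longrightarrow> f C \<in> F0" "\<And>C. C \<in> Q \<Longrightarrow> sg (tau C g) (bar_act (coset_rep (C \<triangleleft> g)) v) - f C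
      - (sg (bar (dl C)) (bar_act (\<beta> C) (bar_act g v)) - sg (bar (dl (C \<triangleleft> g))) (w C)) \<in> L" by metis
  \<comment> \<open>The shift by \<open>g\<close> permutes the cosets, so the subtracted sum depends
    on \<open>v\<close> alone.\<close>
  have re: "(\<Sum>C\<in>Q. sg (bar (dl (C \<triangleleft> g))) (w C)) = Phi v"
    unfolding w_def Phi_def \<beta>_def
    by (rule sum.reindex_bij_betw[OF Q_act_bij[OF g], of "\<lambda>C. sg (bar (dl C)) (bar_act (bar \<alpha> \<odot> bar (rr C)) v)"])
  have "u g v - (\<Sum>C\<in>Q. f C) - (Phi (bar_act g v) - Phi v)
    = (\<Sum>C\<in>Q. sg (tau C g) (bar_act (coset_rep (C \<triangleleft> g)) v) - f C
      - (sg (bar (dl C)) (bar_act (\<beta> C) (bar_act g v)) - sg (bar (dl (C \<triangleleft> g))) (w C)))"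
    unfolding sum_subtractf re by (simp add: u_def Phi_def \<beta>_def)
  also have "\<dots> \<in> L" by (intro L_sum f(2))
  finally show ?thesis using f(1) unfolding F0_def by (intro bexI[of _ "\<Sum>C\<in>Q. f C"] pm.span_sum)
qed

text \<open>Elements of \<open>Y\<close> and \<open>B\<close> are cycles, and p times a chain has
  boundary divisible by p. This carries the cycle condition from \<open>Utilde z\<close> over to its
  part in \<open>F0\<close>.\<close>

lemma L_bd: "L \<subseteq> {x. hcong pm.\<pi> (2 * k) (bd x) 0}"
  and subspace_bd: "pm.subspace {x. hcong pm.\<pi> (2 * k) (bd x) 0}"
proof -
  show s: "pm.subspace {x. hcong pm.\<pi> (2 * k) (bd x) 0}"
  proof (rule pm.subspaceI)
    show "0 \<in> {x. hcong pm.\<pi> (2 * k) (bd x) 0}" by (simp add: hcong_refl)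
  next
    fix x y assume "x \<in> {x. hcong pm.\<pi> (2 * k) (bd x) 0}" "y \<in> {x. hcong pm.\<pi> (2 * k) (bd x) 0}"
    then show "x + y \<in> {x. hcong pm.\<pi> (2 * k) (bd x) 0}"
      using hcong_add[of pm.\<pi> "2 * k" "bd x" 0 "bd y" 0] by (simp add: bd_add)
  next
    fix r x assume "x \<in> {x. hcong pm.\<pi> (2 * k) (bd x) 0}"
    then show "scl r x \<in> {x. hcong pm.\<pi> (2 * k) (bd x) 0}"
      using hcong_scale[of pm.\<pi> "2 * k" "bd x" 0 r] by (simp add: bd_scl)
  qed
  have z: "hcong pm.\<pi> (2 * k) (bd x) 0" if "x \<in> Zc" for x using that by (simp add: Zc_def hcong_refl)
  have "hcong pm.\<pi> (2 * k) (bd (scl pm.\<pi> x)) 0" if "x \<in> gm.chains" for x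
  proof -
    have "bd x \<in> V"
      unfolding bd_def by (intro homogeneous_sum homogeneous_diff bar_act_homogeneous chainsD(2)[OF that])
    then show ?thesis unfolding hcong_def by (intro bexI[of _ "bd x"]) (simp_all add: bd_scl)
  qed
  then have "Y \<union> (B \<union> scl pm.\<pi> ` gm.chains) \<subseteq> {x. hcong pm.\<pi> (2 * k) (bd x) 0}"
    using z Y_Zc B_subset_Zc by auto
  then show "L \<subseteq> {x. hcong pm.\<pi> (2 * k) (bd x) 0}" unfolding L_def using s by (rule pm.span_minimal)
qed

text \<open>The \<open>Phi\<close> terms add up to \<open>Phi (bd z) = 0\<close>, leaving an element
  \<open>s\<close> of \<open>F0\<close> modulo \<open>L\<close>. As \<open>Utilde z\<close> is a
  cycle, the boundary of \<open>s\<close> is divisible by p, and \<open>F0_L\<close>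
  applies.\<close>

lemma Utilde_L:
  assumes z: "z \<in> Zc"
  shows "Utilde z \<in> L"
proof -
  have zc: "z \<in> gm.chains" "bd z = 0" using z by (auto simp: Zc_def)
  let ?K = "Poly_Mapping.keys z" and ?z = "Poly_Mapping.lookup z"
  have "\<forall>g \<in> ?K. \<exists>f. f \<in> F0 \<and> u g (?z g) - f - (Phi (bar_act g (?z g)) - Phi (?z g)) \<in> L"
  proof
    fix g assume "g \<in> ?K"
    from u_mod_L[OF chainsD(1)[OF zc(1) this] chainsD(2)[OF zc(1)]]
    show "\<exists>f. f \<in> F0 \<and> u g (?z g) - f - (Phi (bar_act g (?z g)) - Phi (?z g)) \<in> L"
      unfolding Bex_def .
  qed
  from bchoice[OF this] obtain f where *: "\<forall>g \<in> ?K. f g \<in> F0 \<and>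
    u g (?z g) - f g - (Phi (bar_act g (?z g)) - Phi (?z g)) \<in> L" ..
  have f: "f g \<in> F0" "u g (?z g) - f g - (Phi (bar_act g (?z g)) - Phi (?z g)) \<in> L"
    if "g \<in> ?K" for g
    by (rule conjunct1[OF bspec[OF * that]]) (rule conjunct2[OF bspec[OF * that]])
  define s where "s = (\<Sum>g\<in>?K. f g)"
  have s: "s \<in> F0" unfolding s_def F0_def by (intro pm.span_sum) (use f(1) in \<open>simp add: F0_def\<close>)
  have "(\<Sum>g\<in>?K. Phi (bar_act g (?z g)) - Phi (?z g)) = Phi (bd z)"
    by (simp add: bd_def Phi_sum Phi_diff)
  then have ph: "(\<Sum>g\<in>?K. Phi (bar_act g (?z g)) - Phi (?z g)) = 0" by (simp add: zc(2) Phi_zero)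
  have "Utilde z - s = (\<Sum>g\<in>?K. u g (?z g)) - s - (\<Sum>g\<in>?K. Phi (bar_act g (?z g)) - Phi (?z g))"
    unfolding ph by (simp add: Utilde_def)
  also have "\<dots> = (\<Sum>g\<in>?K. u g (?z g) - f g - (Phi (bar_act g (?z g)) - Phi (?z g)))"
    by (simp add: s_def sum_subtractf)
  also have "\<dots> \<in> L" by (intro L_sum f(2))
  finally have d: "Utilde z - s \<in> L" .
  have "Utilde z \<in> {x. hcong pm.\<pi> (2 * k) (bd x) 0}" using Utilde_Zc[OF z] by (simp add: Zc_def hcong_refl)
  moreover have "Utilde z - s \<in> {x. hcong pm.\<pi> (2 * k) (bd x) 0}" using d L_bd by blast
  ultimately have "Utilde z - (Utilde z - s) \<in> {x. hcong pm.\<pi> (2 * k) (bd x) 0}"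
    by (rule pm.subspace_diff[OF subspace_bd])
  then have "hcong pm.\<pi> (2 * k) (bd s) 0" by simp
  then show ?thesis by (rule L_cancel[OF d F0_L[OF s]])
qed

lemma torsion_free_poly:
  assumes "const2 pm.\<pi> * P = (0 :: 'p padic_int poly2)"
  shows "P = 0"
proof (rule poly2_eqI)
  fix i j
  have "pm.\<pi> * coeff (coeff P i) j = 0" using coeff_const2_mult[of pm.\<pi> P i j] by (simp add: assms)
  then show "coeff (coeff P i) j = coeff (coeff 0 i) j" using padic_torsion_free by simp
qed

text \<open>Sharpens \<open>Utilde_L\<close> from p times a chain \<open>c\<close> to p times a
  cycle: p times \<open>bd c\<close> vanishes because all other terms are cycles, and the
  coefficients have no p-torsion.\<close>

lemma main_congruence:
  assumes z: "z \<in> Zc"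
  shows "\<exists>w \<in> pm.span Y. Utilde z - w \<in> pm.filt 1 Zc B"
proof -
  obtain w x where wx: "Utilde z = w + x" "w \<in> pm.span Y" "x \<in> pm.span (B \<union> scl pm.\<pi> ` gm.chains)"
    using Utilde_L[OF z] unfolding L_def pm.span_Un by blast
  have "B \<union> scl pm.\<pi> ` gm.chains \<subseteq> pm.filt 1 gm.chains B"
  proof
    fix y assume "y \<in> B \<union> scl pm.\<pi> ` gm.chains"
    then show "y \<in> pm.filt 1 gm.chains B"
    proof
      assume "y \<in> B"
      then show ?thesis using pm.subset_filt[OF subspace_chains] by blast
    next
      assume "y \<in> scl pm.\<pi> ` gm.chains"
      then obtain c where "c \<in> gm.chains" "y = scl pm.\<pi> c" by blast
      then show ?thesis using pm.subspace_0[OF subspace_B] by (intro pm.filtI[of c]) simp_all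
    qed
  qed
  then have "x \<in> pm.filt 1 gm.chains B"
    using pm.span_minimal[OF _ pm.subspace_filt[OF subspace_chains subspace_B]] wx(3) by blast
  then obtain c where c: "c \<in> gm.chains" "x - scl pm.\<pi> c \<in> B" unfolding pm.filt_def by auto
  have "w \<in> Zc" using wx(2) pm.span_minimal[OF Y_Zc subspace_Zc] by blast
  then have "Utilde z - w \<in> Zc" using Utilde_Zc[OF z] subspace_Zc by (intro pm.subspace_diff)
  then have xZ: "x \<in> Zc" by (simp add: wx(1))
  have "x - scl pm.\<pi> c \<in> Zc" using c(2) B_subset_Zc by blast
  with xZ have "x - (x - scl pm.\<pi> c) \<in> Zc" by (rule pm.subspace_diff[OF subspace_Zc])
  then have "const2 pm.\<pi> * bd c = 0" by (simp add: Zc_def bd_scl)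
  then have "c \<in> Zc" using c(1) torsion_free_poly by (simp add: Zc_def)
  then have "x \<in> pm.filt 1 Zc B" using c(2) by (intro pm.filtI[of c]) simp_all
  then show ?thesis using wx by (intro bexI[of _ w]) simp_all
qed

section \<open>Passage from chains back to homology\<close>

lemma Zc_finitely_generated: "\<exists>T. finite T \<and> Zc = pm.span (T \<union> B)"
proof -
  obtain S where S: "finite S" "gm.chains \<subseteq> pm.span (S \<union> B)" using chains_finitely_generated by blast
  have "Zc \<subseteq> pm.span (S \<union> B)" using S(2) by (auto simp: Zc_def)
  from pm.noetherian[OF S(1) subspace_B subspace_Zc B_subset_Zc this] show ?thesis by blast
qed

abbreviation cc :: "(mat2 set \<Rightarrow>\<^sub>0 'p padic_int poly2) \<Rightarrow> 'p padic_int chain" where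
  "cc \<equiv> gm.chain_class"

lemma Zc_chains: "x \<in> Zc \<Longrightarrow> x \<in> gm.chains"
  by (simp add: Zc_def)

lemma H1_eq: "(H1 \<Gamma> k :: 'p padic_int chain set) = cc ` Zc"
proof -
  have sub: "H1 \<Gamma> k \<subseteq> carrier gm.TP" by (auto simp: H1_def kernel_def IV_TP)
  show ?thesis
  proof (rule equalityI; rule subsetI)
    fix t :: "'p padic_int chain" assume t: "t \<in> H1 \<Gamma> k"
    then have "t \<in> cc ` gm.chains" unfolding gm.chain_class_surj using sub by (rule subsetD[rotated])
    then obtain x where x: "t = cc x" "x \<in> gm.chains" ..
    have "x \<in> Zc" using t unfolding x(1) by (rule iffD2[OF Zc_iff_H1[OF x(2)]])
    then show "t \<in> cc ` Zc" unfolding x(1) by (rule imageI)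
  next
    fix t assume "t \<in> cc ` Zc"
    then obtain x where x: "t = cc x" "x \<in> Zc" ..
    show "t \<in> H1 \<Gamma> k" unfolding x(1) using x(2) by (rule iffD1[OF Zc_iff_H1[OF Zc_chains[OF x(2)]]])
  qed
qed

lemma hecke_pow:
  assumes "x \<in> gm.chains"
  shows "(hecke \<Gamma> \<alpha> \<Gamma> k ^^ j) (cc x) = cc ((Utilde ^^ j) x) \<and> (Utilde ^^ j) x \<in> gm.chains"
  by (induction j) (simp_all add: assms hecke_chain Utilde_chains)

lemma cc_nat_pow:
  assumes "x \<in> gm.chains"
  shows "cc x [^]\<^bsub>gm.TP\<^esub> (n :: nat) = cc (scl (of_nat n) x)"
proof (induction n)
  case 0
  then show ?case by (simp add: gm.chain_class_zero)
next
  case (Suc n)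
  have "scl (of_nat (Suc n)) x = scl (of_nat n) x + x" by (simp add: pm.scale_left_distrib add.commute)
  then show ?case using Suc assms by (simp add: gm.chain_class_add scl_chains)
qed

text \<open>Powers in the multiplicative group \<open>TP\<close> are scalar multiples upstairs, so
  the neighbourhoods of \<open>padic_limit\<close> become the filtration
  \<open>filt\<close>.\<close>

lemma cc_multiples:
  assumes "y \<in> Zc"
  shows "cc y \<in> (\<lambda>u. u [^]\<^bsub>gm.TP\<^esub> (p ^ n)) ` H1 \<Gamma> k \<longleftrightarrow> y \<in> pm.filt n Zc B"
proof -
  have "cc y = cc w [^]\<^bsub>gm.TP\<^esub> (p ^ n) \<longleftrightarrow> y - scl (pm.\<pi> ^ n) w \<in> B" if "w \<in> Zc" for w
  proof -
    have w: "w \<in> gm.chains" using that by (rule Zc_chains)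
    have e: "(of_nat (p ^ n) :: 'p padic_int) = pm.\<pi> ^ n" by (simp add: card_p)
    show ?thesis
      unfolding cc_nat_pow[OF w] e by (rule chain_class_eq_iff[OF Zc_chains[OF assms] scl_chains[OF w]])
  qed
  then show ?thesis unfolding H1_eq pm.filt_def by auto
qed

text \<open>Both sides are described through classes of ordinary limits. That the span of the
  projected cycles is ordinary follows from linearity of limits; the converse is
  \<open>ordinary_generated\<close> fed with \<open>main_congruence\<close>.\<close>

theorem ordinary_part: "(hyp_ord p \<Gamma> k :: 'p padic_int chain set) = H1_ord p \<Gamma> k"
proof -
  obtain T where T: "finite T" "Zc = pm.span (T \<union> B)" using Zc_finitely_generated by blast
  interpret op: padic_operator "scl :: 'p padic_int \<Rightarrow> _" Utilde Zc B T
    by (rule padic_operator.intro[OF pm.padic_module_axioms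
          padic_operator_axioms.intro[OF Utilde_hom T(1) subspace_B T(2) Utilde_Zc Utilde_B]])
  have limit: "padic_limit p \<Gamma> k (\<lambda>m. (hecke \<Gamma> \<alpha> \<Gamma> k ^^ fact m) (cc z)) (cc l) \<longleftrightarrow> op.is_ord z l"
    if z: "z \<in> Zc" and l: "l \<in> Zc" for z l
  proof -
    have "(hecke \<Gamma> \<alpha> \<Gamma> k ^^ fact m) (cc z) \<otimes>\<^bsub>gm.TP\<^esub> inv\<^bsub>gm.TP\<^esub> cc l \<in> (\<lambda>u. u [^]\<^bsub>gm.TP\<^esub> (p ^ n)) ` H1 \<Gamma> k
       \<longleftrightarrow> (Utilde ^^ fact m) z - l \<in> pm.filt n Zc B" for m n
    proof -
      have h: "(hecke \<Gamma> \<alpha> \<Gamma> k ^^ fact m) (cc z) = cc ((Utilde ^^ fact m) z)" "(Utilde ^^ fact m) z \<in> gm.chains"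
        using hecke_pow[OF Zc_chains[OF z]] by blast+
      have y: "(Utilde ^^ fact m) z - l \<in> Zc"
        using op.pow_Z[OF z] l by (intro pm.subspace_diff[OF subspace_Zc])
      have "cc ((Utilde ^^ fact m) z) \<otimes>\<^bsub>gm.TP\<^esub> inv\<^bsub>gm.TP\<^esub> cc l = cc ((Utilde ^^ fact m) z - l)"
        using gm.chain_class_diff[OF h(2) Zc_chains[OF l]] by simp
      then show ?thesis unfolding h(1) using cc_multiples[OF y] by simp
    qed
    then show ?thesis
      unfolding padic_limit_def op.is_ord_def IV_TP eventually_sequentially H1_eq[symmetric]
      using l by (simp add: H1_eq)
  qed
  have cc_eq: "cc x = cc y \<longleftrightarrow> x - y \<in> B" if "x \<in> Zc" "y \<in> Zc" for x y
    using that by (intro chain_class_eq_iff Zc_chains)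
  \<comment> \<open>Uniqueness of the limit modulo \<open>B\<close> becomes genuine uniqueness of
    its class, as the \<open>THE\<close> demands.\<close>
  have proj: "ord_projector p \<Gamma> k (cc z) = cc l" if z: "z \<in> Zc" and l: "op.is_ord z l" for z l
    unfolding ord_projector_def
  proof (rule the_equality)
    have lZ: "l \<in> Zc" using l by (simp add: op.is_ord_def)
    show "padic_limit p \<Gamma> k (\<lambda>m. (hecke \<Gamma> \<alpha> \<Gamma> k ^^ fact m) (cc z)) (cc l)" using limit[OF z lZ] l by simp
    fix t assume t: "padic_limit p \<Gamma> k (\<lambda>m. (hecke \<Gamma> \<alpha> \<Gamma> k ^^ fact m) (cc z)) t"
    then have "t \<in> cc ` Zc" by (simp add: padic_limit_def H1_eq)
    then obtain l' where l': "l' \<in> Zc" "t = cc l'" by blast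
    then have "op.is_ord z l'" using limit[OF z l'(1)] t by simp
    then show "t = cc l" using op.is_ord_unique[OF _ l] cc_eq[OF l'(1) lZ] l'(2) by blast
  qed
  have H1o: "(H1_ord p \<Gamma> k :: 'p padic_int chain set) = {cc l | l. \<exists>z \<in> Zc. op.is_ord z l}"
  proof (intro equalityI subsetI)
    fix t :: "'p padic_int chain" assume "t \<in> H1_ord p \<Gamma> k"
    then obtain z where z: "z \<in> Zc" "t = ord_projector p \<Gamma> k (cc z)" by (auto simp: H1_ord_def H1_eq)
    then show "t \<in> {cc l | l. \<exists>z \<in> Zc. op.is_ord z l}" using op.is_ord_exists[OF z(1)] proj[OF z(1)] by auto
  next
    fix t assume "t \<in> {cc l | l. \<exists>z \<in> Zc. op.is_ord z l}"
    then obtain l z where lz: "t = cc l" "z \<in> Zc" "op.is_ord z l" by blast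
    show "t \<in> H1_ord p \<Gamma> k"
      unfolding H1_ord_def H1_eq lz(1) proj[OF lz(2,3), symmetric] using lz(2) by blast
  qed
  define gens :: "'p padic_int chain set" where
    "gens = (\<lambda>g. ord_projector p \<Gamma> k (hyp_cycle \<Gamma> k g)) ` hyperbolic_elements \<Gamma>"
  have gens: "gens = {cc l | l. \<exists>y \<in> Y. op.is_ord y l}"
  proof -
    have cyc: "hyp_cycle \<Gamma> k g = cc (sg g (base_change (Q_form g ^ k)))" if "g \<in> hyperbolic_elements \<Gamma>" for g
    proof -
      have "g \<in> carrier (bar_group \<Gamma>)" using that by (simp add: hyperbolic_elements_def carrier_bar_group)
      then show ?thesis
        unfolding hyp_cycle_def pure_tensor_pt minus_one_gm1
        using gm.chain_class_single Q_form_invariant(1)[OF that] by simp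
    qed
    have "gens = (\<lambda>y. ord_projector p \<Gamma> k (cc y)) ` Y"
      unfolding gens_def Y_def image_image by (intro image_cong refl) (simp add: cyc)
    also have "\<dots> = {cc l | l. \<exists>y \<in> Y. op.is_ord y l}"
    proof (intro equalityI subsetI)
      fix t assume "t \<in> (\<lambda>y. ord_projector p \<Gamma> k (cc y)) ` Y"
      then obtain y where y: "y \<in> Y" "t = ord_projector p \<Gamma> k (cc y)" by blast
      then have "y \<in> Zc" using Y_Zc by blast
      then show "t \<in> {cc l | l. \<exists>y \<in> Y. op.is_ord y l}" using y op.is_ord_exists proj by blast
    next
      fix t assume "t \<in> {cc l | l. \<exists>y \<in> Y. op.is_ord y l}"
      then obtain y l where "y \<in> Y" "t = cc l" "op.is_ord y l" by blast
      then show "t \<in> (\<lambda>y. ord_projector p \<Gamma> k (cc y)) ` Y" using proj[of y l] Y_Zc by blast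
    qed
    finally show ?thesis .
  qed
  have ordZ: "l \<in> Zc" if "op.is_ord z l" for z l using that by (simp add: op.is_ord_def)
  have ho: "hyp_ord p \<Gamma> k = submodule_generated \<Gamma> k gens" by (simp add: hyp_ord_def gens_def)
  show ?thesis
    unfolding ho H1o
  proof (intro equalityI subsetI)
    fix t assume "t \<in> submodule_generated \<Gamma> k gens"
    then show "t \<in> {cc l | l. \<exists>z \<in> Zc. op.is_ord z l}"
    proof (induction rule: submodule_generated.induct)
      case zero
      have "\<one>\<^bsub>IV \<Gamma> k\<^esub> = cc 0" by (simp add: IV_TP gm.chain_class_zero)
      then show ?case using op.is_ord_B[OF pm.subspace_0[OF subspace_B]] pm.subspace_0[OF subspace_Zc] by blast
    next
      case (base t)
      then show ?case unfolding gens using Y_Zc by blast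
    next
      case (add t u)
      then obtain l l' z z' where *: "t = cc l" "z \<in> Zc" "op.is_ord z l" "u = cc l'" "z' \<in> Zc" "op.is_ord z' l'" by blast
      have "t \<otimes>\<^bsub>IV \<Gamma> k\<^esub> u = cc (l + l')"
        using * ordZ Zc_chains by (simp add: IV_TP gm.chain_class_add)
      then show ?case using op.is_ord_add[OF *(3,6)] pm.subspace_add[OF subspace_Zc *(2,5)] by blast
    next
      case (scale t r)
      then obtain l z where *: "t = cc l" "z \<in> Zc" "op.is_ord z l" by blast
      have "scalar_mult \<Gamma> k r t = cc (scl r l)"
        unfolding *(1) using ordZ[OF *(3)] by (intro scalar_chain Zc_chains)
      then show ?case using op.is_ord_scale[OF *(3)] pm.subspace_scale[OF subspace_Zc *(2)] by blast
    qed
  next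
    fix t assume "t \<in> {cc l | l. \<exists>z \<in> Zc. op.is_ord z l}"
    then obtain l z where *: "t = cc l" "z \<in> Zc" "op.is_ord z l" by blast
    obtain w where w: "w \<in> pm.span Y" "op.is_ord w l"
      using op.ordinary_generated[OF Y_Zc main_congruence *(2,3)] by blast
    \<comment> \<open>The claim ranges over all limits of \<open>w\<close>: a limit is determined
      only modulo \<open>B\<close>, and the induction hypothesis must apply to whichever one
      occurs.\<close>
    have "w \<in> Zc \<and> (\<forall>l. op.is_ord w l \<longrightarrow> cc l \<in> submodule_generated \<Gamma> k gens)"
      using w(1)
    proof (induction rule: pm.span_induct_alt)
      case base
      show ?case
      proof (intro conjI allI impI)
        show "0 \<in> Zc" by (rule pm.subspace_0[OF subspace_Zc])
        fix l assume l: "op.is_ord 0 l"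
        have "l - 0 \<in> B" using op.is_ord_unique[OF l op.is_ord_B[OF pm.subspace_0[OF subspace_B]]] .
        then have "cc l = \<one>\<^bsub>IV \<Gamma> k\<^esub>" by (simp add: B_def IV_TP)
        then show "cc l \<in> submodule_generated \<Gamma> k gens" by (simp add: submodule_generated.zero)
      qed
    next
      case (step c y w)
      have yZ: "y \<in> Zc" using step(1) Y_Zc by blast
      have wZ: "w \<in> Zc" using step(2) by blast
      show ?case
      proof (intro conjI allI impI)
        show "scl c y + w \<in> Zc"
          by (rule pm.subspace_add[OF subspace_Zc pm.subspace_scale[OF subspace_Zc yZ] wZ])
        fix l assume l: "op.is_ord (scl c y + w) l"
        from yZ obtain ly where ly: "op.is_ord y ly" using op.is_ord_exists by blast
        have "l \<in> Zc" using ordZ[OF l] .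
        from wZ obtain lw where lw: "op.is_ord w lw" using op.is_ord_exists by blast
        have lin: "op.is_ord (scl c y + w) (scl c ly + lw)" by (intro op.is_ord_add op.is_ord_scale ly lw)
        have ch: "ly \<in> gm.chains" "lw \<in> gm.chains" using ordZ[OF ly] ordZ[OF lw] Zc_chains by auto
        have "cc l = cc (scl c ly + lw)"
          using op.is_ord_unique[OF l lin] cc_eq[OF ordZ[OF l] ordZ[OF lin]] by blast
        also have "\<dots> = scalar_mult \<Gamma> k c (cc ly) \<otimes>\<^bsub>IV \<Gamma> k\<^esub> cc lw"
          using ch by (simp add: IV_TP gm.chain_class_add scl_chains scalar_chain)
        also have "\<dots> \<in> submodule_generated \<Gamma> k gens"
        proof (intro submodule_generated.add submodule_generated.scale)
          show "cc ly \<in> submodule_generated \<Gamma> k gens"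
            using step(1) ly by (intro submodule_generated.base) (auto simp: gens)
          show "cc lw \<in> submodule_generated \<Gamma> k gens" using step lw by blast
        qed
        finally show "cc l \<in> submodule_generated \<Gamma> k gens" .
      qed
    qed
    then show "t \<in> submodule_generated \<Gamma> k gens" using w(2) *(1) by blast
  qed
qed

end

theorem theorem1p2:
  fixes p N k :: nat and \<Gamma> :: "mat2 set"
  assumes "prime p" and "CARD('p :: prime_card) = p"
    and "N > 0"
    and "congruence_subgroup \<Gamma>"
    and "Gamma1 N \<subseteq> \<Gamma>" and "\<Gamma> \<subseteq> Gamma0 N"
  shows "(hyp_ord p \<Gamma> k :: 'p padic_int chain set) = H1_ord p \<Gamma> k"
proof -
  \<comment> \<open>This principal level serves finite generation; it is chosen independently of
    \<open>N\<close>, which supplies the unipotents \<open>T\<close> and \<open>g0\<close>.\<close>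
  obtain M where M: "M > 0" "Gamma_principal M \<subseteq> \<Gamma>" "subgroup \<Gamma> SL2Z"
    using assms(4) unfolding congruence_subgroup_def by blast
  interpret hecke_setup \<Gamma> M p
    using M prime_gt_0_nat[OF assms(1)] by (intro hecke_setup.intro)
  interpret hecke_padic \<Gamma> M p k "TYPE('p padic_int)" N
    by unfold_locales (use assms in simp_all)
  show ?thesis by (rule ordinary_part)
qed

end
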